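(* Let $n \geq 2$ and let $\Sigma \subseteq \mathbb{C}^n$ be a compact and connected star-shaped hypersurface invariant under the rotation $$\varphi \colon \mathbb{C}^n \to \mathbb{C}^n, \qquad \varphi(z_1,\dots,z_n) := \left(e^{2\pi i k_1/m}z_1,\dots,e^{2\pi i k_n/m}z_n\right)$$ for some even $m \geq 2$ and $k_1,\dots,k_n \in \mathbb{Z}$ coprime to $m$. Then the quotient $\Sigma/\mathbb{Z}_m$ (by the free $\mathbb{Z}_m$-action generated by $\varphi|_\Sigma$) admits a noncontractible periodic Reeb orbit.
   Context: $\mathbb{C}^n$ carries the one-form $\lambda = \frac{1}{2}\sum_{j=1}^n (y_j\,dx_j - x_j\,dy_j)$, $z_j = x_j + i y_j$. A compact connected star-shaped hypersurface is a smooth boundary $\Sigma = \partial U$ of a bounded connected open set $U\subseteq \mathbb{C}^n$ that is star-shaped with respect to the origin, such that the radial (Liouville) vector field $X = \frac12\sum_j (x_j\partial_{x_j}+y_j\partial_{y_j})$ is transverse to (outward-pointing along) $\Sigma$. Then $\lambda|_\Sigma$ is a contact form; its Reeb vector field $R$ is determined by $i_R d\lambda|_\Sigma = 0$, $\lambda(R)=1$. Invariance means $\varphi(\Sigma) = \Sigma$. Since $\varphi^*\lambda = \lambda$, the contact form $\lambda|_\Sigma$ descends to a contact form on $\Sigma/\mathbb{Z}_m$, and Reeb orbits on $\Sigma/\mathbb{Z}_m$ are taken with respect to it. Noncontractible means not null-homotopic as a loop in $\Sigma/\mathbb{Z}_m$. *)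

theory Defs
  imports "HOL-Analysis.Analysis"
begin

section \<open>Smooth star-shaped hypersurfaces\<close>

text \<open>Only meant for open \<open>S\<close>. Quantifying over all fixed directions \<open>v\<close> amounts to
  quantifying over all partial derivatives.\<close>

primrec Ck_on :: "nat \<Rightarrow> ('a::euclidean_space \<Rightarrow> 'b::real_normed_vector) \<Rightarrow> 'a set \<Rightarrow> bool" where
  "Ck_on 0 f S \<longleftrightarrow> continuous_on S f"
| "Ck_on (Suc k) f S \<longleftrightarrow>
     (\<forall>x\<in>S. f differentiable (at x)) \<and>
     (\<forall>v. Ck_on k (\<lambda>x. frechet_derivative f (at x) v) S)"

definition smooth_on :: "('a::euclidean_space \<Rightarrow> 'b::real_normed_vector) \<Rightarrow> 'a set \<Rightarrow> bool" where
  "smooth_on f S \<longleftrightarrow> (\<forall>k. Ck_on k f S)"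

definition local_equation :: "'a::euclidean_space set \<Rightarrow> 'a set \<Rightarrow> ('a \<Rightarrow> real) \<Rightarrow> bool" where
  "local_equation S W \<rho> \<longleftrightarrow>
     open W \<and> smooth_on \<rho> W \<and> S \<inter> W = {x \<in> W. \<rho> x = 0} \<and>
     (\<forall>x \<in> S \<inter> W. frechet_derivative \<rho> (at x) \<noteq> (\<lambda>v. 0))"

text \<open>The tangent space of a hypersurface is the kernel of the differential of a local equation;
  it does not depend on the choice of the equation.\<close>

definition tangent_space :: "'a::euclidean_space set \<Rightarrow> 'a \<Rightarrow> 'a set" where
  "tangent_space S x =
     {v. \<exists>W \<rho>. x \<in> W \<and> local_equation S W \<rho> \<and> frechet_derivative \<rho> (at x) v = 0}"

definition tangent_bundle :: "'a::euclidean_space set \<Rightarrow> ('a \<times> 'a) set" where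
  "tangent_bundle S = Sigma S (tangent_space S)"

definition boundary_equation :: "'a::euclidean_space set \<Rightarrow> 'a set \<Rightarrow> ('a \<Rightarrow> real) \<Rightarrow> bool" where
  "boundary_equation U W \<rho> \<longleftrightarrow>
     local_equation (frontier U) W \<rho> \<and> U \<inter> W = {x \<in> W. \<rho> x < 0}"

definition smooth_boundary :: "'a::euclidean_space set \<Rightarrow> bool" where
  "smooth_boundary U \<longleftrightarrow> (\<forall>x \<in> frontier U. \<exists>W \<rho>. x \<in> W \<and> boundary_equation U W \<rho>)"

definition outward_pointing :: "'a::euclidean_space set \<Rightarrow> ('a \<Rightarrow> 'a) \<Rightarrow> bool" where
  "outward_pointing U X \<longleftrightarrow>
     (\<forall>x \<in> frontier U. \<forall>W \<rho>. x \<in> W \<and> boundary_equation U W \<rho> \<longrightarrow>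
        frechet_derivative \<rho> (at x) (X x) > 0)"

definition liouville_field :: "'a::euclidean_space \<Rightarrow> 'a" where
  "liouville_field x = (1/2) *\<^sub>R x"

definition star_shaped_hypersurface :: "'a::euclidean_space set \<Rightarrow> bool" where
  "star_shaped_hypersurface S \<longleftrightarrow>
     (\<exists>U. open U \<and> bounded U \<and> connected U \<and>
          0 \<in> U \<and> (\<forall>x\<in>U. closed_segment 0 x \<subseteq> U) \<and>
          S = frontier U \<and> smooth_boundary U \<and> outward_pointing U liouville_field)"

section \<open>The one-form and the rotation\<close>

text \<open>A one-form \<open>\<alpha>\<close> on a Euclidean space is written as \<open>\<alpha> x v\<close>, with base point \<open>x\<close> and tangent
  vector \<open>v\<close>. The formula for the exterior derivative is the invariant one
  \<open>d\<alpha>(V, W) = V(\<alpha>(W)) - W(\<alpha>(V)) - \<alpha>([V, W])\<close> for the constant vector fields \<open>u\<close> and \<open>v\<close>.\<close>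

definition ext_deriv :: "('a::euclidean_space \<Rightarrow> 'a \<Rightarrow> real) \<Rightarrow> 'a \<Rightarrow> 'a \<Rightarrow> 'a \<Rightarrow> real" where
  "ext_deriv \<alpha> x u v =
     frechet_derivative (\<lambda>y. \<alpha> y v) (at x) u - frechet_derivative (\<lambda>y. \<alpha> y u) (at x) v"

definition liouville_form :: "complex ^ 'n \<Rightarrow> complex ^ 'n \<Rightarrow> real" where
  "liouville_form z v = 1/2 * (\<Sum>j\<in>UNIV. Im (z $ j) * Re (v $ j) - Re (z $ j) * Im (v $ j))"

definition rotation :: "nat \<Rightarrow> ('n \<Rightarrow> int) \<Rightarrow> complex ^ 'n \<Rightarrow> complex ^ 'n" where
  "rotation m k z = (\<chi> j. exp (2 * of_real pi * \<i> * of_int (k j) / of_nat m) * z $ j)"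

section \<open>Quotients by the action generated by a map\<close>

text \<open>The relation is only used for maps of finite order, so that natural powers suffice.\<close>

definition action_rel :: "'b set \<Rightarrow> ('b \<Rightarrow> 'b) \<Rightarrow> ('b \<times> 'b) set" where
  "action_rel A f = {(x, y). x \<in> A \<and> y \<in> A \<and> (\<exists>i::nat. y = (f ^^ i) x)}"

definition orbit_proj :: "'b set \<Rightarrow> ('b \<Rightarrow> 'b) \<Rightarrow> 'b \<Rightarrow> 'b set" where
  "orbit_proj A f x = action_rel A f `` {x}"

definition quotient_topology :: "'b topology \<Rightarrow> ('b \<Rightarrow> 'c) \<Rightarrow> 'c topology" where
  "quotient_topology X p =
     topology (\<lambda>V. V \<subseteq> p ` topspace X \<and> openin X {x \<in> topspace X. p x \<in> V})"

lemma quotient_map_quotient_topology: "quotient_map X (quotient_topology X p) p"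
proof -
  have "istopology (\<lambda>V. V \<subseteq> p ` topspace X \<and> openin X {x \<in> topspace X. p x \<in> V})"
    unfolding istopology_def
  proof (intro conjI allI impI; (elim conjE)?)
    fix S T
    assume "openin X {x \<in> topspace X. p x \<in> S}" "openin X {x \<in> topspace X. p x \<in> T}"
    then have "openin X ({x \<in> topspace X. p x \<in> S} \<inter> {x \<in> topspace X. p x \<in> T})"
      by (rule openin_Int)
    also have "{x \<in> topspace X. p x \<in> S} \<inter> {x \<in> topspace X. p x \<in> T} =
      {x \<in> topspace X. p x \<in> S \<inter> T}" by auto
    finally show "openin X {x \<in> topspace X. p x \<in> S \<inter> T}" .
  next
    fix K
    assume "\<forall>V\<in>K. V \<subseteq> p ` topspace X \<and> openin X {x \<in> topspace X. p x \<in> V}"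
    then have "openin X (\<Union>V\<in>K. {x \<in> topspace X. p x \<in> V})" by auto
    also have "(\<Union>V\<in>K. {x \<in> topspace X. p x \<in> V}) = {x \<in> topspace X. p x \<in> \<Union>K}" by auto
    finally show "openin X {x \<in> topspace X. p x \<in> \<Union>K}" .
  qed auto
  then have op: "openin (quotient_topology X p) V \<longleftrightarrow>
      V \<subseteq> p ` topspace X \<and> openin X {x \<in> topspace X. p x \<in> V}" for V
    by (simp add: quotient_topology_def topology_inverse')
  have "{x \<in> topspace X. p x \<in> p ` topspace X} = topspace X" by auto
  then have "openin (quotient_topology X p) (p ` topspace X)" using op by auto
  then have "topspace (quotient_topology X p) = p ` topspace X"
    using op openin_subset openin_topspace by (metis subset_antisym)
  then show ?thesis by (auto simp: quotient_map_def op)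
qed

definition quotient_space :: "'a::euclidean_space set \<Rightarrow> ('a \<Rightarrow> 'a) \<Rightarrow> 'a set topology" where
  "quotient_space S f = quotient_topology (top_of_set S) (orbit_proj S f)"

text \<open>When the action on the hypersurface \<open>S\<close> is free, \<open>S / f\<close> is the manifold for which the
  projection is a local diffeomorphism. Its tangent bundle is the quotient of the tangent bundle of
  \<open>S\<close> by the tangent map of \<open>f\<close>: the tangent vector represented by \<open>(x, v)\<close> is the image of \<open>v\<close>
  under the differential of the projection at \<open>x\<close>, and \<open>fst ` \<xi>\<close> is the base point of the tangent
  vector \<open>\<xi>\<close>.\<close>

definition tangent_map :: "('a::euclidean_space \<Rightarrow> 'a) \<Rightarrow> 'a \<times> 'a \<Rightarrow> 'a \<times> 'a" where
  "tangent_map f = (\<lambda>(x, v). (f x, frechet_derivative f (at x) v))"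

definition quot_tangent_proj ::
  "'a::euclidean_space set \<Rightarrow> ('a \<Rightarrow> 'a) \<Rightarrow> 'a \<times> 'a \<Rightarrow> ('a \<times> 'a) set" where
  "quot_tangent_proj S f = orbit_proj (tangent_bundle S) (tangent_map f)"

definition quot_tangent_space ::
  "'a::euclidean_space set \<Rightarrow> ('a \<Rightarrow> 'a) \<Rightarrow> 'a set \<Rightarrow> ('a \<times> 'a) set set" where
  "quot_tangent_space S f q =
     {\<xi> \<in> tangent_bundle S // action_rel (tangent_bundle S) (tangent_map f). fst ` \<xi> = q}"

text \<open>The forms on \<open>S / f\<close> whose pullbacks to \<open>S\<close> are the restrictions of the invariant forms \<open>\<alpha>\<close>
  and \<open>\<omega>\<close>. The exterior derivative of the descended form of \<open>\<alpha>\<close> is the descended form of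
  \<open>ext_deriv \<alpha>\<close>, as exterior derivatives commute with pullbacks.\<close>

definition descend1 :: "('a \<Rightarrow> 'a \<Rightarrow> real) \<Rightarrow> ('a \<times> 'a) set \<Rightarrow> real" where
  "descend1 \<alpha> \<xi> = (THE r. \<exists>x v. (x, v) \<in> \<xi> \<and> r = \<alpha> x v)"

definition descend2 ::
  "('a \<Rightarrow> 'a \<Rightarrow> 'a \<Rightarrow> real) \<Rightarrow> ('a \<times> 'a) set \<Rightarrow> ('a \<times> 'a) set \<Rightarrow> real" where
  "descend2 \<omega> \<xi> \<eta> = (THE r. \<exists>x u v. (x, u) \<in> \<xi> \<and> (x, v) \<in> \<eta> \<and> r = \<omega> x u v)"

section \<open>Reeb orbits on the quotient\<close>

definition is_reeb_vector ::
  "('a::euclidean_space \<Rightarrow> 'a \<Rightarrow> real) \<Rightarrow> 'a set \<Rightarrow> ('a \<Rightarrow> 'a) \<Rightarrow> 'a set \<Rightarrow> ('a \<times> 'a) set \<Rightarrow> bool"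
where
  "is_reeb_vector \<alpha> S f q \<xi> \<longleftrightarrow>
     \<xi> \<in> quot_tangent_space S f q \<and>
     descend1 \<alpha> \<xi> = 1 \<and>
     (\<forall>\<eta> \<in> quot_tangent_space S f q. descend2 (ext_deriv \<alpha>) \<xi> \<eta> = 0)"

text \<open>As the projection is a local diffeomorphism, curves in the quotient are differentiated by
  means of local lifts.\<close>

definition quot_velocity ::
  "'a::euclidean_space set \<Rightarrow> ('a \<Rightarrow> 'a) \<Rightarrow> (real \<Rightarrow> 'a set) \<Rightarrow> real \<Rightarrow> ('a \<times> 'a) set \<Rightarrow> bool"
where
  "quot_velocity S f \<gamma> t \<xi> \<longleftrightarrow>
     (\<exists>c v. (\<forall>\<^sub>F s in nhds t. c s \<in> S \<and> \<gamma> s = orbit_proj S f (c s)) \<and>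
            (c has_vector_derivative v) (at t) \<and>
            \<xi> = quot_tangent_proj S f (c t, v))"

text \<open>\<open>T\<close> is a period of the orbit, not necessarily the minimal one.\<close>

definition periodic_reeb_orbit ::
  "('a::euclidean_space \<Rightarrow> 'a \<Rightarrow> real) \<Rightarrow> 'a set \<Rightarrow> ('a \<Rightarrow> 'a) \<Rightarrow> real \<Rightarrow> (real \<Rightarrow> 'a set) \<Rightarrow> bool"
where
  "periodic_reeb_orbit \<alpha> S f T \<gamma> \<longleftrightarrow>
     T > 0 \<and> (\<forall>t. \<gamma> (t + T) = \<gamma> t) \<and>
     (\<forall>t. \<exists>\<xi>. quot_velocity S f \<gamma> t \<xi> \<and> is_reeb_vector \<alpha> S f (\<gamma> t) \<xi>)"

text \<open>Free homotopy of loops parametrised by \<open>[0, 1]\<close>, as in \<^const>\<open>homotopic_loops\<close>, which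
  is only available for subsets of a type of class \<open>topological_space\<close>.\<close>

definition null_homotopic_loop :: "'b topology \<Rightarrow> (real \<Rightarrow> 'b) \<Rightarrow> bool" where
  "null_homotopic_loop Y p \<longleftrightarrow>
     (\<exists>y \<in> topspace Y.
        homotopic_with (\<lambda>r. r 1 = r 0) (top_of_set {0..1}) Y p (\<lambda>_. y))"

end

theory Submission
  imports Defs "HOL-Homology.Homology" "HOL-Complex_Analysis.Great_Picard"
begin

text \<open>As the \<open>k j\<close> are odd, the power \<open>m / 2\<close> of the rotation is \<open>- id\<close>. Let \<open>H\<close> be the square of the
  Minkowski functional of the star-shaped domain: it is \<open>C\<^sup>1\<close>, even and homogeneous of degree 2, and
  the Reeb field on \<open>\<Sigma> = {H = 1}\<close> is \<open>- \<i> \<nabla>H\<close>. An orbit that satisfies \<open>z (t + l) = - z t\<close> closes up in the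
  quotient, but its lift does not, so that it is noncontractible.

  To find such an orbit, discretise antiperiodic loops by \<open>N\<close> points \<open>(q i, p i)\<close> and look for critical
  points of the quotient of the discrete action \<open>N \<Sum> p i \<bullet> (q (i + 1) - q i)\<close> by \<open>\<Sum> H (q i, p i)\<close>. On
  antiperiodic loops the action is nondegenerate: it is at most 0 on \<open>p = - N dq\<close> and bounded below
  by a multiple of the squared norm on \<open>p = N dq\<close>. The first subspace is the boundary of a half
  space that links with the second one (there is no retraction of a ball to its sphere), and the
  action on the half space has an upper bound independent of \<open>N\<close>. If there were no almost critical
  point with value between the two bounds, gradient steps would push the half space below the lower
  bound, which contradicts linking. The almost critical points satisfy the symplectic Euler scheme for
  Hamilton's equations up to an error that vanishes as \<open>N \<longlonglongrightarrow> \<infinity>\<close>; by the Arzela-Ascoli theorem they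
  converge to an antiperiodic solution.\<close>

text \<open>The action is unbounded in both directions, so that no minimisation finds the orbit, and
  on loops its positive and negative spaces are both infinite-dimensional. Discretisation makes a
  linking argument by finite-dimensional topology possible, provided that whatever has to survive
  the limit is bounded independently of \<open>N\<close>. Only the two bounds for the quotient are
  of this kind; step sizes and numbers of steps may depend on \<open>N\<close>. The quotient is
  invariant under scaling, and its critical value \<open>l\<close> is the multiplier in Hamilton's
  equations on loops of length 1, that is, the period of the orbit in the quotient manifold; the
  bounds keep it away from 0 and infinity. The action is nondegenerate because a constant
  antiperiodic sequence vanishes. The squared Minkowski functional need not be twice differentiable
  at the origin, where discrete loops may pass. Hence its gradient is treated as merely continuous,
  and the descent takes finite steps with a remainder estimate in place of a flow.\<close>

section \<open>No retraction of a ball to its sphere\<close>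

text \<open>A map of the ball that fixes the boundary sphere and has no zero would, after
  normalisation, contract the sphere. Vectors are sequences that vanish from \<open>d\<close> on,
  because the dimension grows with the number of points of the discretisation and so cannot be part
  of the type.\<close>

lemma no_retraction_nat:
  fixes g :: "(nat \<Rightarrow> real) \<Rightarrow> nat \<Rightarrow> real" and d :: nat
  defines "D \<equiv> {u. (\<forall>i\<ge>d. u i = 0) \<and> (\<Sum>i<d. (u i)\<^sup>2) \<le> 1}"
  assumes d: "d > 0"
    and cont: "\<And>i. i < d \<Longrightarrow> continuous_on D (\<lambda>u. g u i)"
    and bd: "\<And>u i. u \<in> D \<Longrightarrow> (\<Sum>i<d. (u i)\<^sup>2) = 1 \<Longrightarrow> i < d \<Longrightarrow> g u i = u i"
  shows "\<exists>u\<in>D. \<forall>i<d. g u i = 0"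
proof (rule ccontr)
  assume neg: "\<not> ?thesis"
  define n where "n = d - 1"
  have dn: "d = Suc n" using d by (simp add: n_def)
  define S where "S = {x::nat\<Rightarrow>real. (\<Sum>i\<le>n. (x i)\<^sup>2) = 1 \<and> (\<forall>i>n. x i = 0)}"
  have ns: "nsphere n = top_of_set S"
    unfolding nsphere S_def by (simp add: euclidean_product_topology)
  have ne: "(\<Sum>i<d. (g u i)\<^sup>2) > 0" if "u \<in> D" for u
  proof -
    from neg that obtain j where j: "j < d" "g u j \<noteq> 0" by blast
    then have "(\<Sum>i<d. (g u i)\<^sup>2) \<ge> (g u j)\<^sup>2"
      by (intro member_le_sum) auto
    with j show ?thesis by (smt (verit) zero_less_power2)
  qed
  \<comment> \<open>As \<open>s\<close> goes from 1 to 0, the normalised values of \<open>g\<close>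
    deform the identity of the sphere into a constant map.\<close>
  define h where "h = (\<lambda>(s::real, x) i. if i < d
     then g (\<lambda>j. s * x j) i / sqrt (\<Sum>k<d. (g (\<lambda>j. s * x j) k)\<^sup>2) else 0)"
  have sc: "(\<lambda>j. s * x j) \<in> D" if "s \<in> {0..1}" "x \<in> S" for s x
  proof -
    have "s\<^sup>2 \<le> 1" using that by (simp add: power_le_one)
    then show ?thesis using that
      by (auto simp: D_def S_def dn power_mult_distrib lessThan_Suc_atMost simp flip: sum_distrib_left)
  qed
  have contsc: "continuous_on ({0..1} \<times> S) (\<lambda>y. (\<lambda>j. fst y * snd y j))"
  proof (intro continuous_on_coordinatewise_then_product continuous_on_mult continuous_on_fst continuous_on_id)
    fix j
    show "continuous_on ({0..1::real} \<times> S) (\<lambda>y. snd y j)"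
      by (rule continuous_on_compose2[OF continuous_on_product_coordinates continuous_on_snd[OF continuous_on_id]]) simp
  qed
  have contg: "continuous_on ({0..1} \<times> S) (\<lambda>y. g (\<lambda>j. fst y * snd y j) i)" if "i < d" for i
    by (rule continuous_on_compose2[OF cont[OF that] contsc]) (use sc in auto)
  have conth: "continuous_on ({0..1} \<times> S) h"
  proof (intro continuous_on_coordinatewise_then_product)
    fix i
    show "continuous_on ({0..1} \<times> S) (\<lambda>x. h x i)"
    proof (cases "i < d")
      case True
      have "continuous_on ({0..1} \<times> S) (\<lambda>y. g (\<lambda>j. fst y * snd y j) i / sqrt (\<Sum>k<d. (g (\<lambda>j. fst y * snd y j) k)\<^sup>2))"
        by (intro continuous_intros contg True) (use ne sc in \<open>fastforce+\<close>)
      then show ?thesis using True by (simp add: h_def case_prod_beta)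
    qed (simp add: h_def case_prod_beta)
  qed
  have hS: "h y \<in> S" if "y \<in> {0..1} \<times> S" for y
  proof -
    obtain s x where y: "y = (s, x)" by force
    have *: "(\<Sum>k<d. (g (\<lambda>j. s * x j) k)\<^sup>2) > 0" using ne sc that y by auto
    have "(\<Sum>i<d. (h y i)\<^sup>2) = (\<Sum>i<d. (g (\<lambda>j. s * x j) i)\<^sup>2 / (\<Sum>k<d. (g (\<lambda>j. s * x j) k)\<^sup>2))"
      using * by (intro sum.cong) (auto simp: h_def y power_divide)
    also have "\<dots> = 1" using * by (simp flip: sum_divide_distrib)
    finally show ?thesis by (auto simp: S_def dn lessThan_Suc_atMost h_def y)
  qed
  have h1: "h (1, x) = x" if "x \<in> S" for x
  proof -
    have x: "(\<Sum>i<d. (x i)\<^sup>2) = 1" using that by (simp add: S_def dn lessThan_Suc_atMost)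
    have xD: "x \<in> D" using sc[of 1 x] that by simp
    have gx: "g x i = x i" if "i < d" for i using bd[OF xD x that] .
    then have "(\<Sum>k<d. (g x k)\<^sup>2) = 1" using x by simp
    then show ?thesis using gx that by (auto simp: h_def fun_eq_iff S_def dn)
  qed
  have h0: "h (0, x) = h (0, y)" for x y by (simp only: h_def prod.case mult_zero_left)
  obtain a where a: "a \<in> S" using in_topspace_nsphere[of n] ns by auto
  have "homotopic_with (\<lambda>x. True) (top_of_set S) (top_of_set S) (\<lambda>x. h (0, a)) id"
    unfolding homotopic_with_def
  proof (intro exI conjI ballI TrueI allI)
    \<comment> \<open>\<open>homotopic_with\<close> prescribes the end maps at all arguments, also
      off the sphere, where \<open>h\<close> need not have these values; hence the case
      distinction.\<close>
    show "continuous_map (prod_topology (top_of_set {0..1}) (top_of_set S)) (top_of_set S)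
      (\<lambda>y. if fst y = 0 then h (0,a) else if fst y = 1 then id (snd y) else h y)"
    proof (rule continuous_map_eq)
      show "continuous_map (prod_topology (top_of_set {0..1}) (top_of_set S)) (top_of_set S) h"
        using conth hS by (auto simp: prod_topology_subtopology_eu)
      show "\<And>x. x \<in> topspace (prod_topology (top_of_set {0..1}) (top_of_set S)) \<Longrightarrow>
          h x = (if fst x = 0 then h (0, a) else if fst x = 1 then id (snd x) else h x)"
        using h1 h0 by auto
    qed
  qed auto
  then have "contractible_space (nsphere n)"
    unfolding contractible_space_def ns using homotopic_with_symD by blast
  with non_contractible_space_nsphere show False by blast
qed

text \<open>The form needed for linking. \<open>f\<close> enumerates all coordinates of all
  \<open>N\<close> vectors, and \<open>E\<close> rebuilds the vectors from them.\<close>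

lemma no_retraction:
  fixes g :: "(nat \<Rightarrow> 'a::euclidean_space) \<Rightarrow> nat \<Rightarrow> 'a" and N :: nat
  defines "D \<equiv> {u. (\<forall>i\<ge>N. u i = 0) \<and> (\<Sum>i<N. (norm (u i))\<^sup>2) \<le> 1}"
  assumes N: "N > 0"
    and cont: "\<And>i. i < N \<Longrightarrow> continuous_on D (\<lambda>u. g u i)"
    and bd: "\<And>u i. u \<in> D \<Longrightarrow> (\<Sum>i<N. (norm (u i))\<^sup>2) = 1 \<Longrightarrow> i < N \<Longrightarrow> g u i = u i"
  shows "\<exists>u\<in>D. \<forall>i<N. g u i = 0"
proof -
  define I where "I = {..<N} \<times> (Basis :: 'a set)"
  define d where "d = card I"
  have finI: "finite I" by (simp add: I_def)
  have d: "d > 0" using N by (auto simp: d_def I_def card_cartesian_product)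
  obtain f where f: "bij_betw f {..<d} I"
    using ex_bij_betw_nat_finite[OF finI] by (auto simp: d_def lessThan_atLeast0)
  define E where "E = (\<lambda>(x::nat\<Rightarrow>real) i. if i < N then (\<Sum>b\<in>Basis. x (the_inv_into {..<d} f (i, b)) *\<^sub>R b) else (0::'a))"
  have finj: "inj_on f {..<d}" and fim: "f ` {..<d} = I" using f by (auto simp: bij_betw_def)
  have Ein: "E x (fst (f j)) \<bullet> snd (f j) = x j" if "j < d" for x j
  proof -
    obtain i b where ib: "f j = (i, b)" by force
    have "(i, b) \<in> I" using fim ib that by (metis imageI lessThan_iff)
    then have i: "i < N" "b \<in> Basis" by (auto simp: I_def)
    have "E x i \<bullet> b = x (the_inv_into {..<d} f (i, b))"
      using i by (simp add: E_def)
    also have "the_inv_into {..<d} f (i, b) = j"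
      using finj ib that by (metis lessThan_iff the_inv_into_f_f)
    finally show ?thesis by (simp add: ib)
  qed
  have sum_reindex: "(\<Sum>j<d. G (f j)) = (\<Sum>i<N. \<Sum>b\<in>Basis. G (i, b))" for G :: "nat \<times> 'a \<Rightarrow> real"
  proof -
    have "(\<Sum>j<d. G (f j)) = sum G I" using sum.reindex_bij_betw[OF f] by blast
    also have "\<dots> = (\<Sum>i<N. \<Sum>b\<in>Basis. G (i, b))" by (simp add: I_def sum.cartesian_product)
    finally show ?thesis .
  qed
  have nE: "(\<Sum>i<N. (norm (E x i))\<^sup>2) = (\<Sum>j<d. (x j)\<^sup>2)" for x
  proof -
    have "(\<Sum>j<d. (x j)\<^sup>2) = (\<Sum>j<d. (E x (fst (f j)) \<bullet> snd (f j))\<^sup>2)"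
      using Ein by (intro sum.cong) auto
    also have "\<dots> = (\<Sum>i<N. \<Sum>b\<in>Basis. (E x i \<bullet> b)\<^sup>2)"
      using sum_reindex[of "\<lambda>(i,b). (E x i \<bullet> b)\<^sup>2"] by (simp add: case_prod_beta)
    also have "\<dots> = (\<Sum>i<N. (norm (E x i))\<^sup>2)"
      unfolding power2_norm_eq_inner by (subst euclidean_inner) (simp only: power2_eq_square)
    finally show ?thesis by simp
  qed
  define D' where "D' = {u::nat\<Rightarrow>real. (\<forall>i\<ge>d. u i = 0) \<and> (\<Sum>i<d. (u i)\<^sup>2) \<le> 1}"
  have ED: "E x \<in> D" if "x \<in> D'" for x
    using that nE[of x] by (auto simp: D_def D'_def E_def)
  have contE: "continuous_on A E" for A
  proof (intro continuous_on_coordinatewise_then_product)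
    fix i
    have "continuous_on A (\<lambda>x. x k)" for k :: nat and A :: "(nat \<Rightarrow> real) set"
      by (rule continuous_on_subset[OF continuous_on_product_coordinates subset_UNIV])
    then show "continuous_on A (\<lambda>x. E x i)"
      by (cases "i < N") (auto simp: E_def intro!: continuous_intros)
  qed
  define G where "G = (\<lambda>x j. g (E x) (fst (f j)) \<bullet> snd (f j))"
  have fj: "fst (f j) < N" "snd (f j) \<in> Basis" if "j < d" for j
    using fim that unfolding I_def by (metis SigmaE fst_conv imageI lessThan_iff, metis SigmaE snd_conv imageI lessThan_iff)
  have "\<exists>x\<in>D'. \<forall>j<d. G x j = 0"
    unfolding D'_def
  proof (rule no_retraction_nat[OF d], fold D'_def)
    show "continuous_on D' (\<lambda>u. G u i)" if "i < d" for i
      unfolding G_def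
      by (intro continuous_intros continuous_on_compose2[OF cont[OF fj(1)[OF that]] contE]) (use ED in auto)
    show "G x i = x i" if "x \<in> D'" "(\<Sum>i<d. (x i)\<^sup>2) = 1" "i < d" for x i
      using bd[OF ED[OF that(1)], of "fst (f i)"] fj[OF that(3)] Ein[OF that(3)] nE[of x] that by (simp add: G_def)
  qed
  then obtain x where x: "x \<in> D'" and x0: "\<And>j. j < d \<Longrightarrow> G x j = 0" by blast
  have "g (E x) i = 0" if "i < N" for i
  proof (rule euclidean_eqI)
    fix b :: 'a assume "b \<in> Basis"
    then have "(i, b) \<in> f ` {..<d}" using that by (simp add: fim I_def)
    then obtain j where "j < d" "f j = (i, b)" by force
    then show "g (E x) i \<bullet> b = 0 \<bullet> b" using x0[of j] by (simp add: G_def)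
  qed
  with ED[OF x] show ?thesis by blast
qed

section \<open>Homogeneous Hamiltonians and the discrete action\<close>

locale homogeneous_hamiltonian =
  fixes H :: "'b::euclidean_space \<Rightarrow> real" and F :: "'b \<Rightarrow> 'b"
  assumes H_deriv: "(H has_derivative (\<lambda>h. F z \<bullet> h)) (at z)"
    and F_cont: "continuous_on UNIV F"
    and F_scale: "t \<ge> 0 \<Longrightarrow> F (t *\<^sub>R z) = t *\<^sub>R F z"
    and H_0: "H 0 = 0"
    and H_pos: "z \<noteq> 0 \<Longrightarrow> H z > 0"
begin

text \<open>Integration along the ray: the difference \<open>f\<close> has derivative 0 by
  homogeneity of \<open>F\<close> and vanishes at \<open>t = 0\<close>.\<close>

lemma euler: "F z \<bullet> z = 2 * H z"
proof -
  define f where "f = (\<lambda>t. H (t *\<^sub>R z) - t\<^sup>2 / 2 * (F z \<bullet> z))"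
  have "(f has_derivative (\<lambda>h. 0)) (at t within {0..1})" if "t \<in> {0..1}" for t
    unfolding f_def using that
    by (auto intro!: derivative_eq_intros has_derivative_compose[where g = H, OF _ H_deriv] simp: F_scale)
  then have "f 1 = f 0"
    by (intro has_derivative_zero_unique[of "{0..1}" f 1 0]) auto
  then show ?thesis by (simp add: f_def H_0)
qed

lemma H_scale: "t \<ge> 0 \<Longrightarrow> H (t *\<^sub>R z) = t\<^sup>2 * H z"
  using euler[of z] euler[of "t *\<^sub>R z"] by (simp add: F_scale power2_eq_square)

lemma F_0: "F 0 = 0"
  using F_scale[of 0 0] by simp

lemma H_cont: "continuous_on S H"
  by (meson H_deriv continuous_at_imp_continuous_on has_derivative_continuous)

lemma H_bounds:
  obtains c C where "c > 0" "C > 0" "\<And>z. c * (norm z)\<^sup>2 \<le> H z" "\<And>z. H z \<le> C * (norm z)\<^sup>2"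
proof -
  have ne: "sphere 0 1 \<noteq> ({} :: 'b set)" by simp
  obtain x where x: "x \<in> sphere 0 1" "\<And>y. y \<in> sphere 0 1 \<Longrightarrow> H x \<le> H y"
    using continuous_attains_inf[OF compact_sphere ne H_cont] by blast
  obtain y where y: "y \<in> sphere 0 1" "\<And>z. z \<in> sphere 0 1 \<Longrightarrow> H z \<le> H y"
    using continuous_attains_sup[OF compact_sphere ne H_cont] by blast
  have eq: "H z = (norm z)\<^sup>2 * H (z /\<^sub>R norm z)" if "z \<noteq> 0" for z
    using H_scale[of "norm z" "z /\<^sub>R norm z"] that by simp
  have sp: "z /\<^sub>R norm z \<in> sphere 0 1" if "z \<noteq> 0" for z :: 'b using that by simp
  have xn: "x \<noteq> 0" and yn: "y \<noteq> 0" using x y by auto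
  show ?thesis
  proof (rule that[OF H_pos[OF xn] H_pos[OF yn]])
    fix z
    show "H x * (norm z)\<^sup>2 \<le> H z"
      using x(2)[OF sp, of z] eq[of z] by (cases "z = 0") (simp_all add: H_0 mult.commute mult_left_mono)
    show "H z \<le> H y * (norm z)\<^sup>2"
      using y(2)[OF sp, of z] eq[of z] by (cases "z = 0") (simp_all add: H_0 mult.commute mult_left_mono)
  qed
qed

lemma F_bound:
  obtains C where "C > 0" "\<And>z. norm (F z) \<le> C * norm z"
proof -
  have "compact (F ` sphere 0 1)"
    by (intro compact_continuous_image continuous_on_subset[OF F_cont]) auto
  then obtain C where C: "C > 0" "\<And>z. z \<in> sphere 0 1 \<Longrightarrow> norm (F z) \<le> C"
    using compact_imp_bounded bounded_pos by (metis image_eqI)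
  show ?thesis
  proof (rule that[OF C(1)])
    fix z
    show "norm (F z) \<le> C * norm z"
    proof (cases "z = 0")
      case False
      then have "F z = norm z *\<^sub>R F (z /\<^sub>R norm z)"
        using F_scale[of "norm z" "z /\<^sub>R norm z"] by simp
      moreover have "norm (F (z /\<^sub>R norm z)) \<le> C" using False by (intro C) auto
      ultimately show ?thesis
        by (metis abs_norm_cancel mult.commute mult_left_mono norm_ge_zero norm_scaleR)
    qed (simp add: F_0)
  qed
qed

text \<open>A first-order remainder that is uniform in \<open>x\<close>, in place of a bound for
  second derivatives. Uniform continuity of \<open>F\<close> on a ball gives the case
  \<open>R = 1\<close>, and scaling gives the rest. As \<open>R\<close> is only an upper bound for
  \<open>norm x\<close>, points near the origin are covered.\<close>

lemma H_remainder:
  assumes "\<kappa> > 0"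
  obtains \<eta> where "\<eta> > 0"
    "\<And>x h R. R > 0 \<Longrightarrow> norm x \<le> R \<Longrightarrow> norm h \<le> \<eta> * R \<Longrightarrow>
       \<bar>H (x + h) - H x - F x \<bullet> h\<bar> \<le> \<kappa> * R * norm h"
proof -
  \<comment> \<open>Radius 2 contains all segments from \<open>x\<close> to \<open>x + h\<close>
    with \<open>norm x\<close> and \<open>norm h\<close> at most 1.\<close>
  have "uniformly_continuous_on (cball 0 2) F"
    by (intro compact_uniformly_continuous continuous_on_subset[OF F_cont]) auto
  then obtain d where d: "d > 0" "\<And>x y. x \<in> cball 0 2 \<Longrightarrow> y \<in> cball 0 2 \<Longrightarrow> dist y x < d \<Longrightarrow> dist (F y) (F x) < \<kappa>"
    using assms unfolding uniformly_continuous_on_def by blast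
  define \<eta> where "\<eta> = min 1 (d/2)"
  have \<eta>: "\<eta> > 0" "\<eta> \<le> 1" "\<eta> < d" using d by (auto simp: \<eta>_def)
  have unit: "\<bar>H (x + h) - H x - F x \<bullet> h\<bar> \<le> \<kappa> * norm h" if x: "norm x \<le> 1" and h: "norm h \<le> \<eta>" for x h :: 'b
  proof -
    \<comment> \<open>Subtracting the linear part turns the remainder into an increment of
      \<open>g\<close>, whose gradient at \<open>y\<close> is \<open>F y - F x\<close>.\<close>
    define g where "g = (\<lambda>y. H y - F x \<bullet> y)"
    have "norm (g (x + h) - g x) \<le> \<kappa> * norm (x + h - x)"
    proof (rule differentiable_bound)
      show "convex (closed_segment x (x + h))" by simp
      fix y assume y: "y \<in> closed_segment x (x + h)"
      show "(g has_derivative (\<lambda>v. F y \<bullet> v - F x \<bullet> v)) (at y within closed_segment x (x + h))"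
        unfolding g_def by (intro derivative_intros has_derivative_at_withinI[OF H_deriv])
      have yx: "norm (y - x) \<le> norm h" using segment_bound1[OF y] by (simp add: norm_minus_commute)
      have "norm (F y - F x) \<le> \<kappa>"
        using d(2)[of x y] yx x h \<eta> norm_triangle_sub[of y x] by (auto simp: dist_norm)
      then show "onorm (\<lambda>v. F y \<bullet> v - F x \<bullet> v) \<le> \<kappa>"
        by (intro onorm_le) (metis inner_diff_left norm_cauchy_schwarz norm_ge_zero order_trans mult_right_mono Cauchy_Schwarz_ineq2 real_norm_def)
    qed auto
    then show ?thesis by (simp add: g_def inner_add_right)
  qed
  show ?thesis
  proof (rule that[OF \<eta>(1)])
    fix x h :: 'b and R :: real
    assume R: "R > 0" and x: "norm x \<le> R" and h: "norm h \<le> \<eta> * R"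
    have u: "\<bar>H (x /\<^sub>R R + h /\<^sub>R R) - H (x /\<^sub>R R) - F (x /\<^sub>R R) \<bullet> (h /\<^sub>R R)\<bar> \<le> \<kappa> * norm (h /\<^sub>R R)"
      using R x h by (intro unit) (auto simp: field_simps)
    have e1: "H (x + h) = R\<^sup>2 * H (x /\<^sub>R R + h /\<^sub>R R)"
      using H_scale[of R "x /\<^sub>R R + h /\<^sub>R R"] R by (simp add: scaleR_add_right)
    have e2: "H x = R\<^sup>2 * H (x /\<^sub>R R)" using H_scale[of R "x /\<^sub>R R"] R by simp
    have e3: "F x \<bullet> h = R\<^sup>2 * (F (x /\<^sub>R R) \<bullet> (h /\<^sub>R R))"
      using F_scale[of R "x /\<^sub>R R"] R by (simp add: power2_eq_square)
    have "\<bar>H (x + h) - H x - F x \<bullet> h\<bar> = R\<^sup>2 * \<bar>H (x /\<^sub>R R + h /\<^sub>R R) - H (x /\<^sub>R R) - F (x /\<^sub>R R) \<bullet> (h /\<^sub>R R)\<bar>"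
      unfolding e1 e2 e3 by (simp add: abs_mult flip: right_diff_distrib)
    also have "\<dots> \<le> R\<^sup>2 * (\<kappa> * norm (h /\<^sub>R R))" by (intro mult_left_mono u) auto
    also have "\<dots> = \<kappa> * R * norm h" using R by (simp add: power2_eq_square)
    finally show "\<bar>H (x + h) - H x - F x \<bullet> h\<bar> \<le> \<kappa> * R * norm h" .
  qed
qed

end

text \<open>An antiperiodic sequence is given by its values at \<open>i < N\<close>, with \<open>x N = - x 0\<close> and
  \<open>x (- 1) = - x (N - 1)\<close>; the values at \<open>i \<ge> N\<close> are junk.\<close>

definition nxt :: "nat \<Rightarrow> (nat \<Rightarrow> 'v::real_vector) \<Rightarrow> nat \<Rightarrow> 'v" where
  "nxt N x i = (if Suc i < N then x (Suc i) else - x 0)"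

definition prv :: "nat \<Rightarrow> (nat \<Rightarrow> 'v::real_vector) \<Rightarrow> nat \<Rightarrow> 'v" where
  "prv N x i = (if i = 0 then - x (N - 1) else x (i - 1))"

definition dif :: "nat \<Rightarrow> (nat \<Rightarrow> 'v::real_vector) \<Rightarrow> nat \<Rightarrow> 'v" where
  "dif N x i = nxt N x i - x i"

text \<open>Minus the usual backward difference: with this sign it is the adjoint of
  \<open>dif\<close>.\<close>

definition bdif :: "nat \<Rightarrow> (nat \<Rightarrow> 'v::real_vector) \<Rightarrow> nat \<Rightarrow> 'v" where
  "bdif N x i = prv N x i - x i"

text \<open>The sign changes at the two ends agree, as both sides contain
  \<open>- (x (N - 1) \<bullet> y 0)\<close>. This is why summation by parts has no boundary
  terms.\<close>

lemma sum_nxt_prv: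
  fixes x y :: "nat \<Rightarrow> 'v::real_inner"
  assumes "N > 0"
  shows "(\<Sum>i<N. x i \<bullet> nxt N y i) = (\<Sum>i<N. prv N x i \<bullet> y i)"
proof -
  obtain M where M: "N = Suc M" using assms by (cases N) auto
  have "(\<Sum>i<N. x i \<bullet> nxt N y i) = (\<Sum>i<M. x i \<bullet> y (Suc i)) - x M \<bullet> y 0"
    by (simp add: M nxt_def)
  also have "\<dots> = (\<Sum>i<N. prv N x i \<bullet> y i)"
    unfolding M sum.lessThan_Suc_shift by (simp add: prv_def)
  finally show ?thesis .
qed

lemma sum_dif_bdif:
  fixes x y :: "nat \<Rightarrow> 'v::real_inner"
  assumes "N > 0"
  shows "(\<Sum>i<N. x i \<bullet> dif N y i) = (\<Sum>i<N. bdif N x i \<bullet> y i)"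
  using sum_nxt_prv[OF assms, of x y]
  by (simp add: dif_def bdif_def inner_diff_left inner_diff_right sum_subtractf)

lemma sum_norm_nxt: "N > 0 \<Longrightarrow> (\<Sum>i<N. (norm (nxt N x i))\<^sup>2) = (\<Sum>i<N. (norm (x i))\<^sup>2)"
  for x :: "nat \<Rightarrow> 'v::real_inner"
proof -
  assume "N > 0"
  then obtain M where M: "N = Suc M" by (cases N) auto
  have "(\<Sum>i<N. (norm (nxt N x i))\<^sup>2) = (\<Sum>i<M. (norm (x (Suc i)))\<^sup>2) + (norm (x 0))\<^sup>2"
    by (simp add: M nxt_def)
  also have "\<dots> = (\<Sum>i<N. (norm (x i))\<^sup>2)" unfolding M sum.lessThan_Suc_shift by simp
  finally show ?thesis .
qed

lemma sum_norm_prv: "N > 0 \<Longrightarrow> (\<Sum>i<N. (norm (prv N x i))\<^sup>2) = (\<Sum>i<N. (norm (x i))\<^sup>2)"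
  for x :: "nat \<Rightarrow> 'v::real_inner"
proof -
  assume "N > 0"
  then obtain M where M: "N = Suc M" by (cases N) auto
  have "(\<Sum>i<N. (norm (x i))\<^sup>2) = (\<Sum>i<M. (norm (x i))\<^sup>2) + (norm (x M))\<^sup>2"
    by (simp add: M)
  also have "\<dots> = (\<Sum>i<N. (norm (prv N x i))\<^sup>2)" unfolding M sum.lessThan_Suc_shift by (simp add: prv_def)
  finally show ?thesis by simp
qed

lemma norm_diff_squared_le: "(norm (a - b))\<^sup>2 \<le> 2 * (norm a)\<^sup>2 + 2 * (norm b)\<^sup>2" for a b :: "'v::real_inner"
proof -
  have "0 \<le> (norm (a + b))\<^sup>2" by simp
  then show ?thesis by (simp add: power2_norm_eq_inner inner_diff_left inner_diff_right inner_add_left inner_add_right inner_commute)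
qed

lemma sum_norm_dif_le: "N > 0 \<Longrightarrow> (\<Sum>i<N. (norm (dif N x i))\<^sup>2) \<le> 4 * (\<Sum>i<N. (norm (x i))\<^sup>2)"
  for x :: "nat \<Rightarrow> 'v::real_inner"
proof -
  assume N: "N > 0"
  have "(\<Sum>i<N. (norm (dif N x i))\<^sup>2) \<le> (\<Sum>i<N. 2 * (norm (nxt N x i))\<^sup>2 + 2 * (norm (x i))\<^sup>2)"
    unfolding dif_def by (intro sum_mono norm_diff_squared_le)
  also have "\<dots> = 4 * (\<Sum>i<N. (norm (x i))\<^sup>2)"
    by (simp add: sum.distrib sum_norm_nxt[OF N] flip: sum_distrib_left)
  finally show ?thesis .
qed

lemma sum_norm_bdif_le: "N > 0 \<Longrightarrow> (\<Sum>i<N. (norm (bdif N x i))\<^sup>2) \<le> 4 * (\<Sum>i<N. (norm (x i))\<^sup>2)"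
  for x :: "nat \<Rightarrow> 'v::real_inner"
proof -
  assume N: "N > 0"
  have "(\<Sum>i<N. (norm (bdif N x i))\<^sup>2) \<le> (\<Sum>i<N. 2 * (norm (prv N x i))\<^sup>2 + 2 * (norm (x i))\<^sup>2)"
    unfolding bdif_def by (intro sum_mono norm_diff_squared_le)
  also have "\<dots> = 4 * (\<Sum>i<N. (norm (x i))\<^sup>2)"
    by (simp add: sum.distrib sum_norm_prv[OF N] flip: sum_distrib_left)
  finally show ?thesis .
qed

definition sqnorm :: "nat \<Rightarrow> (nat \<Rightarrow> 'v::real_normed_vector) \<Rightarrow> real" where
  "sqnorm N z = (\<Sum>i<N. (norm (z i))\<^sup>2)"

text \<open>A loop is the sequence of the points \<open>z i = (q i, p i)\<close>. The forward difference in \<open>q\<close> becomes a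
  backward difference in \<open>p\<close> in the gradient; in contrast to central differences, this keeps high
  frequencies out of the kernel.\<close>

definition act :: "nat \<Rightarrow> (nat \<Rightarrow> 'a::euclidean_space \<times> 'a) \<Rightarrow> real" where
  "act N z = real N * (\<Sum>i<N. snd (z i) \<bullet> dif N (\<lambda>i. fst (z i)) i)"

definition agrad :: "nat \<Rightarrow> (nat \<Rightarrow> 'a::euclidean_space \<times> 'a) \<Rightarrow> nat \<Rightarrow> 'a \<times> 'a" where
  "agrad N z i = real N *\<^sub>R (bdif N (\<lambda>i. snd (z i)) i, dif N (\<lambda>i. fst (z i)) i)"

lemma sqnorm_nonneg: "sqnorm N z \<ge> 0" by (simp add: sqnorm_def sum_nonneg)

lemma norm_le_sqnorm: "i < N \<Longrightarrow> norm (z i) \<le> sqrt (sqnorm N z)"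
  unfolding sqnorm_def by (intro real_le_rsqrt member_le_sum) auto

lemma sqnorm_pos: "i < N \<Longrightarrow> z i \<noteq> 0 \<Longrightarrow> sqnorm N z > 0"
  unfolding sqnorm_def by (intro sum_pos2[of _ i]) auto

lemma norm_prod_squared: "(norm z)\<^sup>2 = (norm (fst z))\<^sup>2 + (norm (snd z))\<^sup>2"
  for z :: "'u::real_normed_vector \<times> 'w::real_normed_vector"
  by (simp add: norm_prod_def)

lemma sqnorm_prod: "sqnorm N z = sqnorm N (\<lambda>i. fst (z i)) + sqnorm N (\<lambda>i. snd (z i))"
  for z :: "nat \<Rightarrow> 'u::real_normed_vector \<times> 'w::real_normed_vector"
  by (simp add: sqnorm_def norm_prod_squared sum.distrib)

lemma dif_add: "dif N (\<lambda>i. x i + s *\<^sub>R y i) i = dif N x i + s *\<^sub>R dif N y i"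
  by (simp add: dif_def nxt_def algebra_simps)

text \<open>The polarisation of the quadratic form \<open>act\<close>, which identifies
  \<open>agrad\<close> as its gradient.\<close>

lemma sum_agrad:
  assumes "N > 0"
  shows "(\<Sum>i<N. agrad N z i \<bullet> y i) = real N * ((\<Sum>i<N. snd (z i) \<bullet> dif N (\<lambda>i. fst (y i)) i)
    + (\<Sum>i<N. snd (y i) \<bullet> dif N (\<lambda>i. fst (z i)) i))"
proof -
  have "(\<Sum>i<N. agrad N z i \<bullet> y i) = real N * ((\<Sum>i<N. bdif N (\<lambda>i. snd (z i)) i \<bullet> fst (y i))
    + (\<Sum>i<N. dif N (\<lambda>i. fst (z i)) i \<bullet> snd (y i)))"
    by (simp add: agrad_def inner_prod_def sum.distrib algebra_simps flip: sum_distrib_left)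
  then show ?thesis by (simp add: sum_dif_bdif[OF assms] inner_commute)
qed

lemma act_add:
  assumes "N > 0"
  shows "act N (\<lambda>i. z i + s *\<^sub>R y i) = act N z + s * (\<Sum>i<N. agrad N z i \<bullet> y i) + s\<^sup>2 * act N y"
  unfolding sum_agrad[OF assms] act_def
  by (simp add: dif_add inner_add_left inner_add_right sum.distrib algebra_simps power2_eq_square flip: sum_distrib_left)

lemma agrad_self: "N > 0 \<Longrightarrow> (\<Sum>i<N. agrad N z i \<bullet> z i) = 2 * act N z"
  by (simp add: sum_agrad act_def)

text \<open>The factor grows with \<open>N\<close>, which does no harm: it only enters step sizes
  for a fixed \<open>N\<close>.\<close>

lemma sqnorm_agrad_le: "N > 0 \<Longrightarrow> sqnorm N (agrad N z) \<le> 4 * (real N)\<^sup>2 * sqnorm N z"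
proof -
  assume N: "N > 0"
  have "sqnorm N (agrad N z) = (real N)\<^sup>2 * ((\<Sum>i<N. (norm (bdif N (\<lambda>i. snd (z i)) i))\<^sup>2)
      + (\<Sum>i<N. (norm (dif N (\<lambda>i. fst (z i)) i))\<^sup>2))"
    unfolding sqnorm_prod unfolding agrad_def sqnorm_def by (simp add: power_mult_distrib flip: sum_distrib_left distrib_left)
  also have "\<dots> \<le> (real N)\<^sup>2 * (4 * sqnorm N (\<lambda>i. snd (z i)) + 4 * sqnorm N (\<lambda>i. fst (z i)))"
    using sum_norm_dif_le[OF N, of "\<lambda>i. fst (z i)"] sum_norm_bdif_le[OF N, of "\<lambda>i. snd (z i)"]
    by (intro mult_left_mono add_mono) (auto simp: sqnorm_def)
  finally show ?thesis unfolding sqnorm_prod[of N z] by (simp add: algebra_simps)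
qed

lemma act_le: "N > 0 \<Longrightarrow> \<bar>act N z\<bar> \<le> real N * sqnorm N z"
proof -
  assume N: "N > 0"
  have *: "\<bar>a \<bullet> (b - c)\<bar> \<le> (norm a)\<^sup>2 + (norm b)\<^sup>2 / 2 + (norm c)\<^sup>2 / 2" for a b c :: 'a
  proof -
    have "\<bar>a \<bullet> b\<bar> \<le> norm a * norm b" "\<bar>a \<bullet> c\<bar> \<le> norm a * norm c"
      by (rule Cauchy_Schwarz_ineq2)+
    moreover have "2 * (norm a * norm b) \<le> (norm a)\<^sup>2 + (norm b)\<^sup>2" "2 * (norm a * norm c) \<le> (norm a)\<^sup>2 + (norm c)\<^sup>2"
      using sum_squares_bound[of "norm a" "norm b"] sum_squares_bound[of "norm a" "norm c"] by (auto simp: mult.assoc)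
    ultimately show ?thesis by (simp add: inner_diff_right)
  qed
  have "\<bar>\<Sum>i<N. snd (z i) \<bullet> dif N (\<lambda>i. fst (z i)) i\<bar> \<le> (\<Sum>i<N. (norm (snd (z i)))\<^sup>2
      + (norm (nxt N (\<lambda>i. fst (z i)) i))\<^sup>2 / 2 + (norm (fst (z i)))\<^sup>2 / 2)"
    unfolding dif_def by (rule order_trans[OF sum_abs]) (intro sum_mono *)
  also have "\<dots> = sqnorm N z"
    using sum_norm_nxt[OF N, of "\<lambda>i. fst (z i)"] unfolding sqnorm_prod
    by (simp add: sqnorm_def sum.distrib flip: sum_divide_distrib)
  finally show ?thesis unfolding act_def by (simp add: abs_mult mult_left_mono)
qed

section \<open>Gradient steps for the quotient of action and Hamiltonian\<close>

locale discrete_hamiltonian = homogeneous_hamiltonian H F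
  for H :: "'a::euclidean_space \<times> 'a \<Rightarrow> real" and F +
  fixes N :: nat
  assumes N_pos: "N > 0"
begin

definition ham :: "(nat \<Rightarrow> 'a \<times> 'a) \<Rightarrow> real" where "ham z = (\<Sum>i<N. H (z i))"

definition quo :: "(nat \<Rightarrow> 'a \<times> 'a) \<Rightarrow> real" where "quo z = act N z / ham z"

text \<open>Up to the positive factor \<open>ham z\<close>, the gradient of \<open>quo\<close>.\<close>

definition grd :: "(nat \<Rightarrow> 'a \<times> 'a) \<Rightarrow> nat \<Rightarrow> 'a \<times> 'a" where
  "grd z i = agrad N z i - quo z *\<^sub>R F (z i)"

lemma ham_pos:
  assumes "sqnorm N z > 0" shows "ham z > 0"
proof -
  have "\<exists>i<N. z i \<noteq> 0" using assms by (auto simp: sqnorm_def intro: ccontr)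
  then obtain i where i: "i < N" "z i \<noteq> 0" by blast
  have "H x \<ge> 0" for x using H_pos[of x] H_0 by (cases "x = 0") auto
  then show ?thesis unfolding ham_def using i H_pos by (intro sum_pos2[of _ i]) auto
qed

lemma ham_le:
  assumes "\<And>z. H z \<le> C * (norm z)\<^sup>2" shows "ham z \<le> C * sqnorm N z"
  unfolding ham_def sqnorm_def sum_distrib_left by (intro sum_mono assms)

lemma ham_ge:
  assumes "\<And>z. c * (norm z)\<^sup>2 \<le> H z" shows "c * sqnorm N z \<le> ham z"
  unfolding ham_def sqnorm_def sum_distrib_left by (intro sum_mono assms)

text \<open>The quotient is invariant under scaling, so that its gradient is orthogonal to the
  radial direction. Hence gradient steps never decrease the norm and stay away from 0.\<close>

lemma sum_grd_self:
  assumes "sqnorm N z > 0" shows "(\<Sum>i<N. grd z i \<bullet> z i) = 0"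
proof -
  have "(\<Sum>i<N. grd z i \<bullet> z i) = 2 * act N z - quo z * (2 * ham z)"
    using agrad_self[OF N_pos, of z]
    by (simp add: grd_def inner_diff_left sum_subtractf euler ham_def sum_distrib_left mult.left_commute)
  then show ?thesis using ham_pos[OF assms] by (simp add: quo_def)
qed

lemma sqnorm_add: "sqnorm N (\<lambda>i. z i + s *\<^sub>R y i) = sqnorm N z + 2 * s * (\<Sum>i<N. y i \<bullet> z i) + s\<^sup>2 * sqnorm N y"
  for z y :: "nat \<Rightarrow> 'v::real_inner"
  unfolding sqnorm_def power2_norm_eq_inner
  by (simp add: inner_add_left inner_add_right inner_commute sum.distrib algebra_simps power2_eq_square flip: sum_distrib_left)

lemma sqnorm_step:
  assumes "sqnorm N z > 0" shows "sqnorm N (\<lambda>i. z i + s *\<^sub>R grd z i) = sqnorm N z + s\<^sup>2 * sqnorm N (grd z)"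
  using sqnorm_add[of z s "grd z"] sum_grd_self[OF assms] by simp

lemma sqnorm_grd_le:
  assumes "\<And>z. norm (F z) \<le> C * norm z" "0 \<le> quo z" "quo z \<le> b" "C \<ge> 0"
  shows "sqnorm N (grd z) \<le> (8 * (real N)\<^sup>2 + 2 * (b * C)\<^sup>2) * sqnorm N z"
proof -
  have "sqnorm N (grd z) \<le> (\<Sum>i<N. 2 * (norm (agrad N z i))\<^sup>2 + 2 * (norm (quo z *\<^sub>R F (z i)))\<^sup>2)"
    unfolding sqnorm_def grd_def by (intro sum_mono norm_diff_squared_le)
  also have "\<dots> \<le> (\<Sum>i<N. 2 * (norm (agrad N z i))\<^sup>2 + 2 * (b * C * norm (z i))\<^sup>2)"
  proof (intro sum_mono add_left_mono mult_left_mono power_mono)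
    fix i
    have "norm (quo z *\<^sub>R F (z i)) \<le> b * (C * norm (z i))"
      using assms by (simp add: mult_mono)
    then show "norm (quo z *\<^sub>R F (z i)) \<le> b * C * norm (z i)" by (simp add: mult.assoc)
  qed auto
  also have "\<dots> = 2 * sqnorm N (agrad N z) + 2 * (b * C)\<^sup>2 * sqnorm N z"
    by (simp add: sqnorm_def sum.distrib sum_distrib_left power_mult_distrib mult.assoc)
  also have "\<dots> \<le> 2 * (4 * (real N)\<^sup>2 * sqnorm N z) + 2 * (b * C)\<^sup>2 * sqnorm N z"
    using sqnorm_agrad_le[OF N_pos, of z] by (simp add: mult_ac)
  finally show ?thesis by (simp add: algebra_simps)
qed

text \<open>A step changes \<open>act\<close> by an exact quadratic expression and
  \<open>ham\<close> up to the error of \<open>H_remainder\<close>. Both are combined in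
  \<open>act N y - q * ham y\<close>, where \<open>q\<close> is the value before the step: the
  first-order term is \<open>- \<sigma> * sqnorm N (grd z)\<close>, and the errors use up at most
  three quarters of it. The factor \<open>s\<close> serves to slow down or stop steps at low
  values.\<close>

lemma descent_step:
  assumes ab: "0 < a" "a \<le> b" and \<mu>: "\<mu> > 0"
    and noncrit: "\<And>z. sqnorm N z > 0 \<Longrightarrow> a \<le> quo z \<Longrightarrow> quo z \<le> b \<Longrightarrow> sqnorm N (grd z) \<ge> \<mu> * sqnorm N z"
  obtains \<epsilon> \<delta> where "\<epsilon> > 0" "\<delta> > 0"
    "\<And>z s. sqnorm N z > 0 \<Longrightarrow> a \<le> quo z \<Longrightarrow> quo z \<le> b \<Longrightarrow> 0 \<le> s \<Longrightarrow> s \<le> 1 \<Longrightarrow>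
        quo (\<lambda>i. z i - (s * \<epsilon>) *\<^sub>R grd z i) \<le> quo z - s * \<delta>"
proof -
  obtain CF where CF: "CF > 0" "\<And>z. norm (F z) \<le> CF * norm z" using F_bound by blast
  obtain c C where C: "c > 0" "C > 0" "\<And>z. c * (norm z)\<^sup>2 \<le> H z" "\<And>z. H z \<le> C * (norm z)\<^sup>2"
    using H_bounds by blast
  define M where "M = sqrt (8 * (real N)\<^sup>2 + 2 * (b * CF)\<^sup>2)"
  have NN: "real N > 0" using N_pos by simp
  have M: "M > 0" "M\<^sup>2 = 8 * (real N)\<^sup>2 + 2 * (b * CF)\<^sup>2"
    using NN by (auto simp: M_def add_pos_nonneg)
  \<comment> \<open>Chosen so that the remainders at the \<open>N\<close> points, multiplied by
    \<open>b\<close>, add up to \<open>\<mu> / 4 * sqnorm N z\<close> per unit of step size.\<close>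
  define \<kappa> where "\<kappa> = \<mu> / (4 * b * N * M)"
  have \<kappa>: "\<kappa> > 0" using ab \<mu> M NN by (auto simp: \<kappa>_def)
  obtain \<eta> where \<eta>: "\<eta> > 0"
    "\<And>x h R. R > 0 \<Longrightarrow> norm x \<le> R \<Longrightarrow> norm h \<le> \<eta> * R \<Longrightarrow>
       \<bar>H (x + h) - H x - F x \<bullet> h\<bar> \<le> \<kappa> * R * norm h"
    using H_remainder[OF \<kappa>] by blast
  \<comment> \<open>The first bound lets half of the gradient term absorb the quadratic term of the
    action, the second makes \<open>H_remainder\<close> applicable, and the third keeps
    \<open>sqnorm N y\<close> below twice \<open>sqnorm N z\<close>.\<close>
  define \<epsilon> where "\<epsilon> = Min {1 / (2 * N), \<eta> / M, 1 / M}"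
  have \<epsilon>: "\<epsilon> > 0" "\<epsilon> \<le> 1 / (2 * N)" "\<epsilon> \<le> \<eta> / M" "\<epsilon> \<le> 1 / M"
    using NN M \<eta> by (auto simp: \<epsilon>_def)
  \<comment> \<open>The gain \<open>\<mu> / 4 * sqnorm N z\<close> per unit of step size, divided by
    the bound \<open>2 * C * sqnorm N z\<close> for \<open>ham y\<close>.\<close>
  define \<delta> where "\<delta> = \<epsilon> * \<mu> / (8 * C)"
  show ?thesis
  proof (rule that[OF \<epsilon>(1)])
    show "\<delta> > 0" using \<epsilon> \<mu> C by (simp add: \<delta>_def)
    fix z s
    assume z: "sqnorm N z > 0" and qa: "a \<le> quo z" and qb: "quo z \<le> b" and s: "0 \<le> s" "(s::real) \<le> 1"
    define \<sigma> where "\<sigma> = s * \<epsilon>"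
    define R where "R = sqrt (sqnorm N z)"
    define y where "y = (\<lambda>i. z i - \<sigma> *\<^sub>R grd z i)"
    define q where "q = quo z"
    have q: "0 < q" "q \<le> b" using qa qb ab by (auto simp: q_def)
    have R: "R > 0" "R\<^sup>2 = sqnorm N z" using z by (auto simp: R_def)
    have \<sigma>: "0 \<le> \<sigma>" "\<sigma> \<le> \<epsilon>" using s \<epsilon> by (auto simp: \<sigma>_def mult_left_le_one_le)
    have G2: "sqnorm N (grd z) \<le> M\<^sup>2 * sqnorm N z"
      unfolding M(2) by (rule sqnorm_grd_le) (use CF qa qb ab in auto)
    have Gi: "norm (grd z i) \<le> M * R" if "i < N" for i
    proof -
      have "norm (grd z i) \<le> sqrt (sqnorm N (grd z))" by (rule norm_le_sqnorm[OF that])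
      also have "\<dots> \<le> sqrt ((M * R)\<^sup>2)" using G2 by (intro real_sqrt_le_mono) (simp add: power_mult_distrib R)
      finally show ?thesis using M R by simp
    qed
    have y_alt: "y = (\<lambda>i. z i + (- \<sigma>) *\<^sub>R grd z i)" by (simp add: y_def)
    have nny: "sqnorm N y = sqnorm N z + \<sigma>\<^sup>2 * sqnorm N (grd z)"
      unfolding y_alt using sqnorm_step[OF z, of "- \<sigma>"] by simp
    have nny1: "sqnorm N y \<ge> sqnorm N z" using nny sqnorm_nonneg[of N "grd z"] by simp
    have nny2: "sqnorm N y \<le> 2 * sqnorm N z"
    proof -
      have "\<sigma> * M \<le> 1" using \<sigma> \<epsilon> M by (smt (verit) pos_le_divide_eq mult_right_mono)
      then have "(\<sigma> * M)\<^sup>2 \<le> 1" using \<sigma> M by (simp add: power_le_one)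
      then have "\<sigma>\<^sup>2 * M\<^sup>2 * sqnorm N z \<le> 1 * sqnorm N z" using z
        by (intro mult_right_mono) (auto simp: power_mult_distrib)
      moreover have "\<sigma>\<^sup>2 * sqnorm N (grd z) \<le> \<sigma>\<^sup>2 * (M\<^sup>2 * sqnorm N z)" using G2 by (rule mult_left_mono) simp
      ultimately show ?thesis using nny by simp
    qed
    have acty: "act N y = act N z - \<sigma> * (\<Sum>i<N. agrad N z i \<bullet> grd z i) + \<sigma>\<^sup>2 * act N (grd z)"
      unfolding y_alt act_add[OF N_pos] by simp
    have hamy: "ham y \<ge> ham z - \<sigma> * (\<Sum>i<N. F (z i) \<bullet> grd z i) - \<sigma> * N * \<kappa> * M * R\<^sup>2"
    proof -
      have "H (y i) \<ge> H (z i) - \<sigma> * (F (z i) \<bullet> grd z i) - \<sigma> * \<kappa> * M * R\<^sup>2" if i: "i < N" for i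
      proof -
        have zi: "norm (z i) \<le> R" unfolding R_def by (rule norm_le_sqnorm[OF i])
        have h1: "norm (- \<sigma> *\<^sub>R grd z i) \<le> \<sigma> * (M * R)" using Gi[OF i] \<sigma> by (simp add: mult_left_mono)
        also have "\<dots> \<le> \<eta> * R" using \<sigma> \<epsilon> M R
          by (smt (verit) mult.assoc mult_right_mono pos_le_divide_eq)
        finally have "\<bar>H (z i + (- \<sigma> *\<^sub>R grd z i)) - H (z i) - F (z i) \<bullet> (- \<sigma> *\<^sub>R grd z i)\<bar>
            \<le> \<kappa> * R * norm (- \<sigma> *\<^sub>R grd z i)"
          by (intro \<eta>(2) R zi)
        also have "\<dots> \<le> \<kappa> * R * (\<sigma> * (M * R))" using h1 \<kappa> R by (intro mult_left_mono) auto
        finally show ?thesis by (simp add: y_def power2_eq_square mult_ac)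
      qed
      then have "(\<Sum>i<N. H (z i) - \<sigma> * (F (z i) \<bullet> grd z i) - \<sigma> * \<kappa> * M * R\<^sup>2) \<le> ham y"
        unfolding ham_def by (intro sum_mono) auto
      then show ?thesis by (simp add: sum_subtractf ham_def sum_distrib_left mult_ac)
    qed
    have hz: "ham z > 0" and hy: "ham y > 0" using ham_pos z nny1 by auto
    have Gsum: "(\<Sum>i<N. agrad N z i \<bullet> grd z i) - q * (\<Sum>i<N. F (z i) \<bullet> grd z i) = sqnorm N (grd z)"
    proof -
      have "sqnorm N (grd z) = (\<Sum>i<N. (agrad N z i - q *\<^sub>R F (z i)) \<bullet> grd z i)"
        unfolding sqnorm_def power2_norm_eq_inner by (simp add: grd_def q_def)
      then show ?thesis by (simp add: inner_diff_left sum_subtractf sum_distrib_left)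
    qed
    have az: "act N z = q * ham z" using hz by (simp add: q_def quo_def)
    have "q * ham y \<ge> q * (ham z - \<sigma> * (\<Sum>i<N. F (z i) \<bullet> grd z i) - \<sigma> * N * \<kappa> * M * R\<^sup>2)"
      using hamy q by (intro mult_left_mono) auto
    then have "act N y - q * ham y \<le> - \<sigma> * sqnorm N (grd z) + \<sigma>\<^sup>2 * act N (grd z) + q * (\<sigma> * N * \<kappa> * M * R\<^sup>2)"
      unfolding acty az Gsum[symmetric] by (simp add: algebra_simps)
    also have "\<dots> \<le> - \<sigma> * sqnorm N (grd z) + \<sigma> * (sqnorm N (grd z) / 2) + b * (\<sigma> * N * \<kappa> * M * R\<^sup>2)"
    proof (intro add_mono order_refl mult_right_mono q)
      have "\<sigma>\<^sup>2 * act N (grd z) \<le> \<sigma>\<^sup>2 * (N * sqnorm N (grd z))"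
        using act_le[OF N_pos, of "grd z"] by (intro mult_left_mono) auto
      also have "\<dots> = \<sigma> * ((\<sigma> * N) * sqnorm N (grd z))" by (simp add: power2_eq_square)
      also have "\<dots> \<le> \<sigma> * (1/2 * sqnorm N (grd z))"
      proof (intro mult_left_mono mult_right_mono sqnorm_nonneg \<sigma>)
        have "\<sigma> \<le> 1 / (2 * N)" using \<sigma> \<epsilon> by simp
        then show "\<sigma> * N \<le> 1/2" using NN by (simp add: field_simps)
      qed
      finally show "\<sigma>\<^sup>2 * act N (grd z) \<le> \<sigma> * (sqnorm N (grd z) / 2)" by simp
      show "0 \<le> \<sigma> * real N * \<kappa> * M * R\<^sup>2" using \<sigma> \<kappa> M by simp
    qed
    also have "b * (\<sigma> * N * \<kappa> * M * R\<^sup>2) = \<sigma> * (\<mu> / 4 * sqnorm N z)"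
      using ab M NN by (simp add: \<kappa>_def R(2))
    also have "- \<sigma> * sqnorm N (grd z) + \<sigma> * (sqnorm N (grd z) / 2) + \<sigma> * (\<mu> / 4 * sqnorm N z) \<le> - \<sigma> * (\<mu> / 4 * sqnorm N z)"
    proof -
      have "\<sigma> * (\<mu> * sqnorm N z) \<le> \<sigma> * sqnorm N (grd z)" using noncrit[OF z qa qb] \<sigma> by (intro mult_left_mono) auto
      then show ?thesis by (simp add: algebra_simps)
    qed
    finally have main: "act N y - q * ham y \<le> - \<sigma> * (\<mu> / 4 * sqnorm N z)" .
    have "ham y \<le> C * (2 * sqnorm N z)"
      using ham_le[OF C(4), of y] nny2 C(2) by (smt (verit) mult_left_mono)
    then have "s * \<delta> * ham y \<le> s * \<delta> * (C * (2 * sqnorm N z))"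
      using s \<open>\<delta> > 0\<close> by (intro mult_left_mono) auto
    also have "\<dots> = \<sigma> * (\<mu> / 4 * sqnorm N z)" using C by (simp add: \<delta>_def \<sigma>_def)
    finally have "act N y \<le> (q - s * \<delta>) * ham y" using main by (simp add: algebra_simps)
    then have "quo y \<le> q - s * \<delta>" using hy by (simp add: quo_def pos_divide_le_eq)
    then show "quo (\<lambda>i. z i - (s * \<epsilon>) *\<^sub>R grd z i) \<le> quo z - s * \<delta>"
      by (simp add: y_def \<sigma>_def q_def)
  qed
qed

end

section \<open>Linking\<close>

text \<open>The inverse of \<open>dif\<close>: antiperiodicity fixes the constant of summation,
  since the value at 0 must be minus half of the total sum.\<close>

definition adif :: "nat \<Rightarrow> (nat \<Rightarrow> 'v::real_vector) \<Rightarrow> nat \<Rightarrow> 'v" where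
  "adif N w i = (1/2) *\<^sub>R (sum w {..<i} - sum w {i..<N})"

lemma dif_adif:
  assumes "i < N" shows "dif N (adif N w) i = w i"
proof (cases "Suc i < N")
  case True
  have "sum w {i..<N} = w i + sum w {Suc i..<N}" using assms by (rule sum.atLeast_Suc_lessThan)
  then show ?thesis using True by (simp add: dif_def nxt_def adif_def algebra_simps flip: scaleR_2)
next
  case False
  then have N: "N = Suc i" using assms by simp
  show ?thesis by (simp add: N dif_def nxt_def adif_def lessThan_atLeast0 algebra_simps flip: scaleR_2)
qed

text \<open>The differences before \<open>i\<close> sum to \<open>x i - x 0\<close>, those from
  \<open>i\<close> on to \<open>- x 0 - x i\<close>; subtraction cancels \<open>x 0\<close>.\<close>

lemma double_eq_sums:
  assumes N: "N > 0" and i: "i < N"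
  shows "2 *\<^sub>R x i = sum (dif N x) {..<i} - sum (dif N x) {i..<N}"
proof -
  have 1: "sum (dif N x) {..<j} = x j - x 0" if "j < N" for j
    using that by (induction j) (auto simp: dif_def nxt_def)
  have 2: "sum (dif N x) {..<N} = - x 0 - x 0"
  proof -
    obtain M where M: "N = Suc M" using N by (cases N) auto
    have "sum (dif N x) {..<N} = sum (dif N x) {..<M} + dif N x M" by (simp add: M)
    also have "\<dots> = - x 0 - x 0" using 1[of M] by (simp add: M dif_def nxt_def)
    finally show ?thesis .
  qed
  have "{..<N} = {..<i} \<union> {i..<N}" using i by auto
  then have "sum (dif N x) {..<N} = sum (dif N x) {..<i} + sum (dif N x) {i..<N}"
    by (metis finite_atLeastLessThan finite_lessThan ivl_disj_int_one(2) sum.union_disjoint)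
  then have "sum (dif N x) {i..<N} = - x 0 - x 0 - (x i - x 0)"
    unfolding 1[OF i] 2 by (simp add: algebra_simps)
  then show ?thesis using 1[OF i] by (simp add: scaleR_2)
qed

text \<open>Each value is controlled by the sum of all differences. Cauchy-Schwarz costs one factor
  \<open>N\<close>, the sum over \<open>i\<close> the other. For the rescaled difference,
  \<open>N\<close> times \<open>dif\<close>, the constant does not depend on
  \<open>N\<close>.\<close>

lemma discrete_poincare:
  fixes x :: "nat \<Rightarrow> 'v::real_inner"
  assumes N: "N > 0"
  shows "4 * sqnorm N x \<le> (real N)\<^sup>2 * sqnorm N (dif N x)"
proof -
  have *: "4 * (norm (x i))\<^sup>2 \<le> real N * sqnorm N (dif N x)" if i: "i < N" for i
  proof -
    have "2 * norm (x i) = norm (2 *\<^sub>R x i)" by simp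
    also have "\<dots> \<le> norm (sum (dif N x) {..<i}) + norm (sum (dif N x) {i..<N})"
      unfolding double_eq_sums[OF assms i] by (rule norm_triangle_ineq4)
    also have "\<dots> \<le> (\<Sum>j<i. norm (dif N x j)) + (\<Sum>j=i..<N. norm (dif N x j))"
      by (intro add_mono norm_sum)
    also have "\<dots> = (\<Sum>j<N. norm (dif N x j))"
      using i by (metis lessThan_atLeast0 less_eq_nat.simps(1) order_less_imp_le sum.atLeastLessThan_concat)
    finally have "2 * norm (x i) \<le> (\<Sum>j<N. norm (dif N x j))" .
    then have "(2 * norm (x i))\<^sup>2 \<le> (\<Sum>j<N. 1 * norm (dif N x j))\<^sup>2" by (intro power_mono) auto
    also have "\<dots> \<le> (\<Sum>j<N. 1\<^sup>2) * (\<Sum>j<N. (norm (dif N x j))\<^sup>2)"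
      by (rule Cauchy_Schwarz_ineq_sum)
    finally show ?thesis by (simp add: sqnorm_def power_mult_distrib)
  qed
  have "4 * sqnorm N x = (\<Sum>i<N. 4 * (norm (x i))\<^sup>2)" by (simp add: sqnorm_def sum_distrib_left)
  also have "\<dots> \<le> (\<Sum>i<N. real N * sqnorm N (dif N x))" by (intro sum_mono *) auto
  finally show ?thesis by (simp add: power2_eq_square)
qed

text \<open>The lowest mode: \<open>bdif \<circ> dif\<close> acts on it as \<open>O(1 / N\<^sup>2)\<close>, which makes the upper bound for the
  action on the half space independent of \<open>N\<close>.\<close>

definition cosmode :: "nat \<Rightarrow> 'v::real_vector \<Rightarrow> nat \<Rightarrow> 'v" where
  "cosmode N v i = cos (pi * i / N) *\<^sub>R v"

text \<open>The half wave changes sign after \<open>N\<close> steps, so that the wrapped values at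
  both ends are its own values at \<open>N\<close> and at \<open>- 1\<close>. Hence the addition
  theorem applies at every index.\<close>

lemma bdif_dif_cosmode:
  assumes i: "i < N"
  shows "bdif N (dif N (cosmode N v)) i = (2 - 2 * cos (pi / N)) *\<^sub>R cosmode N v i"
proof -
  have N: "real N > 0" using i by simp
  define c where "c = (\<lambda>x::real. cos (pi * x / N))"
  have d: "dif N (cosmode N v) j = (c (j + 1) - c j) *\<^sub>R v" if "j < N" for j
  proof (cases "Suc j < N")
    case True
    then show ?thesis by (simp add: dif_def nxt_def cosmode_def c_def scaleR_diff_left add.commute)
  next
    case False
    then have "real N = real j + 1" using that by linarith
    then have "c (real j + 1) = -1" using N by (simp add: c_def)
    then show ?thesis using False by (simp add: dif_def nxt_def cosmode_def scaleR_diff_left) (simp add: c_def add.commute)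
  qed
  have p: "prv N (dif N (cosmode N v)) i = (c i - c (real i - 1)) *\<^sub>R v"
  proof (cases "i = 0")
    case True
    have "c (real (N - 1)) = - c (-1)"
    proof -
      have "real (N - 1) = real N - 1" using i by (simp add: of_nat_diff)
      then have "pi * real (N - 1) / N = pi + pi * (-1) / N" using N by (simp add: field_simps)
      then show ?thesis by (simp add: c_def)
    qed
    moreover have "c (real (N - 1) + 1) = -1" using i by (simp add: c_def of_nat_diff)
    moreover have "c 0 = 1" by (simp add: c_def)
    ultimately show ?thesis using d[of "N - 1"] i True
      by (simp add: prv_def flip: scaleR_minus_left)
  next
    case False
    then show ?thesis using d[of "i - 1"] i by (simp add: prv_def of_nat_diff)
  qed
  have "c (real i + 1) + c (real i - 1) = 2 * c i * cos (pi / N)"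
    by (simp add: c_def add_divide_distrib diff_divide_distrib distrib_left right_diff_distrib cos_add cos_diff)
  then have eq: "c i - c (real i - 1) - (c (real i + 1) - c i) = (2 - 2 * cos (pi / N)) * c i"
    by (simp add: algebra_simps)
  have "bdif N (dif N (cosmode N v)) i = (c i - c (real i - 1) - (c (real i + 1) - c i)) *\<^sub>R v"
    unfolding bdif_def p d[OF i] by (simp only: scaleR_diff_left of_nat_add of_nat_1)
  then show ?thesis unfolding eq by (simp add: cosmode_def c_def)
qed

lemma eigenvalue_le:
  assumes "N > 0" shows "2 - 2 * cos (pi / N) \<le> (pi / real N)\<^sup>2" "2 - 2 * cos (pi / N) \<ge> 0"
proof -
  define x where "x = pi / N"
  have "2 - 2 * cos x = 4 * (sin (x/2))\<^sup>2"
    using cos_double_sin[of "x/2"] by simp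
  also have "\<dots> \<le> 4 * (x/2)\<^sup>2"
    by (intro mult_left_mono iffD1[OF abs_le_square_iff] abs_sin_x_le_abs_x) auto
  finally show "2 - 2 * cos (pi / N) \<le> (pi / real N)\<^sup>2" by (simp add: x_def power_divide)
  show "2 - 2 * cos (pi / N) \<ge> 0" by simp
qed

lemma sum_dif_cosmode:
  fixes v :: "'v::real_inner"
  assumes "N > 0"
  shows "(\<Sum>i<N. dif N (cosmode N v) i \<bullet> dif N y i) = (2 - 2 * cos (pi / N)) * (\<Sum>i<N. cosmode N v i \<bullet> y i)"
  unfolding sum_dif_bdif[OF assms] by (simp add: bdif_dif_cosmode sum_distrib_left)

lemma sqnorm_dif_cosmode:
  fixes v :: "'v::real_inner"
  assumes "N > 0"
  shows "sqnorm N (dif N (cosmode N v)) = (2 - 2 * cos (pi / N)) * sqnorm N (cosmode N v)"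
  using sum_dif_cosmode[OF assms, of v "cosmode N v"] by (simp add: sqnorm_def power2_norm_eq_inner)

lemma young: "2 * (x \<bullet> y) \<le> (norm x)\<^sup>2 + (norm y)\<^sup>2" for x y :: "'v::real_inner"
proof -
  have "0 \<le> (norm (x - y))\<^sup>2" by simp
  then show ?thesis by (simp add: power2_norm_eq_inner inner_diff_left inner_diff_right inner_commute)
qed

definition negp :: "nat \<Rightarrow> (nat \<Rightarrow> 'v::real_vector \<times> 'v) \<Rightarrow> nat \<Rightarrow> 'v" where
  "negp N z i = snd (z i) - real N *\<^sub>R dif N (\<lambda>i. fst (z i)) i"

text \<open>On the positive space the action equals \<open>sqnorm\<close> of \<open>p\<close>, and
  by the Poincare inequality \<open>sqnorm\<close> of \<open>q\<close> is at most a quarter of this;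
  4/5 is the inverse of 1 + 1/4.\<close>

lemma act_of_negp_0:
  assumes N: "N > 0" and z: "\<And>i. i < N \<Longrightarrow> negp N z i = 0"
  shows "4 / 5 * sqnorm N z \<le> act N z"
proof -
  define w where "w = sqnorm N (dif N (\<lambda>i. fst (z i)))"
  have s: "snd (z i) = real N *\<^sub>R dif N (\<lambda>i. fst (z i)) i" if "i < N" for i
    using z[OF that] by (simp add: negp_def)
  have a: "act N z = (real N)\<^sup>2 * w"
    by (simp add: act_def s w_def sqnorm_def dot_square_norm sum_distrib_left) (simp add: power2_eq_square mult_ac)
  have "sqnorm N (\<lambda>i. snd (z i)) = (real N)\<^sup>2 * w"
    by (simp add: sqnorm_def s w_def power_mult_distrib sum_distrib_left)
  then show ?thesis using discrete_poincare[OF N, of "\<lambda>i. fst (z i)"] unfolding sqnorm_prod[of N z] a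
    by (simp add: w_def)
qed

text \<open>The first summands form the element of the negative space \<open>p = - N dq\<close> whose projection \<open>negp\<close> is
  \<open>u\<close>; the direction added in the interior of the ball lies in the positive space \<open>p = N dq\<close>.\<close>

definition hemisphere :: "nat \<Rightarrow> 'v::real_normed_vector \<Rightarrow> (nat \<Rightarrow> 'v) \<Rightarrow> nat \<Rightarrow> 'v \<times> 'v" where
  "hemisphere N v u i =
    (adif N (\<lambda>i. - (1 / (2 * real N)) *\<^sub>R u i) i + (1 - sqnorm N u) *\<^sub>R cosmode N v i,
     (1/2) *\<^sub>R u i + ((1 - sqnorm N u) * real N) *\<^sub>R dif N (cosmode N v) i)"

lemma dif_fst_hemisphere:
  "i < N \<Longrightarrow> dif N (\<lambda>i. fst (hemisphere N v u i)) i =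
     - (1 / (2 * real N)) *\<^sub>R u i + (1 - sqnorm N u) *\<^sub>R dif N (cosmode N v) i"
  by (simp add: hemisphere_def dif_add dif_adif)

text \<open>The added direction lies in the positive space, so that \<open>negp\<close> does not see
  it. Therefore, if a deformation of the half space fixes its boundary, \<open>no_retraction\<close>
  applies to \<open>negp\<close> after that deformation.\<close>

lemma negp_hemisphere: "i < N \<Longrightarrow> negp N (hemisphere N v u) i = u i"
  unfolding negp_def by (simp add: dif_fst_hemisphere) (simp add: hemisphere_def algebra_simps flip: scaleR_2)

lemma act_hemisphere_boundary:
  fixes v :: "'v::euclidean_space"
  assumes "sqnorm N u = 1" shows "act N (hemisphere N v u) \<le> 0"
proof -
  have "snd (hemisphere N v u i) \<bullet> dif N (\<lambda>i. fst (hemisphere N v u i)) i \<le> 0" if "i < N" for i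
    using that assms by (simp add: dif_fst_hemisphere) (simp add: hemisphere_def)
  then show ?thesis unfolding act_def by (intro mult_nonneg_nonpos sum_nonpos) auto
qed

text \<open>If all points vanish, then so does \<open>u\<close>; but then the added direction has
  its full factor 1, and its value at index 0 is \<open>v\<close>.\<close>

lemma sqnorm_hemisphere_pos:
  fixes v :: "'v::euclidean_space"
  assumes N: "N > 0" and v: "norm v = 1"
  shows "sqnorm N (hemisphere N v u) > 0"
proof (rule ccontr)
  assume "\<not> ?thesis"
  then have "sqnorm N (hemisphere N v u) = 0" using sqnorm_nonneg[of N "hemisphere N v u"] by simp
  then have z: "hemisphere N v u i = 0" if "i < N" for i
    using that sqnorm_pos[of i N "hemisphere N v u"] by fastforce
  have u: "u i = 0" if "i < N" for i
  proof -
    have "snd (hemisphere N v u i) = 0" "dif N (\<lambda>i. fst (hemisphere N v u i)) i = 0"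
      using that z by (auto simp: dif_def nxt_def)
    then show ?thesis using negp_hemisphere[OF that, of v u] by (simp add: negp_def)
  qed
  then have "sqnorm N u = 0" by (simp add: sqnorm_def)
  moreover have "adif N (\<lambda>i. - (1 / (2 * real N)) *\<^sub>R u i) 0 = 0" using u by (simp add: adif_def)
  ultimately have "fst (hemisphere N v u 0) = v" by (simp add: hemisphere_def cosmode_def)
  with z[OF N] v show False by auto
qed

text \<open>Polarisation bounds the action by the squared norm of \<open>p + N dq\<close>, in which
  the contribution of \<open>u\<close> cancels. What remains is a multiple of the lowest mode.
  Moving the differences from \<open>q\<close> onto this mode costs only its eigenvalue, at most
  \<open>(pi / N)\<^sup>2\<close>, which cancels the factor \<open>N\<^sup>2\<close>.\<close>

lemma act_hemisphere_le:
  fixes v :: "'v::euclidean_space"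
  assumes N: "N > 0"
  shows "act N (hemisphere N v u) \<le> 8 * sqnorm N (hemisphere N v u)"
proof -
  define z where "z = hemisphere N v u"
  define s where "s = 1 - sqnorm N u"
  define q where "q = (\<lambda>i. fst (z i))"
  define p where "p = (\<lambda>i. snd (z i))"
  define e where "e = cosmode N v"
  define \<mu> where "\<mu> = 2 - 2 * cos (pi / N)"
  define W where "W = sqnorm N (dif N e)"
  have NN: "real N > 0" using N by simp
  have dq: "dif N q i = - (1 / (2 * real N)) *\<^sub>R u i + s *\<^sub>R dif N e i" if "i < N" for i
    unfolding q_def z_def e_def s_def by (rule dif_fst_hemisphere[OF that])
  have pe: "p i = (1/2) *\<^sub>R u i + (s * N) *\<^sub>R dif N e i" for i
    by (simp add: p_def z_def hemisphere_def s_def e_def)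
  have sum: "p i + real N *\<^sub>R dif N q i = (2 * s * N) *\<^sub>R dif N e i" if "i < N" for i
  proof -
    have "(2 * s * N) *\<^sub>R dif N e i = (s * N) *\<^sub>R dif N e i + (s * N) *\<^sub>R dif N e i"
      by (simp flip: scaleR_add_left)
    moreover have "real N *\<^sub>R dif N q i = - (1/2) *\<^sub>R u i + (s * N) *\<^sub>R dif N e i"
      using NN by (simp add: dq[OF that] scaleR_add_right scaleR_diff_right mult.commute)
    ultimately show ?thesis by (simp add: pe)
  qed
  have "4 * act N z = (\<Sum>i<N. 4 * (p i \<bullet> (real N *\<^sub>R dif N q i)))"
    by (simp add: act_def p_def q_def sum_distrib_left)
  also have "\<dots> \<le> (\<Sum>i<N. (norm (p i + real N *\<^sub>R dif N q i))\<^sup>2)"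
  proof (intro sum_mono)
    fix i
    have "0 \<le> (norm (p i - real N *\<^sub>R dif N q i))\<^sup>2" by simp
    then show "4 * (p i \<bullet> (real N *\<^sub>R dif N q i)) \<le> (norm (p i + real N *\<^sub>R dif N q i))\<^sup>2"
      by (simp add: power2_norm_eq_inner inner_diff_left inner_diff_right inner_add_left inner_add_right inner_commute)
  qed
  also have "\<dots> = (2 * s * N)\<^sup>2 * W"
    by (simp add: sum W_def sqnorm_def power_mult_distrib sum_distrib_left)
  finally have 1: "act N z \<le> s\<^sup>2 * N\<^sup>2 * W" by (simp add: power_mult_distrib)
  have W: "W = \<mu> * sqnorm N e" unfolding W_def e_def \<mu>_def by (rule sqnorm_dif_cosmode[OF N])
  \<comment> \<open>The mode is tested against \<open>p + N dq\<close>. Young's inequality returns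
    \<open>s\<^sup>2 * N\<^sup>2 * W\<close> twice on the right, against four times on the
    left.\<close>
  have "4 * (s\<^sup>2 * N\<^sup>2 * W) = 2 * (\<Sum>i<N. (p i + real N *\<^sub>R dif N q i) \<bullet> ((s * N) *\<^sub>R dif N e i))"
    by (simp add: sum W_def sqnorm_def dot_square_norm sum_distrib_left) (simp add: power2_eq_square mult_ac)
  also have "\<dots> = (\<Sum>i<N. 2 * (p i \<bullet> ((s * N) *\<^sub>R dif N e i))) + 2 * s * (real N)\<^sup>2 * (\<Sum>i<N. dif N e i \<bullet> dif N q i)"
    by (simp add: inner_add_left inner_commute sum.distrib sum_distrib_left power2_eq_square algebra_simps)
  also have "(\<Sum>i<N. dif N e i \<bullet> dif N q i) = \<mu> * (\<Sum>i<N. e i \<bullet> q i)"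
    unfolding e_def \<mu>_def by (rule sum_dif_cosmode[OF N])
  also have "2 * s * (real N)\<^sup>2 * (\<mu> * (\<Sum>i<N. e i \<bullet> q i)) = (real N)\<^sup>2 * \<mu> * (\<Sum>i<N. 2 * ((s *\<^sub>R e i) \<bullet> q i))"
    by (simp add: sum_distrib_left mult_ac)
  also have "(\<Sum>i<N. 2 * (p i \<bullet> ((s * N) *\<^sub>R dif N e i))) \<le> (\<Sum>i<N. (norm (p i))\<^sup>2 + (norm ((s * N) *\<^sub>R dif N e i))\<^sup>2)"
    by (intro sum_mono young)
  also have "\<dots> = sqnorm N p + s\<^sup>2 * N\<^sup>2 * W"
    by (simp add: W_def sqnorm_def sum.distrib power_mult_distrib sum_distrib_left)
  also have "(real N)\<^sup>2 * \<mu> * (\<Sum>i<N. 2 * ((s *\<^sub>R e i) \<bullet> q i)) \<le> (real N)\<^sup>2 * \<mu> * (\<Sum>i<N. (norm (s *\<^sub>R e i))\<^sup>2 + (norm (q i))\<^sup>2)"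
    using eigenvalue_le(2)[OF N] by (intro mult_left_mono sum_mono young) (auto simp: \<mu>_def)
  also have "\<dots> = s\<^sup>2 * N\<^sup>2 * W + (real N)\<^sup>2 * \<mu> * sqnorm N q"
    by (simp add: W sqnorm_def sum.distrib power_mult_distrib algebra_simps flip: sum_distrib_left)
  finally have 2: "2 * (s\<^sup>2 * N\<^sup>2 * W) \<le> sqnorm N p + (real N)\<^sup>2 * \<mu> * sqnorm N q" by (simp add: mult_ac)
  \<comment> \<open>Rounding \<open>pi\<close> up to 4 gives 16, and half of it is the constant 8 of
    the statement.\<close>
  have "(real N)\<^sup>2 * \<mu> \<le> pi\<^sup>2" using eigenvalue_le(1)[OF N] NN by (simp add: \<mu>_def field_simps)
  also have "\<dots> \<le> 4\<^sup>2" using pi_less_4 pi_gt_zero by (intro power_mono) auto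
  also have "(4::real)\<^sup>2 = 16" by simp
  finally have "(real N)\<^sup>2 * \<mu> * sqnorm N q \<le> 16 * sqnorm N q" by (intro mult_right_mono sqnorm_nonneg)
  moreover have "sqnorm N p \<le> 16 * sqnorm N p" using sqnorm_nonneg[of N p] by simp
  ultimately have "2 * (s\<^sup>2 * N\<^sup>2 * W) \<le> 16 * (sqnorm N p + sqnorm N q)" using 2 by simp
  then show ?thesis using 1 sqnorm_prod[of N z] by (simp add: z_def p_def q_def)
qed

lemma continuous_on_dif:
  fixes f :: "'x::topological_space \<Rightarrow> nat \<Rightarrow> 'v::real_normed_vector"
  assumes "\<And>i. i < N \<Longrightarrow> continuous_on D (\<lambda>u. f u i)" "i < N"
  shows "continuous_on D (\<lambda>u. dif N (\<lambda>i. f u i) i)"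
  using assms by (cases "Suc i < N") (auto simp: dif_def nxt_def intro!: continuous_intros)

lemma continuous_on_bdif:
  fixes f :: "'x::topological_space \<Rightarrow> nat \<Rightarrow> 'v::real_normed_vector"
  assumes "\<And>i. i < N \<Longrightarrow> continuous_on D (\<lambda>u. f u i)" "i < N"
  shows "continuous_on D (\<lambda>u. bdif N (\<lambda>i. f u i) i)"
  using assms by (cases "i = 0") (auto simp: bdif_def prv_def intro!: continuous_intros)

section \<open>Deforming the half space by gradient steps\<close>

context discrete_hamiltonian
begin

lemma continuous_on_ham:
  assumes "\<And>i. i < N \<Longrightarrow> continuous_on D (\<lambda>u. f u i)"
  shows "continuous_on D (\<lambda>u. ham (f u))"
  unfolding ham_def
  by (intro continuous_on_sum continuous_on_compose2[OF H_cont[of UNIV] assms]) auto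

lemma continuous_on_quo:
  assumes f: "\<And>i. i < N \<Longrightarrow> continuous_on D (\<lambda>u. f u i)"
    and "\<And>u. u \<in> D \<Longrightarrow> sqnorm N (f u) > 0"
  shows "continuous_on D (\<lambda>u. quo (f u))"
  unfolding quo_def act_def
  by (intro continuous_intros continuous_on_dif continuous_on_ham f)
     (auto simp: ham_pos[OF assms(2), THEN less_imp_neq, THEN not_sym])

lemma continuous_on_grd:
  assumes f: "\<And>i. i < N \<Longrightarrow> continuous_on D (\<lambda>u. f u i)"
    and "\<And>u. u \<in> D \<Longrightarrow> sqnorm N (f u) > 0" and "i < N"
  shows "continuous_on D (\<lambda>u. grd (f u) i)"
  unfolding grd_def agrad_def
  by (intro continuous_intros continuous_on_dif continuous_on_bdif continuous_on_quo
       continuous_on_compose2[OF F_cont f] f) (use assms in auto)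

lemma continuous_on_coordinate: "continuous_on D (\<lambda>u::nat \<Rightarrow> 'v::topological_space. u i)"
  by (rule continuous_on_subset[OF continuous_on_product_coordinates subset_UNIV])

lemma continuous_on_hemisphere:
  fixes D :: "(nat \<Rightarrow> 'v::real_normed_vector) set"
  shows "continuous_on D (\<lambda>u. hemisphere N v u i)"
  unfolding hemisphere_def adif_def sqnorm_def
  by (intro continuous_intros continuous_on_coordinate)

text \<open>Were there no such point, \<open>K\<close> steps would bring every value below
  \<open>2 * a\<close>. But the map \<open>g K\<close> fixes the images of the boundary sphere, so
  that \<open>negp\<close> has a zero on its image. This is a point of the positive space, where the
  quotient is at least \<open>2 * a\<close>.\<close>

lemma approx_critical:
  assumes C: "c > 0" "C > 0" "\<And>z. c * (norm z)\<^sup>2 \<le> H z" "\<And>z. H z \<le> C * (norm z)\<^sup>2"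
    and \<mu>: "\<mu> > 0"
  shows "\<exists>z. sqnorm N z > 0 \<and> 2 / (5 * C) \<le> quo z \<and> quo z \<le> 8 / c \<and> sqnorm N (grd z) < \<mu> * sqnorm N z"
proof (rule ccontr)
  assume "\<not> ?thesis"
  then have noncrit: "sqnorm N (grd z) \<ge> \<mu> * sqnorm N z" if "sqnorm N z > 0" "2 / (5 * C) \<le> quo z" "quo z \<le> 8 / c" for z
    using that not_le by blast
  \<comment> \<open>Half of the lower bound \<open>4 / (5 * C)\<close> on the positive space, which
    leaves the values between \<open>a\<close> and \<open>2 * a\<close> to the cutoff
    \<open>\<theta>\<close>.\<close>
  define a where "a = 2 / (5 * C)"
  define b where "b = 8 / c"
  obtain v :: 'a where v: "norm v = 1" using vector_choose_size[of 1] by auto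
  have "c \<le> C" using order_trans[OF C(3)[of "(v,0)"] C(4)[of "(v,0)"]] v by (simp add: norm_prod_def)
  then have ab: "0 < a" "a \<le> b" using C by (auto simp: a_def b_def frac_le)
  have noncrit': "sqnorm N (grd z) \<ge> \<mu> * sqnorm N z" if "sqnorm N z > 0" "a \<le> quo z" "quo z \<le> b" for z
    using noncrit[of z] that by (simp add: a_def b_def)
  obtain \<epsilon> \<delta> where \<epsilon>: "\<epsilon> > 0" and \<delta>: "\<delta> > 0" and desc:
    "\<And>z s. sqnorm N z > 0 \<Longrightarrow> a \<le> quo z \<Longrightarrow> quo z \<le> b \<Longrightarrow> 0 \<le> s \<Longrightarrow> s \<le> 1 \<Longrightarrow>
        quo (\<lambda>i. z i - (s * \<epsilon>) *\<^sub>R grd z i) \<le> quo z - s * \<delta>"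
    using descent_step[OF ab \<mu> noncrit'] by blast
  \<comment> \<open>The cutoff keeps the step continuous: points of value at most \<open>a\<close>,
    in particular the images of the boundary sphere, do not move, and points of value at least
    \<open>2 * a\<close> take the full step.\<close>
  define \<theta> where "\<theta> = (\<lambda>t. max 0 (min 1 ((t - a) / a)))"
  have \<theta>: "0 \<le> \<theta> t" "\<theta> t \<le> 1" for t by (auto simp: \<theta>_def)
  have \<theta>0: "\<theta> t = 0" if "t \<le> a" for t
  proof -
    have "(t - a) / a \<le> 0" using that ab by (intro divide_nonpos_pos) auto
    then show ?thesis by (simp add: \<theta>_def)
  qed
  have \<theta>1: "\<theta> t = 1" if "t \<ge> 2 * a" for t using that ab by (simp add: \<theta>_def pos_le_divide_eq)
  define \<Phi> where "\<Phi> = (\<lambda>z i. z i - (\<theta> (quo z) * \<epsilon>) *\<^sub>R grd z i)"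
  define g where "g = (\<lambda>k u. (\<Phi> ^^ k) (hemisphere N v u))"
  define D where "D = {u::nat\<Rightarrow>'a. (\<forall>i\<ge>N. u i = 0) \<and> (\<Sum>i<N. (norm (u i))\<^sup>2) \<le> 1}"
  have g0: "g 0 u = hemisphere N v u" and gS: "g (Suc k) u = \<Phi> (g k u)" for k u
    by (auto simp: g_def)
  have pos: "sqnorm N (g k u) > 0" for k u
  proof (induction k)
    case 0
    then show ?case unfolding g0 by (rule sqnorm_hemisphere_pos[OF N_pos v])
  next
    case (Suc k)
    have "g (Suc k) u = (\<lambda>i. g k u i + (- \<theta> (quo (g k u)) * \<epsilon>) *\<^sub>R grd (g k u) i)"
      by (simp add: gS \<Phi>_def)
    then have "sqnorm N (g (Suc k) u) = sqnorm N (g k u) + (- \<theta> (quo (g k u)) * \<epsilon>)\<^sup>2 * sqnorm N (grd (g k u))"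
      using sqnorm_step[OF Suc] by (simp only:)
    then show ?case using Suc by (simp add: add_pos_nonneg sqnorm_nonneg)
  qed
  \<comment> \<open>Either the value has fallen below \<open>2 * a\<close>, where it stays because
    no step increases it, or every step so far has gained \<open>\<delta>\<close>.\<close>
  have dec: "quo (g k u) \<le> b \<and> (quo (g k u) < 2 * a \<or> quo (g k u) \<le> b - k * \<delta>)" for k u
  proof (induction k)
    case 0
    define z where "z = hemisphere N v u"
    have z: "sqnorm N z > 0" using pos[of 0 u] by (simp add: g0 z_def)
    have "act N z \<le> 8 * sqnorm N z" unfolding z_def by (rule act_hemisphere_le[OF N_pos])
    also have "\<dots> \<le> b * ham z" using ham_ge[OF C(3), of z] C(1) by (simp add: b_def field_simps)
    finally have "quo z \<le> b" using ham_pos[OF z] by (simp add: quo_def pos_divide_le_eq)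
    then show ?case by (simp add: g0 z_def)
  next
    case (Suc k)
    define z where "z = g k u"
    have z: "sqnorm N z > 0" "quo z \<le> b" "quo z < 2 * a \<or> quo z \<le> b - k * \<delta>"
      using pos Suc by (auto simp: z_def)
    have "quo (\<Phi> z) \<le> quo z - \<theta> (quo z) * \<delta>"
    proof (cases "a \<le> quo z")
      case True
      then show ?thesis unfolding \<Phi>_def using \<theta> z by (intro desc) auto
    next
      case False
      then show ?thesis by (simp add: \<Phi>_def \<theta>0)
    qed
    moreover have "\<theta> (quo z) * \<delta> \<ge> 0" using \<theta> \<delta> by simp
    ultimately have "quo (\<Phi> z) \<le> b \<and> (quo (\<Phi> z) < 2 * a \<or> quo (\<Phi> z) \<le> b - Suc k * \<delta>)"
      using z \<theta>1[of "quo z"] by (cases "quo z < 2 * a") (auto simp: algebra_simps)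
    then show ?case by (simp add: gS z_def)
  qed
  have cont: "\<forall>i<N. continuous_on D (\<lambda>u. g k u i)" for k
  proof (induction k)
    case 0
    show ?case unfolding g0 by (simp add: continuous_on_hemisphere)
  next
    case (Suc k)
    have "continuous_on D (\<lambda>u. g k u i)" if "i < N" for i using Suc that by blast
    then show ?case unfolding gS \<Phi>_def \<theta>_def
      by (intro allI impI continuous_intros continuous_on_quo continuous_on_grd) (use pos ab in auto)
  qed
  have bd: "g k u = hemisphere N v u" if "sqnorm N u = 1" for k u
  proof (induction k)
    case (Suc k)
    have "quo (hemisphere N v u) \<le> 0"
      using act_hemisphere_boundary[OF that] ham_pos[of "hemisphere N v u"] pos[of 0 u]
      by (simp add: quo_def g0 divide_nonpos_pos)
    then have "\<theta> (quo (hemisphere N v u)) = 0" using ab by (intro \<theta>0) auto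
    then show ?case by (simp add: gS Suc \<Phi>_def)
  qed (simp add: g0)
  obtain K :: nat where K: "b - K * \<delta> < 2 * a"
  proof -
    obtain K :: nat where "(b - 2 * a) / \<delta> < K" using reals_Archimedean2 by blast
    then show ?thesis using that[of K] \<delta> by (simp add: pos_divide_less_eq)
  qed
  have "\<exists>u\<in>D. \<forall>i<N. negp N (g K u) i = 0"
    unfolding D_def
  proof (rule no_retraction[OF N_pos], fold D_def)
    fix i assume i: "i < N"
    show "continuous_on D (\<lambda>u. negp N (g K u) i)"
      unfolding negp_def using cont[of K] i
      by (intro continuous_intros continuous_on_dif) auto
    fix u :: "nat \<Rightarrow> 'a" assume "(\<Sum>i<N. (norm (u i))\<^sup>2) = 1"
    then have "sqnorm N u = 1" by (simp add: sqnorm_def)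
    then show "negp N (g K u) i = u i" using negp_hemisphere[OF i] by (simp add: bd)
  qed
  then obtain u where u: "\<And>i. i < N \<Longrightarrow> negp N (g K u) i = 0" by blast
  have "2 * a * ham (g K u) \<le> 4 / 5 * sqnorm N (g K u)"
    using ham_le[OF C(4), of "g K u"] C(2) by (simp add: a_def field_simps)
  also have "\<dots> \<le> act N (g K u)" by (rule act_of_negp_0[OF N_pos u])
  finally have "2 * a \<le> quo (g K u)"
    using ham_pos[OF pos] by (simp add: quo_def pos_le_divide_eq)
  with dec[of K u] K show False by auto
qed

lemma sqnorm_scale: "sqnorm N (\<lambda>i. t *\<^sub>R z i) = t\<^sup>2 * sqnorm N z"
  by (simp add: sqnorm_def power_mult_distrib sum_distrib_left)

lemma dif_scale: "dif N (\<lambda>i. t *\<^sub>R x i) i = t *\<^sub>R dif N x i"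
  by (simp add: dif_def nxt_def scaleR_diff_right)

lemma agrad_scale: "agrad N (\<lambda>i. t *\<^sub>R z i) i = t *\<^sub>R agrad N z i"
  by (simp add: agrad_def dif_def bdif_def nxt_def prv_def scaleR_diff_right mult.commute)

lemma quo_scale: "t > 0 \<Longrightarrow> quo (\<lambda>i. t *\<^sub>R z i) = quo z"
proof -
  assume t: "t > 0"
  have "act N (\<lambda>i. t *\<^sub>R z i) = t\<^sup>2 * act N z"
    by (simp add: act_def dif_scale sum_distrib_left power2_eq_square mult_ac)
  moreover have "ham (\<lambda>i. t *\<^sub>R z i) = t\<^sup>2 * ham z"
    using t by (simp add: ham_def H_scale sum_distrib_left)
  ultimately show ?thesis using t by (simp add: quo_def)
qed

lemma grd_scale: "t > 0 \<Longrightarrow> grd (\<lambda>i. t *\<^sub>R z i) i = t *\<^sub>R grd z i"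
  by (simp add: grd_def quo_scale agrad_scale F_scale scaleR_diff_right)

text \<open>Scaling to maximum norm 1, and not to \<open>sqnorm\<close> 1, lets a uniform limit of
  the interpolated loops inherit a nonzero value.\<close>

lemma approx_critical_normalised:
  assumes C: "c > 0" "C > 0" "\<And>z. c * (norm z)\<^sup>2 \<le> H z" "\<And>z. H z \<le> C * (norm z)\<^sup>2"
  obtains z l where "2 / (5 * C) \<le> l" "l \<le> 8 / c"
    "\<And>i. i < N \<Longrightarrow> norm (z i) \<le> 1" "\<exists>i<N. norm (z i) = 1"
    "\<And>i. i < N \<Longrightarrow> norm (agrad N z i - l *\<^sub>R F (z i)) \<le> 1 / N"
proof -
  have NN: "real N > 0" using N_pos by simp
  \<comment> \<open>After scaling, \<open>sqnorm\<close> is at most \<open>N\<close>, so that the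
    tolerance \<open>1 / N ^ 3\<close> becomes \<open>(1 / N)\<^sup>2\<close>, an error of
    \<open>1 / N\<close> at each point.\<close>
  obtain y where y: "sqnorm N y > 0" "2 / (5 * C) \<le> quo y" "quo y \<le> 8 / c" "sqnorm N (grd y) < 1 / N ^ 3 * sqnorm N y"
    using approx_critical[OF C, of "1 / N ^ 3"] NN by auto
  define S where "S = (\<lambda>i. norm (y i)) ` {..<N}"
  have S: "finite S" "S \<noteq> {}" using N_pos by (auto simp: S_def)
  define M where "M = Max S"
  have M1: "norm (y i) \<le> M" if "i < N" for i unfolding M_def using S that by (intro Max_ge) (auto simp: S_def)
  have M2: "\<exists>i<N. norm (y i) = M" using Max_in[OF S] unfolding M_def[symmetric] by (auto simp: S_def)
  have "M > 0"
  proof (rule ccontr)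
    assume "\<not> M > 0"
    then have "y i = 0" if "i < N" for i using M1[OF that] by (smt (verit) norm_le_zero_iff)
    then show False using y(1) by (simp add: sqnorm_def)
  qed
  define t where "t = 1 / M"
  have t: "t > 0" using \<open>M > 0\<close> by (simp add: t_def)
  define z where "z = (\<lambda>i. t *\<^sub>R y i)"
  have z1: "norm (z i) \<le> 1" if "i < N" for i using M1[OF that] \<open>M > 0\<close> by (simp add: z_def t_def)
  have qz: "quo z = quo y" unfolding z_def by (rule quo_scale[OF t])
  have gz: "grd z = (\<lambda>i. t *\<^sub>R grd y i)" unfolding z_def by (simp add: grd_scale[OF t] fun_eq_iff)
  have "sqnorm N z \<le> N"
  proof -
    have "sqnorm N z \<le> (\<Sum>i<N. 1)" unfolding sqnorm_def using z1 by (intro sum_mono) (auto simp: power_le_one)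
    then show ?thesis by simp
  qed
  have "sqnorm N (grd z) = t\<^sup>2 * sqnorm N (grd y)" unfolding gz by (rule sqnorm_scale)
  also have "\<dots> \<le> t\<^sup>2 * (1 / N ^ 3 * sqnorm N y)" using y(4) by (intro mult_left_mono) auto
  also have "\<dots> = 1 / N ^ 3 * sqnorm N z" by (simp add: z_def sqnorm_scale)
  also have "\<dots> \<le> 1 / N ^ 3 * N" using \<open>sqnorm N z \<le> N\<close> by (intro mult_left_mono) auto
  also have "\<dots> = (1 / N)\<^sup>2" using NN by (simp add: power2_eq_square power3_eq_cube)
  finally have gN: "sqnorm N (grd z) \<le> (1 / N)\<^sup>2" .
  show ?thesis
  proof (rule that[of "quo y" z])
    show "\<exists>i<N. norm (z i) = 1" using M2 \<open>M > 0\<close> by (auto simp: z_def t_def)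
    fix i assume i: "i < N"
    have "norm (grd z i) \<le> sqrt (sqnorm N (grd z))" by (rule norm_le_sqnorm[OF i])
    also have "\<dots> \<le> 1 / N" using gN real_sqrt_le_mono by fastforce
    finally show "norm (agrad N z i - quo y *\<^sub>R F (z i)) \<le> 1 / N" by (simp add: grd_def qz)
  qed (use y z1 in auto)
qed

end

section \<open>The continuum limit\<close>

definition clamp01 :: "real \<Rightarrow> real" where "clamp01 x = max 0 (min 1 x)"

lemma clamp01_mono: "x \<le> y \<Longrightarrow> clamp01 x \<le> clamp01 y"
  unfolding clamp01_def by (intro max.mono min.mono) auto

lemma sum_clamp01: "(\<Sum>j<M. clamp01 (x - real j)) = min (real M) (max 0 x)"
  by (induction M) (auto simp: clamp01_def)

text \<open>Step \<open>j\<close> is traversed between the times \<open>j / N\<close> and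
  \<open>(j + 1) / N\<close>. The clamped factor is the fraction covered at time \<open>t\<close>,
  so that no interval containing \<open>t\<close> has to be singled out.\<close>

definition polygon :: "nat \<Rightarrow> nat \<Rightarrow> (nat \<Rightarrow> 'v::real_normed_vector) \<Rightarrow> real \<Rightarrow> 'v" where
  "polygon M N x t = x 0 + (\<Sum>j<M. clamp01 (real N * t - real j) *\<^sub>R (x (Suc j) - x j))"

lemma polygon_node:
  assumes "N > 0" "k \<le> M" shows "polygon M N x (real k / real N) = x k"
proof -
  have "(\<Sum>j<M. clamp01 (real k - real j) *\<^sub>R (x (Suc j) - x j)) = (\<Sum>j<k. x (Suc j) - x j)"
    using assms by (intro sum.mono_neutral_cong_right) (auto simp: clamp01_def)
  then show ?thesis using assms by (simp add: polygon_def sum_lessThan_telescope)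
qed

text \<open>The increment combines the steps that meet the interval from \<open>s\<close> to
  \<open>t\<close>, with nonnegative weights of sum \<open>N * (t - s)\<close>. With
  \<open>v = 0\<close> this is a Lipschitz bound; with the expected velocity it yields the
  derivative of the limit.\<close>

lemma polygon_increment:
  assumes N: "N > 0" and st: "0 \<le> s" "s \<le> t" "real N * t \<le> real M"
    and B: "\<And>j. j < M \<Longrightarrow> real N * s < real j + 1 \<Longrightarrow> real j < real N * t \<Longrightarrow>
              norm (real N *\<^sub>R (x (Suc j) - x j) - v) \<le> B"
  shows "norm (polygon M N x t - polygon M N x s - (t - s) *\<^sub>R v) \<le> B * (t - s)"
proof -
  define c where "c = (\<lambda>j. clamp01 (real N * t - real j) - clamp01 (real N * s - real j))"
  have NN: "real N > 0" using N by simp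
  have Nst: "real N * s \<le> real N * t" using st NN by simp
  have c0: "c j \<ge> 0" for j using clamp01_mono[of "real N * s - real j" "real N * t - real j"] Nst by (simp add: c_def)
  have sumc: "(\<Sum>j<M. c j) = real N * (t - s)"
  proof -
    have "0 \<le> real N * s" using st by simp
    then have "min (real M) (max 0 (real N * t)) = real N * t" "min (real M) (max 0 (real N * s)) = real N * s"
      using st Nst by auto
    then show ?thesis unfolding c_def sum_subtractf sum_clamp01 by (simp add: right_diff_distrib)
  qed
  have "polygon M N x t - polygon M N x s = (\<Sum>j<M. c j *\<^sub>R (x (Suc j) - x j))"
    by (simp add: polygon_def c_def scaleR_diff_left sum_subtractf)
  moreover have "(t - s) *\<^sub>R v = (\<Sum>j<M. c j *\<^sub>R (v /\<^sub>R real N))"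
    unfolding scaleR_sum_left[symmetric] sumc using NN by simp
  ultimately have "polygon M N x t - polygon M N x s - (t - s) *\<^sub>R v =
      (\<Sum>j<M. c j *\<^sub>R ((x (Suc j) - x j) - v /\<^sub>R real N))"
    by (simp add: scaleR_diff_right sum_subtractf)
  also have "norm \<dots> \<le> (\<Sum>j<M. c j * (B / real N))"
  proof (rule sum_norm_le)
    fix j assume "j \<in> {..<M}"
    then have j: "j < M" by simp
    show "norm (c j *\<^sub>R ((x (Suc j) - x j) - v /\<^sub>R real N)) \<le> c j * (B / real N)"
    proof (cases "real N * s < real j + 1 \<and> real j < real N * t")
      case True
      have "norm ((x (Suc j) - x j) - v /\<^sub>R real N) = norm (real N *\<^sub>R (x (Suc j) - x j) - v) / real N"
      proof -
        have "(x (Suc j) - x j) - v /\<^sub>R real N = (real N *\<^sub>R (x (Suc j) - x j) - v) /\<^sub>R real N"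
          using NN by (simp add: scaleR_diff_right)
        then show ?thesis by (simp add: divide_inverse_commute)
      qed
      also have "\<dots> \<le> B / real N" using B[OF j] True NN by (intro divide_right_mono) auto
      finally have "c j * norm ((x (Suc j) - x j) - v /\<^sub>R real N) \<le> c j * (B / real N)"
        using c0 by (rule mult_left_mono)
      then show ?thesis using c0[of j] by simp
    next
      case False
      then have "c j = 0" using Nst by (auto simp: c_def clamp01_def)
      then show ?thesis by simp
    qed
  qed
  also have "\<dots> = B * (t - s)" unfolding sum_distrib_right[symmetric] sumc using NN by simp
  finally show ?thesis .
qed

section \<open>Extension of antiperiodic sequences to all indices\<close>

definition antiper :: "nat \<Rightarrow> (nat \<Rightarrow> 'v::real_vector) \<Rightarrow> nat \<Rightarrow> 'v" where
  "antiper N z j = (-1) ^ (j div N) *\<^sub>R z (j mod N)"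

text \<open>At the end of a block the sign in \<open>nxt\<close> makes up for the change of the
  exponent.\<close>

lemma antiper_Suc:
  assumes "N > 0" shows "antiper N z (Suc j) = (-1) ^ (j div N) *\<^sub>R nxt N z (j mod N)"
proof (cases "Suc (j mod N) < N")
  case True
  then have "Suc j mod N = Suc (j mod N)" "Suc j div N = j div N"
    using assms by (auto simp: mod_Suc div_Suc)
  then show ?thesis using True by (simp add: antiper_def nxt_def)
next
  case False
  then have "Suc (j mod N) = N" using assms by (metis Suc_lessI mod_less_divisor)
  then have "Suc j mod N = 0" "Suc j div N = Suc (j div N)"
    by (auto simp: mod_Suc div_Suc)
  then show ?thesis using False by (simp add: antiper_def nxt_def)
qed

lemma antiper_prv:
  assumes "N > 0" shows "antiper N z j = (-1) ^ (Suc j div N) *\<^sub>R prv N z (Suc j mod N)"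
proof (cases "Suc (j mod N) < N")
  case True
  then have "Suc j mod N = Suc (j mod N)" "Suc j div N = j div N"
    using assms by (auto simp: mod_Suc div_Suc)
  then show ?thesis using True by (simp add: antiper_def prv_def)
next
  case False
  then have *: "Suc (j mod N) = N" using assms by (metis Suc_lessI mod_less_divisor)
  then have "Suc j mod N = 0" "Suc j div N = Suc (j div N)" "j mod N = N - 1"
    by (auto simp: mod_Suc div_Suc)
  then show ?thesis using False by (simp add: antiper_def prv_def)
qed

lemma antiper_add: "N > 0 \<Longrightarrow> antiper N z (j + N) = - antiper N z j"
  by (simp add: antiper_def)

lemma nxt_fst: "fst (nxt N z i) = nxt N (\<lambda>i. fst (z i)) i" by (simp add: nxt_def)
lemma prv_snd: "snd (prv N z i) = prv N (\<lambda>i. snd (z i)) i" by (simp add: prv_def)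

lemma norm_fst_bound: "norm (fst v) \<le> norm v"
  by (metis norm_fst_le prod.collapse)

lemma norm_snd_bound: "norm (snd v) \<le> norm v"
  by (metis norm_snd_le prod.collapse)

locale odd_hamiltonian = homogeneous_hamiltonian H F
  for H :: "'a::euclidean_space \<times> 'a \<Rightarrow> real" and F +
  assumes F_odd: "F (- z) = - F z"
begin

lemma F_sign: "F ((-1) ^ k *\<^sub>R z) = (-1) ^ k *\<^sub>R F z"
  by (cases "even k") (auto simp: F_odd)

text \<open>Oddness of \<open>F\<close> carries the equations over to all blocks. The backward
  difference belongs to the index \<open>Suc j\<close>, which is why the second equation evaluates
  \<open>F\<close> there and the first one at \<open>x j\<close>.\<close>

lemma antiper_step:
  assumes N: "N > 0" and z: "\<And>i. i < N \<Longrightarrow> norm (agrad N z i - l *\<^sub>R F (z i)) \<le> e"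
  defines "x \<equiv> antiper N z"
  shows "norm (real N *\<^sub>R (fst (x (Suc j)) - fst (x j)) - l *\<^sub>R snd (F (x j))) \<le> e"
    and "norm (real N *\<^sub>R (snd (x (Suc j)) - snd (x j)) + l *\<^sub>R fst (F (x (Suc j)))) \<le> e"
proof -
  define i where "i = j mod N"
  have i: "i < N" using N by (simp add: i_def)
  have xj: "x j = (-1) ^ (j div N) *\<^sub>R z i" by (simp add: x_def antiper_def i_def)
  have xS: "x (Suc j) = (-1) ^ (j div N) *\<^sub>R nxt N z i"
    unfolding x_def i_def by (rule antiper_Suc[OF N])
  have "real N *\<^sub>R (fst (x (Suc j)) - fst (x j)) - l *\<^sub>R snd (F (x j)) =
      (-1) ^ (j div N) *\<^sub>R snd (agrad N z i - l *\<^sub>R F (z i))"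
    unfolding xj xS F_sign by (simp add: agrad_def dif_def nxt_fst scaleR_diff_right mult.commute)
  also have "norm \<dots> \<le> e" using order_trans[OF norm_snd_bound z[OF i]] by simp
  finally show "norm (real N *\<^sub>R (fst (x (Suc j)) - fst (x j)) - l *\<^sub>R snd (F (x j))) \<le> e" .
  define i' where "i' = Suc j mod N"
  have i': "i' < N" using N by (simp add: i'_def)
  have xS: "x (Suc j) = (-1) ^ (Suc j div N) *\<^sub>R z i'" by (simp add: x_def antiper_def i'_def)
  have xj: "x j = (-1) ^ (Suc j div N) *\<^sub>R prv N z i'"
    unfolding x_def i'_def by (rule antiper_prv[OF N])
  have "real N *\<^sub>R (snd (x (Suc j)) - snd (x j)) + l *\<^sub>R fst (F (x (Suc j))) =
      - ((-1) ^ (Suc j div N) *\<^sub>R fst (agrad N z i' - l *\<^sub>R F (z i')))"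
    unfolding xj xS F_sign by (simp add: agrad_def bdif_def prv_snd scaleR_diff_right mult.commute)
  also have "norm \<dots> \<le> e" using order_trans[OF norm_fst_bound z[OF i']] by simp
  finally show "norm (real N *\<^sub>R (snd (x (Suc j)) - snd (x j)) + l *\<^sub>R fst (F (x (Suc j)))) \<le> e" .
qed

lemma discrete_orbits:
  obtains a b L where "0 < a" "L > 0"
    "\<And>N. N > 0 \<Longrightarrow> \<exists>x l. a \<le> l \<and> l \<le> b \<and> (\<forall>j. x (j + N) = - x j) \<and> (\<forall>j. norm (x j) \<le> 1) \<and>
       (\<exists>j<N. norm (x j) = 1) \<and>
       (\<forall>j. norm (real N *\<^sub>R (x (Suc j) - x j)) \<le> L) \<and>
       (\<forall>j. norm (real N *\<^sub>R (fst (x (Suc j)) - fst (x j)) - l *\<^sub>R snd (F (x j))) \<le> 1 / real N) \<and>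
       (\<forall>j. norm (real N *\<^sub>R (snd (x (Suc j)) - snd (x j)) + l *\<^sub>R fst (F (x (Suc j)))) \<le> 1 / real N)"
proof -
  obtain c C where C: "c > 0" "C > 0" "\<And>z. c * (norm z)\<^sup>2 \<le> H z" "\<And>z. H z \<le> C * (norm z)\<^sup>2"
    using H_bounds by blast
  obtain CF where CF: "CF > 0" "\<And>z. norm (F z) \<le> CF * norm z" using F_bound by blast
  define a where "a = 2 / (5 * C)"
  define b where "b = 8 / c"
  have b: "b > 0" using C by (simp add: b_def)
  have a: "a > 0" using C by (simp add: a_def)
  \<comment> \<open>Each of the two components moves with speed at most \<open>b * CF\<close> plus
    an error of at most 1.\<close>
  define L where "L = 2 * (b * CF + 1)"
  have "\<exists>x l. a \<le> l \<and> l \<le> b \<and> (\<forall>j. x (j + N) = - x j) \<and> (\<forall>j. norm (x j) \<le> 1) \<and>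
       (\<exists>j<N. norm (x j) = 1) \<and>
       (\<forall>j. norm (real N *\<^sub>R (x (Suc j) - x j)) \<le> L) \<and>
       (\<forall>j. norm (real N *\<^sub>R (fst (x (Suc j)) - fst (x j)) - l *\<^sub>R snd (F (x j))) \<le> 1 / real N) \<and>
       (\<forall>j. norm (real N *\<^sub>R (snd (x (Suc j)) - snd (x j)) + l *\<^sub>R fst (F (x (Suc j)))) \<le> 1 / real N)"
    if N: "N > 0" for N
  proof -
    interpret D: discrete_hamiltonian H F N by unfold_locales (rule N)
    obtain z l where zl: "a \<le> l" "l \<le> b"
      and z1: "\<And>i. i < N \<Longrightarrow> norm (z i) \<le> 1" and z2: "\<exists>i<N. norm (z i) = 1"
      and crit: "\<And>i. i < N \<Longrightarrow> norm (agrad N z i - l *\<^sub>R F (z i)) \<le> 1 / N"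
      using D.approx_critical_normalised[OF C, folded a_def b_def] by (metis (no_types, lifting))
    have l: "0 \<le> l" using zl(1) a by simp
    define x where "x = antiper N z"
    have x1: "norm (x j) \<le> 1" for j
      using z1[of "j mod N"] N by (simp add: x_def antiper_def)
    have x2: "\<exists>j<N. norm (x j) = 1" using z2 by (auto simp: x_def antiper_def)
    have s1: "norm (real N *\<^sub>R (fst (x (Suc j)) - fst (x j)) - l *\<^sub>R snd (F (x j))) \<le> 1 / real N"
     and s2: "norm (real N *\<^sub>R (snd (x (Suc j)) - snd (x j)) + l *\<^sub>R fst (F (x (Suc j)))) \<le> 1 / real N" for j
      unfolding x_def using antiper_step[OF N crit] by simp_all
    have Fx: "norm (l *\<^sub>R snd (F (x j))) \<le> b * CF" "norm (l *\<^sub>R fst (F (x j))) \<le> b * CF" for j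
    proof -
      have "norm (F (x j)) \<le> CF" using CF(2)[of "x j"] x1[of j] CF(1) by (smt (verit) mult_left_le)
      then have "norm (snd (F (x j))) \<le> CF" "norm (fst (F (x j))) \<le> CF"
        using norm_snd_bound norm_fst_bound order_trans by blast+
      then show "norm (l *\<^sub>R snd (F (x j))) \<le> b * CF" "norm (l *\<^sub>R fst (F (x j))) \<le> b * CF"
        using l zl b CF by (auto intro!: mult_mono)
    qed
    have N1: "1 / real N \<le> 1" using N by simp
    have "norm (real N *\<^sub>R (x (Suc j) - x j)) \<le> L" for j
    proof -
      have "norm (real N *\<^sub>R (fst (x (Suc j)) - fst (x j))) \<le> b * CF + 1"
        using s1[of j] Fx(1)[of j] N1 norm_triangle_sub[of "real N *\<^sub>R (fst (x (Suc j)) - fst (x j))" "l *\<^sub>R snd (F (x j))"]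
        by linarith
      moreover have "norm (real N *\<^sub>R (snd (x (Suc j)) - snd (x j))) \<le> b * CF + 1"
        using s2[of j] Fx(2)[of "Suc j"] N1 norm_triangle_ineq4[of "real N *\<^sub>R (snd (x (Suc j)) - snd (x j)) + l *\<^sub>R fst (F (x (Suc j)))" "l *\<^sub>R fst (F (x (Suc j)))"]
        by simp
      moreover have "real N *\<^sub>R (x (Suc j) - x j) = (real N *\<^sub>R (fst (x (Suc j)) - fst (x j)), real N *\<^sub>R (snd (x (Suc j)) - snd (x j)))"
        by (simp add: prod_eq_iff)
      ultimately show ?thesis unfolding L_def
        by (smt (verit) norm_Pair_le)
    qed
    then show ?thesis using zl x1 x2 s1 s2 antiper_add[OF N, of z] unfolding x_def[symmetric] by blast
  qed
  moreover have "L > 0" using b CF by (simp add: L_def add_pos_pos)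
  ultimately show ?thesis using that[OF a, of L b] by blast
qed

text \<open>The interval has three units of time: the orbit will be read off on
  \<open>{1..2}\<close>, and the margins provide two-sided derivatives at its ends.\<close>

lemma antiperiodic_limit:
  obtains g l where "l > 0" "continuous_on {0..3} g"
    "\<And>t. t \<in> {0..2} \<Longrightarrow> g (t + 1) = - g t"
    "\<exists>t\<in>{0..1}. g t \<noteq> 0"
    "\<And>t. 0 < t \<Longrightarrow> t < 3 \<Longrightarrow> (g has_vector_derivative l *\<^sub>R (snd (F (g t)), - fst (F (g t)))) (at t)"
proof -
  obtain a b L where a: "0 < a" and L: "L > 0" and
    "\<And>N. N > 0 \<Longrightarrow> \<exists>x l. a \<le> l \<and> l \<le> b \<and> (\<forall>j. x (j + N) = - x j) \<and> (\<forall>j. norm (x j) \<le> 1) \<and>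
       (\<exists>j<N. norm (x j) = 1) \<and>
       (\<forall>j. norm (real N *\<^sub>R (x (Suc j) - x j)) \<le> L) \<and>
       (\<forall>j. norm (real N *\<^sub>R (fst (x (Suc j)) - fst (x j)) - l *\<^sub>R snd (F (x j))) \<le> 1 / real N) \<and>
       (\<forall>j. norm (real N *\<^sub>R (snd (x (Suc j)) - snd (x j)) + l *\<^sub>R fst (F (x (Suc j)))) \<le> 1 / real N)"
    using discrete_orbits by metis
  then have "\<forall>n. \<exists>x l. a \<le> l \<and> l \<le> b \<and> (\<forall>j. x (j + Suc n) = - x j) \<and> (\<forall>j. norm (x j) \<le> 1) \<and>
       (\<exists>j<Suc n. norm (x j) = 1) \<and>
       (\<forall>j. norm (real (Suc n) *\<^sub>R (x (Suc j) - x j)) \<le> L) \<and>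
       (\<forall>j. norm (real (Suc n) *\<^sub>R (fst (x (Suc j)) - fst (x j)) - l *\<^sub>R snd (F (x j))) \<le> 1 / real (Suc n)) \<and>
       (\<forall>j. norm (real (Suc n) *\<^sub>R (snd (x (Suc j)) - snd (x j)) + l *\<^sub>R fst (F (x (Suc j)))) \<le> 1 / real (Suc n))"
    by blast
  then obtain X l where l: "\<And>n. a \<le> l n \<and> l n \<le> b"
    and Xper: "\<And>n j. X n (j + Suc n) = - X n j"
    and X1: "\<And>n j. norm (X n j) \<le> 1" and Xmax: "\<And>n. \<exists>j<Suc n. norm (X n j) = 1"
    and XL: "\<And>n j. norm (real (Suc n) *\<^sub>R (X n (Suc j) - X n j)) \<le> L"
    and Xq: "\<And>n j. norm (real (Suc n) *\<^sub>R (fst (X n (Suc j)) - fst (X n j)) - l n *\<^sub>R snd (F (X n j))) \<le> 1 / real (Suc n)"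
    and Xp: "\<And>n j. norm (real (Suc n) *\<^sub>R (snd (X n (Suc j)) - snd (X n j)) + l n *\<^sub>R fst (F (X n (Suc j)))) \<le> 1 / real (Suc n)"
    unfolding choice_iff by blast
  define Y where "Y = (\<lambda>n. polygon (3 * Suc n) (Suc n) (X n))"
  have incr: "norm (Y n t - Y n s - (t - s) *\<^sub>R v) \<le> B * (t - s)"
    if "0 \<le> s" "s \<le> t" "t \<le> 3" and "\<And>j. j < 3 * Suc n \<Longrightarrow> real (Suc n) * s < real j + 1 \<Longrightarrow> real j < real (Suc n) * t \<Longrightarrow>
              norm (real (Suc n) *\<^sub>R (X n (Suc j) - X n j) - v) \<le> B" for n s t v B
  proof -
    have "real (Suc n) * t \<le> real (Suc n) * 3" using that by (intro mult_left_mono) auto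
    also have "\<dots> = real (3 * Suc n)" by simp
    finally show ?thesis unfolding Y_def using that by (intro polygon_increment) auto
  qed
  have lip1: "norm (Y n t - Y n s) \<le> L * (t - s)" if "0 \<le> s" "s \<le> t" "t \<le> 3" for n s t
    using incr[OF that, of n 0 L] XL by simp
  have lip: "norm (Y n t - Y n s) \<le> L * \<bar>t - s\<bar>" if "s \<in> {0..3}" "t \<in> {0..3}" for n s t
    using lip1[of s t n] lip1[of t s n] that by (cases "s \<le> t") (auto simp: norm_minus_commute)
  have node: "Y n (real k / real (Suc n)) = X n k" if "k \<le> 3 * Suc n" for n k
    unfolding Y_def by (rule polygon_node[OF _ that]) simp
  obtain l0 r where l0: "l0 \<in> {a..b}" and r: "strict_mono r" and lr: "(l \<circ> r) \<longlonglongrightarrow> l0"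
    using compact_Icc[of a b, unfolded compact_def] l by (metis atLeastAtMost_iff)
  obtain g k where gc: "continuous_on {0..3} g" and k: "strict_mono (k :: nat \<Rightarrow> nat)"
    and conv: "\<And>e. 0 < e \<Longrightarrow> \<exists>M. \<forall>n x. n \<ge> M \<and> x \<in> {0..3} \<longrightarrow> norm ((Y \<circ> r) (k n) x - g x) < e"
  proof (rule Arzela_Ascoli[of "{0..3::real}" "Y \<circ> r" "1 + 3 * L"])
    fix n x assume x: "x \<in> {0..3::real}"
    have "norm (Y (r n) x - Y (r n) 0) \<le> L * \<bar>x - 0\<bar>" using x by (intro lip) auto
    also have "\<dots> \<le> L * 3" using x L by (intro mult_left_mono) auto
    finally have "norm (Y (r n) x) \<le> L * 3 + norm (Y (r n) 0)"
      using norm_triangle_sub[of "Y (r n) x" "Y (r n) 0"] by simp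
    moreover have "Y (r n) 0 = X (r n) 0" using node[of 0 "r n"] by simp
    ultimately show "norm ((Y \<circ> r) n x) \<le> 1 + 3 * L" using X1[of "r n" 0] by simp
  next
    fix x e assume x: "x \<in> {0..3::real}" and e: "(0::real) < e"
    have "norm (Y n x - Y n y) < e" if "y \<in> {0..3}" "norm (x - y) < e / L" for n y
    proof -
      have "norm (Y n x - Y n y) \<le> L * \<bar>x - y\<bar>" using x that by (intro lip) auto
      also have "\<dots> < e" using that L by (simp add: pos_less_divide_eq mult.commute)
      finally show ?thesis .
    qed
    then show "\<exists>d. 0 < d \<and> (\<forall>n y. y \<in> {0..3} \<and> norm (x - y) < d \<longrightarrow> norm ((Y \<circ> r) n x - (Y \<circ> r) n y) < e)"
      using e L by (intro exI[of _ "e / L"]) auto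
  qed auto
  define m where "m = r \<circ> k"
  have m: "strict_mono m" unfolding m_def using r k by (simp add: strict_mono_o)
  have mlim: "(\<lambda>n. l (m n)) \<longlonglongrightarrow> l0"
    using LIMSEQ_subseq_LIMSEQ[OF lr k] by (simp add: m_def o_def)
  have conv': "\<forall>\<^sub>F n in sequentially. \<forall>x\<in>{0..3}. norm (Y (m n) x - g x) < e" if "e > 0" for e
    using conv[OF that] unfolding eventually_sequentially m_def o_def by blast
  have Ylim: "(\<lambda>n. Y (m n) x) \<longlonglongrightarrow> g x" if "x \<in> {0..3}" for x
  proof (rule tendstoI)
    fix e :: real assume "e > 0"
    from conv'[OF this] show "\<forall>\<^sub>F n in sequentially. dist (Y (m n) x) (g x) < e"
      by eventually_elim (use that in \<open>auto simp: dist_norm\<close>)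
  qed
  have inv: "(\<lambda>n. 1 / real (Suc (m n))) \<longlonglongrightarrow> 0"
    using LIMSEQ_subseq_LIMSEQ[OF lim_1_over_n[THEN LIMSEQ_Suc] m] by (simp add: o_def)
  have inv': "\<forall>\<^sub>F n in sequentially. 1 / real (Suc (m n)) < e" if "e > 0" for e
    using order_tendstoD(2)[OF inv that] .
  have l0pos: "l0 > 0" using l0 a by auto
  show ?thesis
  proof (rule that[OF l0pos gc])
    fix t :: real assume t: "t \<in> {0..2}"
    \<comment> \<open>Antiperiodicity is exact at the nodes. Rounding \<open>t\<close> down to a
      node costs at most \<open>L / N\<close> at each of \<open>t\<close> and
      \<open>t + 1\<close>.\<close>
    have "norm (Y n (t + 1) + Y n t) \<le> 2 * L * (1 / real (Suc n))" for n
    proof -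
      define N where "N = real (Suc n)"
      have N: "N > 0" by (simp add: N_def)
      define j where "j = nat \<lfloor>N * t\<rfloor>"
      have j: "real j \<le> N * t" "N * t < real j + 1" using t N by (auto simp: j_def)
      have "N * t \<le> N * 2" using t N by (intro mult_left_mono) auto
      then have "real j \<le> N * 2" using j by simp
      then have "real j \<le> real (2 * Suc n)" by (simp add: N_def)
      then have j2: "j \<le> 2 * Suc n" by (simp only: of_nat_le_iff)
      define s where "s = real j / N"
      have "t < (real j + 1) / N" using j N by (simp add: pos_less_divide_eq mult.commute)
      then have s: "s \<le> t" "t - s \<le> 1 / N" "0 \<le> s"
        using j N by (auto simp: s_def pos_divide_le_eq add_divide_distrib mult.commute)
      have "Y n s = X n j" unfolding s_def N_def using j2 by (intro node) simp
      moreover have "Y n (s + 1) = X n (j + Suc n)"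
      proof -
        have "s + 1 = real (j + Suc n) / real (Suc n)" using N by (simp add: s_def N_def field_simps)
        then show ?thesis using j2 node[of "j + Suc n" n] by simp
      qed
      ultimately have e: "Y n (s + 1) = - Y n s" using Xper[of n j] by simp
      have "norm (Y n t - Y n s) \<le> L * (t - s)" using s t by (intro lip1) auto
      moreover have "norm (Y n (t + 1) - Y n (s + 1)) \<le> L * (t - s)" using lip1[of "s + 1" "t + 1" n] s t by auto
      moreover have "norm (Y n (t + 1) + Y n t) \<le> norm (Y n (t + 1) - Y n (s + 1)) + norm (Y n t - Y n s)"
      proof -
        have eq: "Y n (t + 1) + Y n t = (Y n (t + 1) - Y n (s + 1)) + (Y n t - Y n s)" using e by simp
        show ?thesis unfolding eq by (rule norm_triangle_ineq)
      qed
      ultimately have "norm (Y n (t + 1) + Y n t) \<le> 2 * (L * (t - s))" by linarith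
      also have "\<dots> \<le> 2 * (L * (1 / N))" using s L by (intro mult_left_mono) auto
      finally show ?thesis by (simp add: N_def)
    qed
    then have "(\<lambda>n. Y (m n) (t + 1) + Y (m n) t) \<longlonglongrightarrow> 0"
      by (intro Lim_null_comparison[OF always_eventually tendsto_mult_right_zero[OF inv]]) blast
    moreover have "(\<lambda>n. Y (m n) (t + 1) + Y (m n) t) \<longlonglongrightarrow> g (t + 1) + g t"
      using t by (intro tendsto_add Ylim) auto
    ultimately have "g (t + 1) + g t = 0" using LIMSEQ_unique by blast
    then show "g (t + 1) = - g t" by (simp add: eq_neg_iff_add_eq_0)
  next
    \<comment> \<open>At a node of norm 1 the limit differs from the interpolation by less than 1,
      so that it does not vanish there.\<close>
    obtain n where n: "\<forall>x\<in>{0..3}. norm (Y (m n) x - g x) < 1"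
      using conv'[of 1] by (auto simp: eventually_sequentially)
    obtain j where j: "j < Suc (m n)" "norm (X (m n) j) = 1" using Xmax by blast
    define t where "t = real j / real (Suc (m n))"
    have t: "t \<in> {0..1}" using j by (auto simp: t_def)
    have "Y (m n) t = X (m n) j" unfolding t_def using j by (intro node) simp
    then have "g t \<noteq> 0" using n j t by (metis atLeastAtMost_iff diff_zero less_irrefl numeral_le_one_iff order_trans semiring_norm(70) one_le_numeral)
    then show "\<exists>t\<in>{0..1}. g t \<noteq> 0" using t by blast
  next
    fix t :: real assume t: "0 < t" "t < 3"
    define v where "v = l0 *\<^sub>R (snd (F (g t)), - fst (F (g t)))"
    \<comment> \<open>No integral equation is used: near \<open>t\<close> all increments of the
      interpolations agree with those of constant velocity \<open>v\<close> up to
      \<open>\<epsilon>\<close> per unit of time, and this passes to the limit.\<close>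
    have main: "\<exists>d>0. \<forall>s. norm (s - t) < d \<longrightarrow> norm (g s - g t - (s - t) *\<^sub>R v) \<le> \<epsilon> * norm (s - t)"
      if \<epsilon>: "\<epsilon> > 0" for \<epsilon>
    proof -
      \<comment> \<open>One half of \<open>\<epsilon>\<close> for each of the two components. Each
        half is again shared between the continuity of \<open>F\<close> and the discretisation
        error.\<close>
      define E where "E = \<epsilon> / 2"
      have E: "E > 0" using \<epsilon> by (simp add: E_def)
      define \<Psi> where "\<Psi> = (\<lambda>(l::real, y). norm (l *\<^sub>R F y - l0 *\<^sub>R F (g t)))"
      have cF: "continuous (at z) F" for z using F_cont continuous_on_eq_continuous_at[OF open_UNIV, of F] by blast
      have "isCont \<Psi> (l0, g t)"
        unfolding \<Psi>_def case_prod_beta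
        by (intro continuous_norm continuous_diff continuous_scaleR continuous_fst continuous_snd
            continuous_const continuous_ident isCont_o2[OF _ cF])
      moreover have "\<Psi> (l0, g t) = 0" by (simp add: \<Psi>_def)
      ultimately obtain \<rho>' where \<rho>': "\<rho>' > 0" "\<And>y. dist y (l0, g t) < \<rho>' \<Longrightarrow> \<bar>\<Psi> y\<bar> < E / 2"
        using E unfolding continuous_at_eps_delta by (metis dist_real_def diff_zero half_gt_zero)
      define \<rho> where "\<rho> = \<rho>' / 2"
      have \<rho>: "\<rho> > 0" using \<rho>' by (simp add: \<rho>_def)
      have F\<rho>: "norm (l' *\<^sub>R F y - l0 *\<^sub>R F (g t)) < E / 2" if "\<bar>l' - l0\<bar> < \<rho>" "norm (y - g t) < \<rho>" for l' y
      proof -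
        have "dist (l', y) (l0, g t) \<le> dist l' l0 + dist y (g t)"
          by (metis dist_Pair_Pair dist_norm add.commute zero_le_dist sqrt_sum_squares_le_sum)
        also have "\<dots> < \<rho>'" using that by (simp add: dist_norm \<rho>_def)
        finally have "\<bar>\<Psi> (l', y)\<bar> < E / 2" by (rule \<rho>'(2))
        then show ?thesis by (simp add: \<Psi>_def)
      qed
      obtain d0 where d0: "d0 > 0" "\<And>s. s \<in> {0..3} \<Longrightarrow> dist s t < d0 \<Longrightarrow> dist (g s) (g t) < \<rho> / 2"
        using gc t \<rho> unfolding continuous_on_iff by (metis atLeastAtMost_iff half_gt_zero less_imp_le)
      \<comment> \<open>\<open>d0 / 2\<close>, because the end nodes of a step that meets the
        interval may lie outside it by up to \<open>1 / N < d\<close>.\<close>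
      define d where "d = min (d0 / 2) (min t (3 - t))"
      have d: "d > 0" "d \<le> d0 / 2" "d \<le> t" "d \<le> 3 - t"
        using d0(1) t unfolding d_def by linarith+
      have ev: "\<forall>\<^sub>F n in sequentially. \<forall>s s'. 0 \<le> s \<and> s \<le> s' \<and> s' \<le> 3 \<and> \<bar>s - t\<bar> < d \<and> \<bar>s' - t\<bar> < d \<longrightarrow>
          norm (Y (m n) s' - Y (m n) s - (s' - s) *\<^sub>R v) \<le> \<epsilon> * (s' - s)"
        using conv'[OF half_gt_zero[OF \<rho>]] inv'[OF half_gt_zero[OF E]] inv'[OF d(1)] tendstoD[OF mlim \<rho>]
      proof eventually_elim
        fix n
        assume n1: "\<forall>x\<in>{0..3}. norm (Y (m n) x - g x) < \<rho> / 2"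
          and n2: "1 / real (Suc (m n)) < E / 2" and n3: "1 / real (Suc (m n)) < d"
          and n4: "dist (l (m n)) l0 < \<rho>"
        define N where "N = real (Suc (m n))"
        have N: "N > 0" by (simp add: N_def)
        show "\<forall>s s'. 0 \<le> s \<and> s \<le> s' \<and> s' \<le> 3 \<and> \<bar>s - t\<bar> < d \<and> \<bar>s' - t\<bar> < d \<longrightarrow>
          norm (Y (m n) s' - Y (m n) s - (s' - s) *\<^sub>R v) \<le> \<epsilon> * (s' - s)"
        proof (intro allI impI incr)
          fix s s' j
          assume s: "0 \<le> s \<and> s \<le> s' \<and> s' \<le> 3 \<and> \<bar>s - t\<bar> < d \<and> \<bar>s' - t\<bar> < d"
            and j: "j < 3 * Suc (m n)" "real (Suc (m n)) * s < real j + 1" "real j < real (Suc (m n)) * s'"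
          have near: "norm (X (m n) i - g t) < \<rho>" if i: "i = j \<or> i = Suc j" for i
          proof -
            define u where "u = real i / N"
            have "i \<le> 3 * Suc (m n)" using i j by auto
            then have Yu: "Y (m n) u = X (m n) i" unfolding u_def N_def by (rule node)
            have "real i \<le> real (3 * Suc (m n))" using \<open>i \<le> 3 * Suc (m n)\<close> by (simp only: of_nat_le_iff)
            then have "real i \<le> 3 * N" by (simp add: N_def)
            then have u3: "u \<in> {0..3}" using N by (auto simp: u_def field_simps)
            have "N * s < real i + 1" "real i < N * s' + 1" using j i by (auto simp: N_def)
            then have "s < u + 1 / N" "u < s' + 1 / N" using N by (auto simp: u_def field_simps)
            then have "dist u t < d0" using s n3 d by (auto simp: dist_real_def N_def)
            then have "dist (g u) (g t) < \<rho> / 2" by (rule d0(2)[OF u3])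
            moreover have "norm (Y (m n) u - g u) < \<rho> / 2" using n1 u3 by blast
            ultimately show ?thesis
              using norm_triangle_ineq[of "Y (m n) u - g u" "g u - g t"] by (simp add: Yu dist_norm)
          qed
          have Fn: "norm (l (m n) *\<^sub>R F (X (m n) i) - l0 *\<^sub>R F (g t)) < E / 2" if "i = j \<or> i = Suc j" for i
            using n4 near[OF that] by (intro F\<rho>) (auto simp: dist_real_def)
          define D where "D = N *\<^sub>R (X (m n) (Suc j) - X (m n) j) - v"
          have "fst D = (N *\<^sub>R (fst (X (m n) (Suc j)) - fst (X (m n) j)) - l (m n) *\<^sub>R snd (F (X (m n) j)))
              + snd (l (m n) *\<^sub>R F (X (m n) j) - l0 *\<^sub>R F (g t))"
            by (simp add: D_def v_def)
          also have "norm \<dots> \<le> E"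
            using norm_triangle_le[OF add_mono[OF Xq[of "m n" j, folded N_def] order_trans[OF norm_snd_bound less_imp_le[OF Fn[of j]]]]] n2
            unfolding N_def by simp
          finally have f1: "norm (fst D) \<le> E" .
          have "snd D = (N *\<^sub>R (snd (X (m n) (Suc j)) - snd (X (m n) j)) + l (m n) *\<^sub>R fst (F (X (m n) (Suc j))))
              - fst (l (m n) *\<^sub>R F (X (m n) (Suc j)) - l0 *\<^sub>R F (g t))"
            by (simp add: D_def v_def)
          also have "norm \<dots> \<le> E"
            using order_trans[OF norm_triangle_ineq4 add_mono[OF Xp[of "m n" j, folded N_def] order_trans[OF norm_fst_bound less_imp_le[OF Fn[of "Suc j"]]]]] n2
            unfolding N_def by simp
          finally have f2: "norm (snd D) \<le> E" .
          have "norm D \<le> norm (fst D) + norm (snd D)" by (metis norm_Pair_le prod.collapse)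
          also have "\<dots> \<le> \<epsilon>" using f1 f2 by (simp add: E_def)
          finally show "norm (real (Suc (m n)) *\<^sub>R (X (m n) (Suc j) - X (m n) j) - v) \<le> \<epsilon>"
            by (simp add: D_def N_def)
        qed auto
      qed
      have est: "norm (g s' - g s - (s' - s) *\<^sub>R v) \<le> \<epsilon> * (s' - s)"
        if s: "0 \<le> s" "s \<le> s'" "s' \<le> 3" "\<bar>s - t\<bar> < d" "\<bar>s' - t\<bar> < d" for s s'
      proof (rule tendsto_upperbound)
        show "(\<lambda>n. norm (Y (m n) s' - Y (m n) s - (s' - s) *\<^sub>R v)) \<longlonglongrightarrow> norm (g s' - g s - (s' - s) *\<^sub>R v)"
          using s by (intro tendsto_intros Ylim) auto
        show "\<forall>\<^sub>F n in sequentially. norm (Y (m n) s' - Y (m n) s - (s' - s) *\<^sub>R v) \<le> \<epsilon> * (s' - s)"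
          using ev by eventually_elim (use s in auto)
      qed simp
      have "norm (g s - g t - (s - t) *\<^sub>R v) \<le> \<epsilon> * norm (s - t)" if "norm (s - t) < d" for s
      proof (cases "t \<le> s")
        case True
        then show ?thesis using est[of t s] that d t by (auto simp: abs_less_iff)
      next
        case False
        then have "norm (g t - g s - (t - s) *\<^sub>R v) \<le> \<epsilon> * (t - s)" using est[of s t] that d t by (auto simp: abs_less_iff)
        moreover have "g s - g t - (s - t) *\<^sub>R v = - (g t - g s - (t - s) *\<^sub>R v)"
          by (simp add: scaleR_diff_left)
        ultimately show ?thesis using False by (metis abs_minus_commute abs_of_pos diff_gt_0_iff_gt linorder_not_le norm_minus_cancel real_norm_def)
      qed
      then show ?thesis using d(1) by blast
    qed
    show "(g has_vector_derivative l0 *\<^sub>R (snd (F (g t)), - fst (F (g t)))) (at t)"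
      unfolding has_vector_derivative_def has_derivative_at_alt v_def[symmetric]
      using main by (auto intro: bounded_linear_scaleR_left)
  qed
qed

end

section \<open>The Minkowski functional of a star-shaped domain\<close>

locale star_domain =
  fixes U S :: "'a::euclidean_space set"
  assumes U_open: "open U" and U_bounded: "bounded U" and U_0: "0 \<in> U"
    and U_star: "\<And>x. x \<in> U \<Longrightarrow> closed_segment 0 x \<subseteq> U"
    and S_def: "S = frontier U" and smooth: "smooth_boundary U"
    and outward: "outward_pointing U liouville_field"
begin

lemma S_compact: "compact S"
  unfolding S_def using U_bounded compact_frontier_bounded by blast

lemma S_disjoint: "x \<in> S \<Longrightarrow> x \<notin> U"
  using U_open by (auto simp: S_def frontier_def interior_open)

lemma S_nonzero: "x \<in> S \<Longrightarrow> x \<noteq> 0"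
  using S_disjoint U_0 by blast

lemma boundary_equation_exists:
  assumes "x \<in> S" obtains W \<rho> where "x \<in> W" "boundary_equation U W \<rho>"
  using smooth assms unfolding smooth_boundary_def S_def by blast

lemma local_equation_differentiable:
  assumes "local_equation S W \<rho>" "x \<in> W"
  shows "(\<rho> has_derivative frechet_derivative \<rho> (at x)) (at x)"
proof -
  have "Ck_on (Suc 0) \<rho> W" using assms unfolding local_equation_def smooth_on_def by blast
  then have "\<rho> differentiable (at x)" using assms by auto
  then show ?thesis by (simp add: frechet_derivative_works)
qed

lemma local_equation_C1:
  assumes "local_equation S W \<rho>"
  shows "continuous_on W (\<lambda>x. frechet_derivative \<rho> (at x) v)"
proof -
  have "Ck_on (Suc 0) \<rho> W" using assms unfolding local_equation_def smooth_on_def by blast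
  then show ?thesis by auto
qed

lemma boundary_equationD:
  assumes "boundary_equation U W \<rho>" "x \<in> W" "x \<in> S"
  shows "local_equation S W \<rho>" "frechet_derivative \<rho> (at x) x > 0" "\<rho> x = 0"
    "\<And>y. y \<in> W \<Longrightarrow> \<rho> y < 0 \<Longrightarrow> y \<in> U"
proof -
  show le: "local_equation S W \<rho>" using assms unfolding boundary_equation_def S_def by blast
  have "linear (frechet_derivative \<rho> (at x))"
    using local_equation_differentiable[OF le assms(2)] has_derivative_linear by blast
  moreover have "frechet_derivative \<rho> (at x) (liouville_field x) > 0"
    using outward assms unfolding outward_pointing_def S_def by blast
  ultimately show "frechet_derivative \<rho> (at x) x > 0"
    by (simp add: liouville_field_def linear_cmul)
  show "\<rho> x = 0" using le assms unfolding local_equation_def by blast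
  show "\<And>y. y \<in> W \<Longrightarrow> \<rho> y < 0 \<Longrightarrow> y \<in> U" using assms unfolding boundary_equation_def by blast
qed

text \<open>Star-shapedness alone would allow a ray to run inside the frontier. Transversality makes
  a local equation increase along the ray at \<open>x\<close>, so that points just before
  \<open>x\<close> lie in \<open>U\<close>; star-shapedness then gives all points before
  those.\<close>

lemma scaled_in_U:
  assumes x: "x \<in> S" and s: "0 \<le> s" "s < 1" shows "s *\<^sub>R x \<in> U"
proof -
  obtain W \<rho> where W: "x \<in> W" "boundary_equation U W \<rho>" using boundary_equation_exists[OF x] .
  note D = boundary_equationD[OF W(2,1) x]
  have oW: "open W" using D(1) unfolding local_equation_def by blast
  define f where "f = (\<lambda>t::real. \<rho> (t *\<^sub>R x))"
  have "((\<lambda>t::real. \<rho> (t *\<^sub>R x)) has_derivative (\<lambda>t. frechet_derivative \<rho> (at x) (t *\<^sub>R x))) (at 1)"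
  proof (rule has_derivative_compose[where f = "\<lambda>t. t *\<^sub>R x" and g = \<rho>])
    show "((\<lambda>t. t *\<^sub>R x) has_derivative (\<lambda>t. t *\<^sub>R x)) (at (1::real))"
      by (auto intro!: derivative_eq_intros)
    show "(\<rho> has_derivative frechet_derivative \<rho> (at x)) (at (1 *\<^sub>R x))"
      using local_equation_differentiable[OF D(1) W(1)] by simp
  qed
  moreover have "frechet_derivative \<rho> (at x) (t *\<^sub>R x) = frechet_derivative \<rho> (at x) x * t" for t
    using local_equation_differentiable[OF D(1) W(1), THEN has_derivative_linear] by (simp add: linear_cmul)
  ultimately have "DERIV f 1 :> frechet_derivative \<rho> (at x) x"
    unfolding f_def has_field_derivative_def by (simp add: mult_commute_abs)
  then obtain d1 where d1: "d1 > 0" "\<And>h. 0 < h \<Longrightarrow> h < d1 \<Longrightarrow> f (1 - h) < f 1"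
    using DERIV_pos_inc_left D(2) by blast
  have "open ((\<lambda>t::real. t *\<^sub>R x) -` W)"
    by (intro open_vimage oW continuous_intros)
  then obtain d2 where d2: "d2 > 0" "ball 1 d2 \<subseteq> (\<lambda>t::real. t *\<^sub>R x) -` W"
    using W(1) openE[of "(\<lambda>t::real. t *\<^sub>R x) -` W" 1] by auto
  \<comment> \<open>The bound \<open>1 - s\<close> places \<open>s *\<^sub>R x\<close> on the
    segment from 0 to \<open>(1 - h) *\<^sub>R x\<close>; for \<open>h = 1\<close> this segment is a
    point.\<close>
  define h where "h = min (min d1 d2 / 2) (1 - s)"
  have h: "0 < h" "h < d1" "h < d2" "h \<le> 1 - s" using d1(1) d2(1) s unfolding h_def by linarith+
  have "(1 - h) *\<^sub>R x \<in> W" using d2(2) h by (auto simp: dist_real_def subset_iff)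
  moreover have "\<rho> ((1 - h) *\<^sub>R x) < 0" using d1(2)[OF h(1,2)] D(3) by (simp add: f_def)
  ultimately have U: "(1 - h) *\<^sub>R x \<in> U" using D(4) by blast
  show ?thesis
  proof (cases "h = 1")
    case True
    then have "s = 0" using h s by linarith
    then show ?thesis using U_0 by simp
  next
    case False
    then have h1: "1 - h > 0" using h s by linarith
    have "s *\<^sub>R x = (s / (1 - h)) *\<^sub>R ((1 - h) *\<^sub>R x)" using h1 by simp
    moreover have "0 \<le> s / (1 - h)" "s / (1 - h) \<le> 1" using h h1 s by auto
    ultimately have "s *\<^sub>R x \<in> closed_segment 0 ((1 - h) *\<^sub>R x)"
      unfolding closed_segment_def by (auto simp del: scaleR_scaleR)
    then show ?thesis using U_star[OF U] by blast
  qed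
qed

lemma ray_unique:
  assumes "x \<in> S" "t *\<^sub>R x \<in> S" "t > 0" shows "t = 1"
proof (rule ccontr)
  assume "t \<noteq> 1"
  then consider "t < 1" | "t > 1" by linarith
  then show False
  proof cases
    case 1
    then show ?thesis using scaled_in_U[OF assms(1), of t] S_disjoint assms by auto
  next
    case 2
    have "(1 / t) *\<^sub>R (t *\<^sub>R x) \<in> U" using 2 by (intro scaled_in_U assms) auto
    then show ?thesis using S_disjoint assms 2 by auto
  qed
qed

lemma ray_exists:
  assumes "x \<noteq> 0" obtains t where "t > 0" "t *\<^sub>R x \<in> S"
  using ray_to_frontier[OF U_bounded _ assms, of 0] U_0 U_open S_def by (auto simp: interior_open)

section \<open>The functional and its first derivative\<close>

definition minkowski :: "'a \<Rightarrow> real" where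
  "minkowski x = (if x = 0 then 0 else 1 / (THE t. t > 0 \<and> t *\<^sub>R x \<in> S))"

lemma minkowski_eqI:
  assumes "c > 0" "x /\<^sub>R c \<in> S" shows "minkowski x = c"
proof -
  have x: "x \<noteq> 0" using S_nonzero[OF assms(2)] by auto
  have "(THE t. t > 0 \<and> t *\<^sub>R x \<in> S) = inverse c"
  proof (rule the_equality)
    fix t assume t: "t > 0 \<and> t *\<^sub>R x \<in> S"
    have "(t * c) *\<^sub>R (x /\<^sub>R c) \<in> S" using t assms(1) by (simp add: mult.assoc)
    then have "t * c = 1" using ray_unique[OF assms(2)] t assms(1) by simp
    then show "t = inverse c" using assms(1) by (simp add: field_simps)
  qed (use assms in auto)
  then show ?thesis using x by (simp add: minkowski_def divide_inverse)
qed

lemma minkowski_pos: "x \<noteq> 0 \<Longrightarrow> minkowski x > 0" and minkowski_scaled: "x \<noteq> 0 \<Longrightarrow> x /\<^sub>R minkowski x \<in> S"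
proof -
  assume "x \<noteq> 0"
  then obtain t where t: "t > 0" "t *\<^sub>R x \<in> S" using ray_exists by blast
  then have "minkowski x = inverse t" by (intro minkowski_eqI) auto
  then show "minkowski x > 0" "x /\<^sub>R minkowski x \<in> S" using t by auto
qed

lemma minkowski_0: "minkowski 0 = 0" by (simp add: minkowski_def)

lemma minkowski_S: "x \<in> S \<Longrightarrow> minkowski x = 1"
  by (rule minkowski_eqI) auto

lemma minkowski_eq_1: "minkowski x = 1 \<Longrightarrow> x \<in> S"
  using minkowski_scaled[of x] minkowski_0 by (cases "x = 0") auto

lemma minkowski_scale: "t \<ge> 0 \<Longrightarrow> minkowski (t *\<^sub>R x) = t * minkowski x"
proof (cases "t = 0 \<or> x = 0")
  case False
  assume "t \<ge> 0"
  then have t: "t > 0" "x \<noteq> 0" using False by auto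
  have "minkowski (t *\<^sub>R x) = minkowski x * t"
    by (rule minkowski_eqI) (use t minkowski_pos[OF t(2)] minkowski_scaled[OF t(2)] in \<open>auto simp: mult.assoc\<close>)
  then show ?thesis by simp
qed (auto simp: minkowski_0)

text \<open>Radial projection to the unit sphere is injective on the compact \<open>S\<close>, hence
  a homeomorphism onto its image. The inverse yields the distance from 0 to \<open>S\<close> in each
  direction as a continuous function.\<close>

lemma minkowski_cont: "continuous_on (- {0}) minkowski"
proof -
  define \<phi> where "\<phi> = (\<lambda>x::'a. x /\<^sub>R norm x)"
  have c\<phi>: "continuous_on (- {0}) \<phi>" unfolding \<phi>_def by (intro continuous_intros) auto
  have inj: "inj_on \<phi> S"
  proof
    fix x y assume xy: "x \<in> S" "y \<in> S" "\<phi> x = \<phi> y"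
    have nz: "norm x > 0" "norm y > 0" using S_nonzero xy by auto
    then have "(norm y / norm x) *\<^sub>R x = norm y *\<^sub>R \<phi> x" by (simp add: \<phi>_def divide_inverse)
    also have "\<dots> = y" using xy nz by (simp add: \<phi>_def)
    finally have e: "(norm y / norm x) *\<^sub>R x = y" .
    then have r: "norm y / norm x = 1" using xy nz by (intro ray_unique[OF xy(1)]) auto
    show "x = y" using e[unfolded r] by simp
  qed
  have "continuous_on S \<phi>" by (rule continuous_on_subset[OF c\<phi>]) (use S_nonzero in auto)
  then obtain \<psi> where \<psi>: "homeomorphism S (\<phi> ` S) \<phi> \<psi>"
    using homeomorphism_compact[OF S_compact _ refl inj] by blast
  have im: "\<phi> x \<in> \<phi> ` S" if "x \<noteq> 0" for x
  proof -
    have "\<phi> (x /\<^sub>R minkowski x) = \<phi> x" using minkowski_pos[OF that] that by (simp add: \<phi>_def)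
    then show ?thesis using minkowski_scaled[OF that] by (metis imageI)
  qed
  have "minkowski x = norm x / norm (\<psi> (\<phi> x))" if "x \<noteq> 0" for x
  proof -
    have "\<phi> (x /\<^sub>R minkowski x) = \<phi> x" using minkowski_pos[OF that] that by (simp add: \<phi>_def)
    then have "\<psi> (\<phi> x) = x /\<^sub>R minkowski x" using homeomorphism_apply1[OF \<psi> minkowski_scaled[OF that]] by simp
    then show ?thesis using minkowski_pos[OF that] that by (simp add: divide_inverse)
  qed
  moreover have "continuous_on (- {0}) (\<lambda>x. norm x / norm (\<psi> (\<phi> x)))"
  proof (intro continuous_intros continuous_on_compose2[OF homeomorphism_cont2[OF \<psi>] c\<phi>])
    show "\<phi> ` (- {0}) \<subseteq> \<phi> ` S" using im by auto
    show "\<forall>x\<in>- {0}. norm (\<psi> (\<phi> x)) \<noteq> 0"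
      using im homeomorphism_image2[OF \<psi>] S_nonzero by fastforce
  qed
  ultimately show ?thesis by (metis (no_types, lifting) ComplD continuous_on_cong singletonI)
qed

text \<open>Implicit differentiation of \<open>\<rho> (y /\<^sub>R minkowski y) = 0\<close>. The
  radial derivative by which one divides is positive by transversality.\<close>

lemma minkowski_deriv_S:
  assumes x: "x \<in> S" and W: "x \<in> W" "boundary_equation U W \<rho>"
  shows "(minkowski has_derivative (\<lambda>h. frechet_derivative \<rho> (at x) h / frechet_derivative \<rho> (at x) x)) (at x)"
proof -
  note D = boundary_equationD[OF W(2,1) x]
  have oW: "open W" using D(1) unfolding local_equation_def by blast
  define L where "L = frechet_derivative \<rho> (at x)"
  have \<rho>d: "(\<rho> has_derivative L) (at x)" unfolding L_def by (rule local_equation_differentiable[OF D(1) W(1)])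
  then have bl: "bounded_linear L" by (rule has_derivative_bounded_linear)
  interpret L: bounded_linear L by (rule bl)
  define l where "l = L x"
  have l: "l > 0" using D(2) by (simp add: l_def L_def)
  obtain B where B: "B > 0" "\<And>h. norm (L h) \<le> norm h * B" using L.pos_bounded by blast
  have xn: "x \<noteq> 0" by (rule S_nonzero[OF x])
  have gx: "minkowski x = 1" by (rule minkowski_S[OF x])
  have gc: "isCont minkowski y" if "y \<noteq> 0" for y
    using minkowski_cont that continuous_on_eq_continuous_at[of "- {0}" minkowski] by auto
  define K where "K = B / l"
  have K: "K > 0" using B l by (simp add: K_def)
  show ?thesis
    unfolding has_derivative_at_alt L_def[symmetric] l_def[symmetric]
  proof (intro conjI allI impI)
    show "bounded_linear (\<lambda>h. L h / l)" by (intro bounded_linear_divide bl bounded_linear_compose[OF bounded_linear_divide bl])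
    fix \<eta> :: real assume \<eta>: "\<eta> > 0"
    define q where "q = 1 + norm x * K"
    have q: "q > 0" using K by (simp add: q_def add_pos_nonneg)
    \<comment> \<open>The error \<open>e\<close> reappears on the right of its own estimate. The
      first bound makes its coefficient there at most \<open>l / 2\<close>, so that it is absorbed;
      the second one leads to the tolerance \<open>\<eta>\<close>.\<close>
    define \<epsilon> where "\<epsilon> = min (l / (2 * norm x)) (\<eta> * l / (2 * q))"
    have \<epsilon>: "\<epsilon> > 0" using l \<eta> xn q by (simp add: \<epsilon>_def)
    have e1: "\<epsilon> * norm x \<le> l / 2"
    proof -
      have "\<epsilon> \<le> l / (2 * norm x)" unfolding \<epsilon>_def by simp
      then have "\<epsilon> * norm x \<le> l / (2 * norm x) * norm x" by (rule mult_right_mono) simp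
      then show ?thesis using xn by simp
    qed
    have e2: "\<epsilon> * q \<le> \<eta> * l / 2"
    proof -
      have "\<epsilon> \<le> \<eta> * l / (2 * q)" unfolding \<epsilon>_def by simp
      then have "\<epsilon> * q \<le> \<eta> * l / (2 * q) * q" using q by (intro mult_right_mono) auto
      then show ?thesis using q by simp
    qed
    obtain d1 where d1: "d1 > 0" "\<And>y. norm (y - x) < d1 \<Longrightarrow> norm (\<rho> y - \<rho> x - L (y - x)) \<le> \<epsilon> * norm (y - x)"
      using \<rho>d \<epsilon> unfolding has_derivative_at_alt by blast
    define p where "p = (\<lambda>y. y /\<^sub>R minkowski y)"
    have "isCont p x" unfolding p_def using gx by (intro continuous_intros gc xn) auto
    moreover have "p x \<in> W \<inter> ball x d1" using W d1 by (simp add: p_def gx)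
    moreover have "open (W \<inter> ball x d1)" using oW by auto
    ultimately have "\<forall>\<^sub>F y in at x. p y \<in> W \<inter> ball x d1"
      unfolding continuous_at by (metis topological_tendstoD)
    moreover have "\<forall>\<^sub>F y in at x. y \<noteq> 0" by (rule tendsto_imp_eventually_ne[OF tendsto_ident_at xn])
    ultimately have "\<forall>\<^sub>F y in at x. norm (minkowski y - minkowski x - L (y - x) / l) \<le> \<eta> * norm (y - x)"
    proof eventually_elim
      fix y assume py: "p y \<in> W \<inter> ball x d1" and y: "y \<noteq> 0"
      define g where "g = minkowski y"
      have g: "g > 0" unfolding g_def by (rule minkowski_pos[OF y])
      have "p y \<in> S" unfolding p_def by (rule minkowski_scaled[OF y])
      then have "\<rho> (p y) = 0" using py D(1) unfolding local_equation_def by blast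
      moreover have "norm (p y - x) < d1" using py by (simp add: dist_norm norm_minus_commute)
      ultimately have "\<bar>L (p y - x)\<bar> \<le> \<epsilon> * norm (p y - x)" using d1(2)[of "p y"] D(3) by simp
      then have "g * \<bar>L (p y - x)\<bar> \<le> g * (\<epsilon> * norm (p y - x))" using g by (intro mult_left_mono) auto
      then have 1: "\<bar>L (g *\<^sub>R (p y - x))\<bar> \<le> \<epsilon> * norm (g *\<^sub>R (p y - x))"
        using g by (simp add: L.scaleR abs_mult mult_ac)
      have gp: "g *\<^sub>R (p y - x) = (y - x) - (g - 1) *\<^sub>R x"
        using g by (simp add: p_def g_def scaleR_diff_right scaleR_diff_left)
      define e where "e = g - 1 - L (y - x) / l"
      have "L (g *\<^sub>R (p y - x)) = - (e * l)"
        unfolding gp L.diff[of "y - x"] L.scaleR using l by (simp add: e_def l_def[symmetric] field_simps)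
      then have 2: "\<bar>e\<bar> * l \<le> \<epsilon> * norm (g *\<^sub>R (p y - x))" using 1 l by (simp add: abs_mult)
      have "norm (g *\<^sub>R (p y - x)) \<le> norm (y - x) + \<bar>g - 1\<bar> * norm x"
        unfolding gp using norm_triangle_ineq4[of "y - x" "(g - 1) *\<^sub>R x"] by simp
      moreover have "\<bar>g - 1\<bar> \<le> \<bar>e\<bar> + K * norm (y - x)"
      proof -
        have "\<bar>L (y - x) / l\<bar> \<le> K * norm (y - x)"
          using B(2)[of "y - x"] l by (simp add: K_def abs_divide divide_right_mono mult.commute)
        then show ?thesis unfolding e_def by linarith
      qed
      ultimately have "norm (g *\<^sub>R (p y - x)) \<le> norm (y - x) + (\<bar>e\<bar> + K * norm (y - x)) * norm x"
        by (smt (verit) mult_right_mono norm_ge_zero)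
      then have "\<bar>e\<bar> * l \<le> \<epsilon> * (norm (y - x) + (\<bar>e\<bar> + K * norm (y - x)) * norm x)"
        using 2 \<epsilon> by (smt (verit) mult_left_mono)
      also have "\<dots> = (\<epsilon> * q) * norm (y - x) + \<bar>e\<bar> * (\<epsilon> * norm x)"
        by (simp add: q_def algebra_simps)
      also have "\<dots> \<le> (\<eta> * l / 2) * norm (y - x) + \<bar>e\<bar> * (l / 2)"
        by (intro add_mono mult_right_mono mult_left_mono e1 e2) auto
      finally have "\<bar>e\<bar> * (l / 2) \<le> (\<eta> * norm (y - x)) * (l / 2)" by (simp add: field_simps)
      then have "\<bar>e\<bar> \<le> \<eta> * norm (y - x)" using l by simp
      then show "norm (minkowski y - minkowski x - L (y - x) / l) \<le> \<eta> * norm (y - x)"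
        by (simp add: e_def g_def gx)
    qed
    then obtain d where d: "d > 0" "\<And>y. y \<noteq> x \<Longrightarrow> dist y x < d \<Longrightarrow> norm (minkowski y - minkowski x - L (y - x) / l) \<le> \<eta> * norm (y - x)"
      unfolding eventually_at by auto
    show "\<exists>d>0. \<forall>y. norm (y - x) < d \<longrightarrow> norm (minkowski y - minkowski x - L (y - x) / l) \<le> \<eta> * norm (y - x)"
    proof (intro exI conjI allI impI)
      fix y assume "norm (y - x) < d"
      then show "norm (minkowski y - minkowski x - L (y - x) / l) \<le> \<eta> * norm (y - x)"
        using d(2)[of y] by (cases "y = x") (auto simp: dist_norm L.zero)
    qed (rule d(1))
  qed
qed

definition dminkowski :: "'a \<Rightarrow> 'a \<Rightarrow> real" where "dminkowski x = frechet_derivative minkowski (at x)"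

text \<open>Homogeneity of degree 1 transports the derivative from the point of \<open>S\<close> on
  the same ray.\<close>

lemma minkowski_deriv:
  assumes "x \<noteq> 0" shows "(minkowski has_derivative dminkowski (x /\<^sub>R minkowski x)) (at x)"
proof -
  define c where "c = minkowski x"
  have c: "c > 0" unfolding c_def by (rule minkowski_pos[OF assms])
  define y where "y = x /\<^sub>R c"
  have y: "y \<in> S" unfolding y_def c_def by (rule minkowski_scaled[OF assms])
  obtain W \<rho> where W: "y \<in> W" "boundary_equation U W \<rho>" using boundary_equation_exists[OF y] .
  have dy: "(minkowski has_derivative dminkowski y) (at y)"
    using minkowski_deriv_S[OF y W] frechet_derivative_at unfolding dminkowski_def by metis
  have "((\<lambda>z. c * minkowski (z /\<^sub>R c)) has_derivative (\<lambda>h. c * dminkowski y (h /\<^sub>R c))) (at x)"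
  proof (rule has_derivative_mult_right, rule has_derivative_compose[where g = minkowski and f = "\<lambda>z. z /\<^sub>R c"])
    show "((\<lambda>z. z /\<^sub>R c) has_derivative (\<lambda>h. h /\<^sub>R c)) (at x)" by (auto intro!: derivative_eq_intros)
    show "(minkowski has_derivative dminkowski y) (at (x /\<^sub>R c))" using dy by (simp add: y_def)
  qed
  moreover have "(\<lambda>z. c * minkowski (z /\<^sub>R c)) = minkowski" using c by (simp add: minkowski_scale fun_eq_iff)
  moreover have "(\<lambda>h. c * dminkowski y (h /\<^sub>R c)) = dminkowski y"
    using c has_derivative_linear[OF dy] by (simp add: linear_cmul fun_eq_iff)
  ultimately show ?thesis by (simp add: y_def c_def)
qed

lemma dminkowski_hom: "x \<noteq> 0 \<Longrightarrow> dminkowski (x /\<^sub>R minkowski x) = dminkowski x"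
  using frechet_derivative_at[OF minkowski_deriv] unfolding dminkowski_def by metis

lemma minkowski_deriv': "x \<noteq> 0 \<Longrightarrow> (minkowski has_derivative dminkowski x) (at x)"
  using minkowski_deriv dminkowski_hom by metis

lemma dminkowski_linear: "x \<noteq> 0 \<Longrightarrow> linear (dminkowski x)"
  using minkowski_deriv' has_derivative_linear by blast

lemma dminkowski_cont_S: "continuous_on S (\<lambda>x. dminkowski x v)"
proof (rule continuous_on_eq_continuous_within[THEN iffD2], rule ballI)
  fix x assume x: "x \<in> S"
  obtain W \<rho> where W: "x \<in> W" "boundary_equation U W \<rho>" using boundary_equation_exists[OF x] .
  note D = boundary_equationD[OF W(2,1) x]
  have oW: "open W" using D(1) unfolding local_equation_def by blast
  \<comment> \<open>Smoothness of \<open>\<rho>\<close> gives continuity of its derivative in fixed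
    directions, while the denominator has the moving direction \<open>y\<close>; hence the expansion
    of \<open>y\<close> in \<open>Basis\<close>.\<close>
  have eq: "dminkowski y v = frechet_derivative \<rho> (at y) v / (\<Sum>b\<in>Basis. (y \<bullet> b) * frechet_derivative \<rho> (at y) b)"
    and pos: "(\<Sum>b\<in>Basis. (y \<bullet> b) * frechet_derivative \<rho> (at y) b) > 0" if y: "y \<in> S \<inter> W" for y
  proof -
    have "linear (frechet_derivative \<rho> (at y))"
      using local_equation_differentiable[OF D(1)] y has_derivative_linear by blast
    then have "frechet_derivative \<rho> (at y) (\<Sum>b\<in>Basis. (y \<bullet> b) *\<^sub>R b) = (\<Sum>b\<in>Basis. (y \<bullet> b) * frechet_derivative \<rho> (at y) b)"
      by (simp add: linear_sum linear_cmul)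
    then have e: "frechet_derivative \<rho> (at y) y = (\<Sum>b\<in>Basis. (y \<bullet> b) * frechet_derivative \<rho> (at y) b)"
      by (simp add: euclidean_representation)
    have y': "y \<in> W" "y \<in> S" using y by auto
    have "dminkowski y = (\<lambda>h. frechet_derivative \<rho> (at y) h / frechet_derivative \<rho> (at y) y)"
      unfolding dminkowski_def using frechet_derivative_at[OF minkowski_deriv_S[OF y'(2,1) W(2)]] by simp
    then show "dminkowski y v = frechet_derivative \<rho> (at y) v / (\<Sum>b\<in>Basis. (y \<bullet> b) * frechet_derivative \<rho> (at y) b)"
      using e by simp
    show "(\<Sum>b\<in>Basis. (y \<bullet> b) * frechet_derivative \<rho> (at y) b) > 0"
      using boundary_equationD(2)[OF W(2) y'] e by simp
  qed
  have "continuous_on (S \<inter> W) (\<lambda>y. frechet_derivative \<rho> (at y) v / (\<Sum>b\<in>Basis. (y \<bullet> b) * frechet_derivative \<rho> (at y) b))"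
    using pos by (intro continuous_intros continuous_on_subset[OF local_equation_C1[OF D(1)]]) (auto, fastforce)
  then have "continuous_on (S \<inter> W) (\<lambda>y. dminkowski y v)"
    by (rule continuous_on_eq) (use eq in auto)
  then have "continuous (at x within S \<inter> W) (\<lambda>y. dminkowski y v)"
    using x W by (simp add: continuous_on_eq_continuous_within)
  moreover have "at x within S \<inter> W = at x within S"
    using oW W(1) by (intro at_within_nhd[of x W]) auto
  ultimately show "continuous (at x within S) (\<lambda>y. dminkowski y v)" by (simp only:)
qed

lemma dminkowski_cont: "continuous_on (- {0}) (\<lambda>x. dminkowski x v)"
proof -
  have "continuous_on (- {0}) (\<lambda>x. dminkowski (x /\<^sub>R minkowski x) v)"
    by (rule continuous_on_compose2[OF dminkowski_cont_S])
       (use minkowski_pos minkowski_scaled in \<open>auto intro!: continuous_intros minkowski_cont simp: less_imp_neq[symmetric]\<close>)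
  then show ?thesis by (rule continuous_on_eq) (use dminkowski_hom in auto)
qed

section \<open>The Hamiltonian and its gradient\<close>

definition hamil :: "'a \<Rightarrow> real" where "hamil x = (minkowski x)\<^sup>2"

definition grad :: "'a \<Rightarrow> 'a" where
  "grad x = (if x = 0 then 0 else (2 * minkowski x) *\<^sub>R (\<Sum>b\<in>Basis. dminkowski x b *\<^sub>R b))"

lemma grad_inner: "x \<noteq> 0 \<Longrightarrow> grad x \<bullet> v = 2 * minkowski x * dminkowski x v"
proof -
  assume x: "x \<noteq> 0"
  have "dminkowski x (\<Sum>b\<in>Basis. (v \<bullet> b) *\<^sub>R b) = (\<Sum>b\<in>Basis. (v \<bullet> b) * dminkowski x b)"
    using dminkowski_linear[OF x] by (simp add: linear_sum linear_cmul)
  then have "dminkowski x v = (\<Sum>b\<in>Basis. (v \<bullet> b) * dminkowski x b)" by (simp add: euclidean_representation)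
  then show ?thesis using x by (simp add: grad_def inner_sum_left inner_sum_right inner_commute mult.commute)
qed

lemma minkowski_bound: obtains C where "C > 0" "\<And>x. minkowski x \<le> C * norm x"
proof -
  obtain e where e: "e > 0" "ball 0 e \<subseteq> U" using U_open U_0 openE by blast
  have "minkowski x \<le> (1 / e) * norm x" for x
  proof (cases "x = 0")
    case False
    have "x /\<^sub>R minkowski x \<notin> ball 0 e" using minkowski_scaled[OF False] S_disjoint e by blast
    then show ?thesis using minkowski_pos[OF False] e by (simp add: field_simps)
  qed (simp add: minkowski_0)
  then show ?thesis using that[of "1 / e"] e by simp
qed

lemma grad_bound: obtains C where "\<And>x. norm (grad x) \<le> C * norm x"
proof -
  have "continuous_on S (\<lambda>x. \<Sum>b\<in>Basis. dminkowski x b *\<^sub>R b)"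
    by (intro continuous_intros dminkowski_cont_S)
  then have "bounded ((\<lambda>x. \<Sum>b\<in>Basis. dminkowski x b *\<^sub>R b) ` S)"
    using compact_continuous_image S_compact compact_imp_bounded by blast
  then obtain B where B: "B > 0" "\<And>x. x \<in> S \<Longrightarrow> norm (\<Sum>b\<in>Basis. dminkowski x b *\<^sub>R b) \<le> B"
    unfolding bounded_pos by blast
  obtain C where C: "C > 0" "\<And>x. minkowski x \<le> C * norm x" using minkowski_bound by blast
  have "norm (grad x) \<le> (2 * C * B) * norm x" for x
  proof (cases "x = 0")
    case False
    have "norm (\<Sum>b\<in>Basis. dminkowski x b *\<^sub>R b) \<le> B"
      using B(2)[OF minkowski_scaled[OF False]] by (simp add: dminkowski_hom[OF False])
    moreover have "0 < minkowski x" "minkowski x \<le> C * norm x" using minkowski_pos[OF False] C by auto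
    ultimately have "2 * minkowski x * norm (\<Sum>b\<in>Basis. dminkowski x b *\<^sub>R b) \<le> 2 * (C * norm x) * B"
      by (intro mult_mono) auto
    then show ?thesis using False \<open>0 < minkowski x\<close> by (simp add: grad_def mult_ac)
  qed (simp add: grad_def)
  then show ?thesis using that by blast
qed

text \<open>Off the origin this is the calculus of \<open>minkowski\<close>. At the origin the
  quadratic bound for \<open>hamil\<close> and the linear bound for \<open>grad\<close> take
  over.\<close>

lemma homogeneous_hamiltonian: "homogeneous_hamiltonian hamil grad"
proof
  fix z :: 'a
  show "(hamil has_derivative (\<lambda>h. grad z \<bullet> h)) (at z)"
  proof (cases "z = 0")
    case False
    have "((\<lambda>x. (minkowski x)\<^sup>2) has_derivative (\<lambda>h. 2 * minkowski z * dminkowski z h)) (at z)"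
      using minkowski_deriv'[OF False] by (auto intro!: derivative_eq_intros)
    then show ?thesis unfolding hamil_def[abs_def] by (simp add: grad_inner[OF False])
  next
    case True
    obtain C where C: "C > 0" "\<And>x. minkowski x \<le> C * norm x" using minkowski_bound by blast
    have m0: "minkowski x \<ge> 0" for x using minkowski_pos[of x] minkowski_0 by (cases "x = 0") auto
    have "(hamil has_derivative (\<lambda>h. 0)) (at 0)"
      unfolding has_derivative_at_alt
    proof (intro conjI allI impI)
      fix e :: real assume e: "e > 0"
      have "norm (hamil y - hamil 0 - 0) \<le> e * norm (y - 0)" if "norm (y - 0) < e / C\<^sup>2" for y
      proof -
        have "hamil y \<le> (C * norm y)\<^sup>2" unfolding hamil_def using C m0 by (intro power_mono) auto
        also have "\<dots> = (C\<^sup>2 * norm y) * norm y" by (simp add: power2_eq_square)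
        also have "\<dots> \<le> e * norm y"
          using that C by (intro mult_right_mono) (auto simp: pos_less_divide_eq mult.commute)
        finally show ?thesis by (simp add: hamil_def minkowski_0)
      qed
      then show "\<exists>d>0. \<forall>y. norm (y - 0) < d \<longrightarrow> norm (hamil y - hamil 0 - 0) \<le> e * norm (y - 0)"
        using e C by (intro exI[of _ "e / C\<^sup>2"]) auto
    qed simp
    then show ?thesis using True by (simp add: grad_def)
  qed
  show "continuous_on UNIV grad"
  proof (rule continuous_at_imp_continuous_on, rule ballI)
    fix x :: 'a
    show "isCont grad x"
    proof (cases "x = 0")
      case False
      have "continuous_on (- {0}) (\<lambda>x. (2 * minkowski x) *\<^sub>R (\<Sum>b\<in>Basis. dminkowski x b *\<^sub>R b))"
        by (intro continuous_intros minkowski_cont dminkowski_cont)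
      then have "continuous_on (- {0}) grad"
        by (rule continuous_on_eq) (auto simp: grad_def)
      then show ?thesis using False continuous_on_eq_continuous_at[of "- {0}" grad] by auto
    next
      case True
      obtain C where C: "\<And>x. norm (grad x) \<le> C * norm x" using grad_bound by blast
      have "((\<lambda>x::'a. C * norm x) \<longlongrightarrow> C * norm (0::'a)) (at 0)" by (intro tendsto_intros)
      then have "(grad \<longlongrightarrow> 0) (at 0)"
        by (intro Lim_null_comparison[of grad "\<lambda>x. C * norm x"] always_eventually allI C) simp
      then show ?thesis using True by (simp add: isCont_def grad_def)
    qed
  qed
  show "grad (t *\<^sub>R z) = t *\<^sub>R grad z" if "t \<ge> 0" for t
  proof (cases "t = 0 \<or> z = 0")
    case False
    then have t: "t > 0" "z \<noteq> 0" "t *\<^sub>R z \<noteq> 0" using that by auto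
    have "dminkowski (t *\<^sub>R z) = dminkowski ((t *\<^sub>R z) /\<^sub>R minkowski (t *\<^sub>R z))" by (rule dminkowski_hom[OF t(3), symmetric])
    also have "(t *\<^sub>R z) /\<^sub>R minkowski (t *\<^sub>R z) = z /\<^sub>R minkowski z" using t by (simp add: minkowski_scale)
    also have "dminkowski \<dots> = dminkowski z" by (rule dminkowski_hom[OF t(2)])
    finally show ?thesis using t by (simp add: grad_def minkowski_scale)
  qed (auto simp: grad_def)
  show "hamil 0 = 0" by (simp add: hamil_def minkowski_0)
  show "hamil z > 0" if "z \<noteq> 0" using minkowski_pos[OF that] by (simp add: hamil_def)
qed

lemma grad_self: "x \<in> S \<Longrightarrow> grad x \<bullet> x = 2"
  using homogeneous_hamiltonian.euler[OF homogeneous_hamiltonian, of x] by (simp add: hamil_def minkowski_S)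

end

section \<open>Tangent spaces and linear symmetries\<close>

context star_domain
begin

text \<open>Any local equation may witness a tangent vector, so that all of them must have the same
  kernel. Vectors in the kernel of \<open>dminkowski x\<close> are velocities of curves in
  \<open>S\<close> and are killed by the differential of every local equation. As this differential
  is not 0, it is a nonzero multiple of \<open>dminkowski x\<close>.\<close>

lemma tangent_space_eq:
  assumes x: "x \<in> S" shows "tangent_space S x = {v. grad x \<bullet> v = 0}"
proof -
  have xn: "x \<noteq> 0" by (rule S_nonzero[OF x])
  have mx: "minkowski x = 1" by (rule minkowski_S[OF x])
  have gd: "grad x \<bullet> v = 2 * dminkowski x v" for v by (simp add: grad_inner[OF xn] mx)
  have key: "frechet_derivative \<rho> (at x) v = 0 \<longleftrightarrow> grad x \<bullet> v = 0"
    if W: "x \<in> W" "local_equation S W \<rho>" for W \<rho> v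
  proof -
    define L where "L = frechet_derivative \<rho> (at x)"
    have \<rho>d: "(\<rho> has_derivative L) (at x)" unfolding L_def by (rule local_equation_differentiable[OF W(2,1)])
    then have lin: "linear L" by (rule has_derivative_linear)
    have oW: "open W" using W unfolding local_equation_def by blast
    have L0: "L \<noteq> (\<lambda>v. 0)" using W x unfolding local_equation_def L_def by blast
    have tang: "L w = 0" if w: "dminkowski x w = 0" for w
    proof -
      \<comment> \<open>Pushing the line radially onto \<open>S\<close> does not change its velocity
        \<open>w\<close> at 0, as the derivative of \<open>minkowski\<close> along \<open>w\<close>
        is 0.\<close>
      define c where "c = (\<lambda>t::real. (x + t *\<^sub>R w) /\<^sub>R minkowski (x + t *\<^sub>R w))"
      have c0: "c 0 = x" by (simp add: c_def mx)
      have "((\<lambda>t::real. minkowski (x + t *\<^sub>R w)) has_derivative (\<lambda>t. dminkowski x (t *\<^sub>R w))) (at 0)"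
      proof (rule has_derivative_compose[where g = minkowski and f = "\<lambda>t. x + t *\<^sub>R w"])
        show "((\<lambda>t. x + t *\<^sub>R w) has_derivative (\<lambda>t. t *\<^sub>R w)) (at (0::real))"
          by (auto intro!: derivative_eq_intros)
        show "(minkowski has_derivative dminkowski x) (at (x + 0 *\<^sub>R w))" using minkowski_deriv'[OF xn] by simp
      qed
      moreover have "dminkowski x (t *\<^sub>R w) = 0" for t using w dminkowski_linear[OF xn] by (simp add: linear_cmul)
      ultimately have md: "((\<lambda>t::real. minkowski (x + t *\<^sub>R w)) has_derivative (\<lambda>t. 0)) (at 0)" by simp
      have cd: "(c has_derivative (\<lambda>t. t *\<^sub>R w)) (at 0)"
      proof -
        have "((\<lambda>t::real. inverse (minkowski (x + t *\<^sub>R w))) has_derivative (\<lambda>t. 0)) (at 0)"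
          using Deriv.has_derivative_inverse[OF _ md] by (simp add: mx)
        moreover have "((\<lambda>t::real. x + t *\<^sub>R w) has_derivative (\<lambda>t. t *\<^sub>R w)) (at 0)"
          by (auto intro!: derivative_eq_intros)
        ultimately have "((\<lambda>t::real. inverse (minkowski (x + t *\<^sub>R w)) *\<^sub>R (x + t *\<^sub>R w)) has_derivative
            (\<lambda>t. inverse (minkowski (x + 0 *\<^sub>R w)) *\<^sub>R (t *\<^sub>R w) + 0 *\<^sub>R (x + 0 *\<^sub>R w))) (at 0)"
          by (rule has_derivative_scaleR)
        then show ?thesis unfolding c_def by (simp add: mx)
      qed
      have "((\<lambda>t. \<rho> (c t)) has_derivative (\<lambda>t. L (t *\<^sub>R w))) (at 0)"
        by (rule has_derivative_compose[OF cd]) (simp add: c0 \<rho>d)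
      moreover have "((\<lambda>t. \<rho> (c t)) has_derivative (\<lambda>t. 0)) (at 0)"
      proof (rule has_derivative_transform_eventually[of "\<lambda>t. 0"])
        have "isCont c 0" using cd has_derivative_continuous by blast
        then have 1: "\<forall>\<^sub>F t in at 0. c t \<in> W"
          unfolding continuous_at c0 using oW W(1) by (rule topological_tendstoD)
        have "isCont (\<lambda>t::real. x + t *\<^sub>R w) 0" by (intro continuous_intros)
        then have 2: "\<forall>\<^sub>F t in at (0::real). x + t *\<^sub>R w \<in> - {0}"
          unfolding continuous_at by (rule topological_tendstoD) (use xn in auto)
        show "\<forall>\<^sub>F t in at 0. 0 = \<rho> (c t)"
          using 1 2
        proof eventually_elim
          case (elim t)
          then have "c t \<in> S" unfolding c_def by (intro minkowski_scaled) auto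
          then show ?case using elim W(2) unfolding local_equation_def by fastforce
        qed
        have "c 0 \<in> S \<inter> W" using c0 x W by simp
        then show "0 = \<rho> (c 0)" using W(2) unfolding local_equation_def by fastforce
      qed auto
      ultimately have "(\<lambda>t. L (t *\<^sub>R w)) = (\<lambda>t. 0)" by (rule has_derivative_unique)
      from fun_cong[OF this, of 1] have "L (1 *\<^sub>R w) = 0" .
      then show ?thesis by simp
    qed
    have dx: "dminkowski x x = 1" using grad_self[OF x] gd[of x] by simp
    have Lv: "L u = dminkowski x u * L x" for u
    proof -
      have "dminkowski x (u - dminkowski x u *\<^sub>R x) = 0"
        using dminkowski_linear[OF xn] by (simp add: linear_diff linear_cmul dx)
      then have "L (u - dminkowski x u *\<^sub>R x) = 0" by (rule tang)
      then show ?thesis using lin by (simp add: linear_diff linear_cmul)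
    qed
    have "L x \<noteq> 0"
    proof
      assume "L x = 0"
      then have "L u = 0" for u using Lv[of u] by simp
      then show False using L0 by blast
    qed
    then show ?thesis using Lv[of v] gd[of v] by (simp add: L_def)
  qed
  obtain W \<rho> where W: "x \<in> W" "boundary_equation U W \<rho>" using boundary_equation_exists[OF x] .
  have "local_equation S W \<rho>" using boundary_equationD(1)[OF W(2,1) x] .
  then show ?thesis unfolding tangent_space_def using key W(1) by blast
qed

lemma minkowski_linear_invariant:
  assumes f: "linear f" "f ` S = S" shows "minkowski (f x) = minkowski x"
proof (cases "x = 0")
  case False
  have "f (x /\<^sub>R minkowski x) \<in> S" using minkowski_scaled[OF False] f(2) by blast
  then have "f x /\<^sub>R minkowski x \<in> S" using f(1) by (simp add: linear_cmul)
  then show ?thesis using minkowski_pos[OF False] by (intro minkowski_eqI)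
qed (use f in \<open>simp add: linear_0 minkowski_0\<close>)

text \<open>The derivative of the invariance of \<open>hamil\<close>. For the rotation, which
  preserves the inner product, it becomes equivariance of \<open>grad\<close>; for
  \<open>uminus\<close> it becomes oddness.\<close>

lemma grad_linear_invariant:
  assumes f: "linear f" "f ` S = S" shows "grad (f x) \<bullet> f v = grad x \<bullet> v"
proof -
  note deriv = homogeneous_hamiltonian.H_deriv[OF homogeneous_hamiltonian]
  have bl: "bounded_linear f" using f(1) by (rule linear_conv_bounded_linear[THEN iffD1])
  have "((\<lambda>x. hamil (f x)) has_derivative (\<lambda>h. grad (f x) \<bullet> f h)) (at x)"
    by (rule has_derivative_compose[OF bounded_linear_imp_has_derivative[OF bl] deriv])
  moreover have "(\<lambda>x. hamil (f x)) = hamil" by (simp add: hamil_def minkowski_linear_invariant[OF f] fun_eq_iff)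
  ultimately have "(\<lambda>h. grad (f x) \<bullet> f h) = (\<lambda>h. grad x \<bullet> h)"
    using has_derivative_unique[OF _ deriv] by metis
  then show ?thesis by metis
qed

end

section \<open>Loops in the quotient by a free isometric action\<close>

text \<open>The quotient is embedded into a normed space by means of distance functions, because
  \<^const>\<open>covering_space\<close> is only available for subsets of a type of class \<open>topological_space\<close>.\<close>

definition orbit_dist :: "'a::metric_space set \<Rightarrow> 'a \<Rightarrow>\<^sub>C real" where
  "orbit_dist A = Bcontfun (\<lambda>y. min 1 (infdist y A))"

lemma orbit_dist_apply: "apply_bcontfun (orbit_dist A) y = min 1 (infdist y A)"
proof -
  have "(\<lambda>y. min 1 (infdist y A)) \<in> bcontfun"
    by (rule bcontfun_normI[of _ 1]) (auto intro!: continuous_intros simp: infdist_nonneg)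
  then show ?thesis by (simp add: orbit_dist_def Bcontfun_inverse)
qed

locale free_isometric_action =
  fixes S :: "'a::euclidean_space set" and f :: "'a \<Rightarrow> 'a" and m :: nat
  assumes S_compact: "compact S" and m_pos: "m > 0"
    and iso: "dist (f x) (f y) = dist x y"
    and order: "(f ^^ m) x = x"
    and inv: "f ` S = S"
    and free: "x \<in> S \<Longrightarrow> 0 < i \<Longrightarrow> i < m \<Longrightarrow> (f ^^ i) x \<noteq> x"
begin

lemma iso_pow: "dist ((f ^^ i) x) ((f ^^ i) y) = dist x y"
  by (induction i) (auto simp: iso)

lemma inv_pow: "x \<in> S \<Longrightarrow> (f ^^ i) x \<in> S"
  by (induction i) (use inv in auto)

lemma order_mult: "(f ^^ (m * k)) x = x"
  by (induction k) (auto simp: funpow_add order)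

lemma pow_mod: "(f ^^ i) x = (f ^^ (i mod m)) x"
proof -
  have "(f ^^ i) x = (f ^^ (i mod m + m * (i div m))) x" by simp
  also have "\<dots> = (f ^^ (i mod m)) x" by (simp only: funpow_add o_apply order_mult)
  finally show ?thesis .
qed

lemma pow_inverse: "i \<le> m \<Longrightarrow> (f ^^ (m - i)) ((f ^^ i) x) = x"
  by (metis comp_apply funpow_add le_add_diff_inverse2 order)

lemma orbit_proj_eq: "x \<in> S \<Longrightarrow> orbit_proj S f x = (\<lambda>i. (f ^^ i) x) ` {..<m}"
proof -
  assume x: "x \<in> S"
  have "y \<in> (\<lambda>i. (f ^^ i) x) ` {..<m}" if "y = (f ^^ i) x" for i y
    using that pow_mod[of i x] m_pos by (intro image_eqI[of _ _ "i mod m"]) auto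
  then show ?thesis using x inv_pow by (auto simp: orbit_proj_def action_rel_def)
qed

lemma orbit_proj_pow:
  assumes "x \<in> S" "i \<le> m" shows "orbit_proj S f ((f ^^ i) x) = orbit_proj S f x"
proof -
  let ?y = "(f ^^ i) x"
  have y: "?y \<in> S" by (rule inv_pow[OF assms(1)])
  have "z \<in> orbit_proj S f ?y" if "z \<in> orbit_proj S f x" for z
  proof -
    from that obtain k where k: "z = (f ^^ k) x" by (auto simp: orbit_proj_eq[OF assms(1)])
    have "z = (f ^^ (k + (m - i))) ?y" unfolding k funpow_add o_apply using pow_inverse[of i x] assms by simp
    then show ?thesis using assms y inv_pow k by (auto simp: orbit_proj_def action_rel_def)
  qed
  moreover have "z \<in> orbit_proj S f x" if "z \<in> orbit_proj S f ?y" for z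
  proof -
    from that obtain k where k: "z = (f ^^ k) ?y" by (auto simp: orbit_proj_eq[OF y])
    have "z = (f ^^ (k + i)) x" unfolding k funpow_add o_apply by simp
    then show ?thesis using assms inv_pow by (auto simp: orbit_proj_def action_rel_def)
  qed
  ultimately show ?thesis by blast
qed

definition emb :: "'a \<Rightarrow> 'a \<Rightarrow>\<^sub>C real" where "emb x = orbit_dist (orbit_proj S f x)"

text \<open>The power of \<open>f\<close> that takes \<open>x\<close> to the orbit point nearest to
  \<open>z\<close> takes \<open>y\<close> to within \<open>dist x y\<close> of that point.\<close>

lemma infdist_orbit_le:
  assumes "x \<in> S" "y \<in> S" shows "infdist z (orbit_proj S f y) \<le> infdist z (orbit_proj S f x) + dist x y"
proof -
  let ?O = "orbit_proj S f x"
  have "finite ?O" "?O \<noteq> {}" using m_pos by (auto simp: orbit_proj_eq[OF assms(1)])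
  then obtain w where w: "w \<in> ?O" "infdist z ?O = dist z w"
    using infdist_attains_inf[of ?O z] finite_imp_closed by blast
  then obtain i where i: "w = (f ^^ i) x" "i < m" by (auto simp: orbit_proj_eq[OF assms(1)])
  have "infdist z (orbit_proj S f y) \<le> dist z ((f ^^ i) y)"
    using i by (intro infdist_le) (auto simp: orbit_proj_eq[OF assms(2)])
  also have "\<dots> \<le> dist z w + dist ((f ^^ i) x) ((f ^^ i) y)" unfolding i by (rule dist_triangle)
  finally show ?thesis by (simp add: w iso_pow)
qed

lemma emb_lipschitz: "x \<in> S \<Longrightarrow> y \<in> S \<Longrightarrow> dist (emb x) (emb y) \<le> dist x y"
proof (rule dist_bound)
  fix z assume "x \<in> S" "y \<in> S"
  then show "dist (apply_bcontfun (emb x) z) (apply_bcontfun (emb y) z) \<le> dist x y"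
    using infdist_orbit_le[of x y z] infdist_orbit_le[of y x z]
    unfolding emb_def orbit_dist_apply dist_real_def by (auto simp: dist_commute min_def)
qed

lemma emb_cont: "continuous_on S emb"
  unfolding continuous_on_iff using emb_lipschitz by (meson le_less_trans)

text \<open>A finite orbit is closed, hence the zero set of its distance function.\<close>

lemma emb_eq_iff:
  assumes "x \<in> S" "y \<in> S" shows "emb x = emb y \<longleftrightarrow> (\<exists>i<m. y = (f ^^ i) x)"
proof
  assume e: "emb x = emb y"
  have yO: "y \<in> orbit_proj S f y" using orbit_proj_eq[OF assms(2)] m_pos by force
  then have "apply_bcontfun (emb y) y = 0" by (simp add: emb_def orbit_dist_apply)
  then have "apply_bcontfun (emb x) y = 0" using e by simp
  then have "min 1 (infdist y (orbit_proj S f x)) = 0" by (simp add: emb_def orbit_dist_apply)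
  then have "infdist y (orbit_proj S f x) = 0" by (auto simp: min_def split: if_splits)
  moreover have "closed (orbit_proj S f x)" "orbit_proj S f x \<noteq> {}"
    using m_pos by (auto simp: orbit_proj_eq[OF assms(1)] intro!: finite_imp_closed)
  ultimately have "y \<in> orbit_proj S f x" using in_closed_iff_infdist_zero by blast
  then show "\<exists>i<m. y = (f ^^ i) x" by (auto simp: orbit_proj_eq[OF assms(1)])
next
  assume "\<exists>i<m. y = (f ^^ i) x"
  then have "orbit_proj S f y = orbit_proj S f x" using orbit_proj_pow[OF assms(1)] by auto
  then show "emb x = emb y" by (simp add: emb_def)
qed

lemma emb_pow: "x \<in> S \<Longrightarrow> emb ((f ^^ i) x) = emb x"
proof -
  assume x: "x \<in> S"
  have "\<exists>j<m. (f ^^ i) x = (f ^^ j) x" using pow_mod[of i x] m_pos by (metis mod_less_divisor)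
  then show ?thesis using emb_eq_iff[OF x inv_pow[OF x]] by metis
qed

text \<open>On the compact \<open>S\<close>, \<open>emb\<close> is a quotient map onto its image,
  and saturating \<open>V\<close> gives the union of its preimages under the powers of
  \<open>f\<close>.\<close>

lemma emb_open:
  assumes "openin (top_of_set S) V" shows "openin (top_of_set (emb ` S)) (emb ` V)"
proof -
  have VS: "V \<subseteq> S" using assms by (rule openin_imp_subset)
  have "S \<inter> emb -` (emb ` V) = (\<Union>i<m. S \<inter> (f ^^ i) -` V)"
  proof
    show "S \<inter> emb -` (emb ` V) \<subseteq> (\<Union>i<m. S \<inter> (f ^^ i) -` V)"
    proof
      fix x assume "x \<in> S \<inter> emb -` (emb ` V)"
      then obtain v where v: "x \<in> S" "v \<in> V" "emb x = emb v" by auto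
      then obtain i where "i < m" "v = (f ^^ i) x" using emb_eq_iff[of x v] VS by auto
      then show "x \<in> (\<Union>i<m. S \<inter> (f ^^ i) -` V)" using v by auto
    qed
    show "(\<Union>i<m. S \<inter> (f ^^ i) -` V) \<subseteq> S \<inter> emb -` (emb ` V)"
    proof
      fix x assume "x \<in> (\<Union>i<m. S \<inter> (f ^^ i) -` V)"
      then obtain i where "x \<in> S" "(f ^^ i) x \<in> V" by blast
      then show "x \<in> S \<inter> emb -` (emb ` V)" using emb_pow[of x i] by (metis IntI imageI vimageI)
    qed
  qed
  moreover have "openin (top_of_set S) (S \<inter> (f ^^ i) -` V)" for i
  proof (rule continuous_openin_preimage[OF _ _ assms])
    show "continuous_on S (f ^^ i)" unfolding continuous_on_iff by (auto simp: iso_pow)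
    show "(f ^^ i) \<in> S \<rightarrow> S" using inv_pow by auto
  qed
  ultimately have "openin (top_of_set S) (S \<inter> emb -` (emb ` V))"
    by (simp only:) (intro openin_Union, auto)
  then show ?thesis
    using Abstract_Topology_2.continuous_imp_quotient_map[OF emb_cont refl S_compact, of "emb ` V"] VS by auto
qed

lemma emb_covering: "covering_space S emb (emb ` S)"
proof
  show "continuous_on S emb" by (rule emb_cont)
  fix p assume "p \<in> emb ` S"
  then obtain x where x: "x \<in> S" "p = emb x" by blast
  \<comment> \<open>The displacements of \<open>x\<close> under nontrivial powers; the inserted 1
    keeps the set nonempty if \<open>m = 1\<close>. Balls about the orbit points with half of the
    minimum as radius are disjoint, and they cut the sheets out of \<open>S\<close>.\<close>
  define \<Delta> where "\<Delta> = insert 1 ((\<lambda>i. dist ((f ^^ i) x) x) ` {0<..<m})"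
  define \<delta> where "\<delta> = Min \<Delta>"
  have fin: "finite \<Delta>" "\<Delta> \<noteq> {}" by (auto simp: \<Delta>_def)
  have "\<delta> > 0" unfolding \<delta>_def using free[OF x(1)] by (subst Min_gr_iff[OF fin]) (auto simp: \<Delta>_def)
  have \<delta>: "\<delta> \<le> dist ((f ^^ i) x) x" if "0 < i" "i < m" for i
    unfolding \<delta>_def using that fin by (intro Min_le) (auto simp: \<Delta>_def)
  have \<delta>2: "i = j" if "i < m" "j < m" "y \<in> ball ((f ^^ i) x) (\<delta> / 2)" "y \<in> ball ((f ^^ j) x) (\<delta> / 2)" for i j y
  proof -
    have *: "\<delta> \<le> dist ((f ^^ a) x) ((f ^^ b) x)" if "a < b" "b < m" for a b
    proof -
      have "dist ((f ^^ a) x) ((f ^^ b) x) = dist x ((f ^^ (b - a)) x)"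
        using iso_pow[of a x "(f ^^ (b - a)) x"] that by (metis comp_apply funpow_add le_add_diff_inverse less_imp_le)
      then show ?thesis using \<delta>[of "b - a"] that by (simp add: dist_commute)
    qed
    have "dist ((f ^^ i) x) ((f ^^ j) x) < \<delta>"
      using that(3,4) by (auto intro: dist_triangle_half_l simp: dist_commute)
    then show ?thesis using *[of i j] *[of j i] that(1,2) by (metis dist_commute linorder_neqE_nat not_le)
  qed
  define V where "V = (\<lambda>i. S \<inter> ball ((f ^^ i) x) (\<delta> / 2))"
  have Vopen: "openin (top_of_set S) (V i)" for i unfolding V_def by (simp add: openin_open_Int)
  have VV: "(f ^^ j) y \<in> V (i + j)" if "y \<in> V i" for y i j
  proof -
    have "dist ((f ^^ (i + j)) x) ((f ^^ j) y) = dist ((f ^^ i) x) y"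
      using iso_pow[of j "(f ^^ i) x" y] by (simp add: add.commute[of i] funpow_add)
    then show ?thesis using that inv_pow by (auto simp: V_def)
  qed
  have Vmod: "V i = V (i mod m)" for i using pow_mod[of i x] by (simp add: V_def)
  have img: "emb ` V i = emb ` V 0" if "i < m" for i
  proof
    have *: "emb ` V a \<subseteq> emb ` V (a + j)" for a j
    proof
      fix q assume "q \<in> emb ` V a"
      then obtain y where y: "y \<in> V a" "q = emb y" by blast
      then have "q = emb ((f ^^ j) y)" using emb_pow by (auto simp: V_def)
      then show "q \<in> emb ` V (a + j)" using VV[OF y(1)] by blast
    qed
    show "emb ` V 0 \<subseteq> emb ` V i" using *[of 0 i] by simp
    have "V (i + (m - i)) = V 0" using that Vmod[of m] by simp
    then show "emb ` V i \<subseteq> emb ` V 0" using *[of i "m - i"] by simp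
  qed
  have injV: "inj_on emb (V i)" if "i < m" for i
  proof
    fix y z assume yz: "y \<in> V i" "z \<in> V i" "emb y = emb z"
    then obtain j where j: "j < m" "z = (f ^^ j) y" using emb_eq_iff[of y z] by (auto simp: V_def)
    then have "z \<in> V ((i + j) mod m)" using VV[OF yz(1)] Vmod by metis
    \<comment> \<open>\<open>z\<close> lies in the sheets with these two indices, and distinct
      sheets are disjoint.\<close>
    then have "i = (i + j) mod m" using yz(2) that m_pos by (intro \<delta>2[of i "(i + j) mod m" z]) (auto simp: V_def)
    then have "j = 0" using that j(1) by (cases "i + j < m") (simp_all add: le_mod_geq)
    then show "y = z" using j by simp
  qed
  show "\<exists>T. p \<in> T \<and> openin (top_of_set (emb ` S)) T \<and>
      (\<exists>v. \<Union> v = S \<inter> emb -` T \<and> (\<forall>u\<in>v. openin (top_of_set S) u) \<and> pairwise disjnt v \<and>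
           (\<forall>u\<in>v. \<exists>q. homeomorphism u T emb q))"
  proof (intro exI[of _ "emb ` V 0"] exI[of _ "V ` {..<m}"] conjI ballI)
    show "p \<in> emb ` V 0" using x \<open>\<delta> > 0\<close> by (auto simp: V_def)
    show "openin (top_of_set (emb ` S)) (emb ` V 0)" by (rule emb_open[OF Vopen])
    show "\<Union> (V ` {..<m}) = S \<inter> emb -` (emb ` V 0)"
    proof
      show "\<Union> (V ` {..<m}) \<subseteq> S \<inter> emb -` (emb ` V 0)" using img by (force simp: V_def)
      show "S \<inter> emb -` (emb ` V 0) \<subseteq> \<Union> (V ` {..<m})"
      proof
        fix y assume "y \<in> S \<inter> emb -` (emb ` V 0)"
        then obtain v where v: "y \<in> S" "v \<in> V 0" "emb v = emb y" by auto
        then obtain i where i: "i < m" "y = (f ^^ i) v" using emb_eq_iff[of v y] by (auto simp: V_def)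
        then have "y \<in> V i" using VV[OF v(2), of i] by simp
        then show "y \<in> \<Union> (V ` {..<m})" using i by blast
      qed
    qed
    show "openin (top_of_set S) u" if "u \<in> V ` {..<m}" for u using that Vopen by auto
    show "pairwise disjnt (V ` {..<m})"
    proof (rule pairwiseI)
      fix A B assume "A \<in> V ` {..<m}" "B \<in> V ` {..<m}" "A \<noteq> B"
      then obtain i j where "i < m" "j < m" "A = V i" "B = V j" "i \<noteq> j" by auto
      then show "disjnt A B" using \<delta>2 unfolding disjnt_iff V_def by blast
    qed
    fix u assume "u \<in> V ` {..<m}"
    then obtain i where i: "i < m" "u = V i" by blast
    have sub: "V i \<subseteq> S" by (auto simp: V_def)
    show "\<exists>q. homeomorphism u (emb ` V 0) emb q"
    proof (rule homeomorphism_injective_open_map[of u emb "emb ` V 0"])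
      show "continuous_on u emb" using emb_cont sub i continuous_on_subset by blast
      show "emb ` u = emb ` V 0" unfolding i(2) by (rule img[OF i(1)])
      show "inj_on emb u" unfolding i(2) by (rule injV[OF i(1)])
      fix O' assume O: "openin (top_of_set u) O'"
      then have "openin (top_of_set S) O'" using Vopen i openin_trans by blast
      then have "openin (top_of_set (emb ` S)) (emb ` O')" by (rule emb_open)
      moreover have "emb ` O' \<subseteq> emb ` V 0" using openin_imp_subset[OF O] img i by blast
      moreover have "emb ` V 0 \<subseteq> emb ` S" by (auto simp: V_def)
      ultimately show "openin (top_of_set (emb ` V 0)) (emb ` O')"
        by (metis openin_subset_trans)
    qed blast
  qed
qed (rule refl)

text \<open>The universal property of the quotient topology carries the free homotopy to the image
  of \<open>emb\<close>. There the loop is also contractible with fixed base point, and by monodromy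
  its lift ends where the constant lift does.\<close>

lemma null_homotopic_lift_closed:
  assumes c: "path c" "path_image c \<subseteq> S"
    and null: "null_homotopic_loop (quotient_space S f) (\<lambda>s. orbit_proj S f (c s))"
  shows "c 1 = c 0"
proof -
  let ?Y = "quotient_space S f" and ?p = "\<lambda>s. orbit_proj S f (c s)"
  have q: "quotient_map (top_of_set S) ?Y (orbit_proj S f)"
    unfolding quotient_space_def by (rule quotient_map_quotient_topology)
  have "orbit_dist \<circ> orbit_proj S f = emb" by (simp add: emb_def fun_eq_iff)
  then have "continuous_map (top_of_set S) (top_of_set (emb ` S)) (orbit_dist \<circ> orbit_proj S f)"
    using emb_cont by auto
  then have cm: "continuous_map ?Y (top_of_set (emb ` S)) orbit_dist"
    using continuous_compose_quotient_map_eq[OF q] by blast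
  from null obtain y where h: "homotopic_with (\<lambda>r. r 1 = r 0) (top_of_set {0..1}) ?Y ?p (\<lambda>_. y)"
    unfolding null_homotopic_loop_def by blast
  have "homotopic_with (\<lambda>r. r 1 = r 0) (top_of_set {0..1}) (top_of_set (emb ` S)) (orbit_dist \<circ> ?p) (orbit_dist \<circ> (\<lambda>_. y))"
    by (rule homotopic_with_compose_continuous_map_left[OF h cm]) simp
  then have "homotopic_loops (emb ` S) (emb \<circ> c) (linepath (orbit_dist y) (orbit_dist y))"
    unfolding homotopic_loops_def linepath_refl pathfinish_def pathstart_def
    by (simp add: emb_def o_def)
  then have hp: "homotopic_paths (emb ` S) (emb \<circ> c) (linepath (pathstart (emb \<circ> c)) (pathstart (emb \<circ> c)))"
    by (rule homotopic_loops_imp_homotopic_paths_null)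
  have "pathfinish c = pathfinish (linepath (c 0) (c 0))"
  proof (rule covering_space_monodromy[OF emb_covering _ _ _ _ hp])
    have "c 0 \<in> S" using c(2) pathstart_in_path_image by (metis pathstart_def subsetD)
    then show "path_image (linepath (c 0) (c 0)) \<subseteq> S" by simp
    show "path (emb \<circ> c)" "path_image (emb \<circ> c) \<subseteq> emb ` S"
      "path (linepath (pathstart (emb \<circ> c)) (pathstart (emb \<circ> c)))"
      "path_image (linepath (pathstart (emb \<circ> c)) (pathstart (emb \<circ> c))) \<subseteq> emb ` S"
      using hp homotopic_paths_imp_path homotopic_paths_imp_subset by blast+
    show "path (linepath (c 0) (c 0))" by (rule path_linepath)
  qed (use c in \<open>auto simp: pathstart_def linepath_refl\<close>)
  then show ?thesis by (simp add: pathfinish_def)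
qed

end

section \<open>The noncontractible Reeb orbit\<close>

definition cmul :: "complex \<Rightarrow> complex ^ 'n \<Rightarrow> complex ^ 'n" where "cmul a z = (\<chi> j. a * z $ j)"

lemma linear_cmul_vec: "linear (cmul a)"
  by (rule linearI) (simp_all add: cmul_def vec_eq_iff distrib_left)

lemma inner_mult_complex: "(a * x) \<bullet> (a * y) = (cmod a)\<^sup>2 * (x \<bullet> y)" for a x y :: complex
  unfolding cmod_power2 inner_complex_def by (simp add: power2_eq_square algebra_simps)

lemma inner_cmul: "cmul a z \<bullet> cmul a w = (cmod a)\<^sup>2 * (z \<bullet> w)"
  by (simp add: inner_vec_def cmul_def inner_mult_complex sum_distrib_left)

lemma cmul_cmul: "cmul a (cmul b z) = cmul (a * b) z"
  by (simp add: cmul_def mult.assoc)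

lemma cmul_1: "cmul 1 z = z"
  by (simp add: cmul_def)

lemma inner_cmul_i: "z \<bullet> cmul \<i> z = 0"
  by (simp add: inner_vec_def cmul_def inner_complex_def)

lemma liouville_form_inner: "liouville_form z v = (z \<bullet> cmul \<i> v) / 2"
  by (simp add: liouville_form_def inner_vec_def cmul_def inner_complex_def algebra_simps sum_subtractf)

lemma ext_deriv_liouville: "ext_deriv liouville_form x u v = u \<bullet> cmul \<i> v"
proof -
  have d: "frechet_derivative (\<lambda>y. liouville_form y w) (at x) = (\<lambda>y. (y \<bullet> cmul \<i> w) / 2)" for w
    unfolding liouville_form_inner
    by (rule frechet_derivative_at[symmetric]) (auto intro!: derivative_eq_intros)
  have "v \<bullet> cmul \<i> u = - (u \<bullet> cmul \<i> v)"
    by (simp add: inner_vec_def cmul_def inner_complex_def algebra_simps sum_subtractf)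
  then show ?thesis by (simp add: ext_deriv_def d)
qed

definition rot_coeff :: "nat \<Rightarrow> int \<Rightarrow> complex" where
  "rot_coeff m k = exp (2 * of_real pi * \<i> * of_int k / of_nat m)"

lemma rotation_nth: "rotation m k z $ j = rot_coeff m (k j) * z $ j"
  by (simp add: rotation_def rot_coeff_def)

lemma rotation_linear: "linear (rotation m k)"
  by (rule linearI) (simp_all add: vec_eq_iff rotation_nth distrib_left)

lemma rotation_cmul: "rotation m k (cmul a z) = cmul a (rotation m k z)"
  by (simp add: vec_eq_iff rotation_nth cmul_def mult.left_commute)

lemma cmod_rot_coeff: "cmod (rot_coeff m k) = 1"
proof -
  have "rot_coeff m k = exp (\<i> * of_real (2 * pi * of_int k / of_nat m))"
    by (simp add: rot_coeff_def mult_ac)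
  then show ?thesis by (simp only: norm_exp_i_times)
qed

lemma rotation_inner: "rotation m k z \<bullet> rotation m k w = z \<bullet> w"
  by (simp add: inner_vec_def rotation_nth cmod_rot_coeff inner_mult_complex)

lemma rotation_dist: "dist (rotation m k z) (rotation m k w) = dist z w"
proof -
  have "rotation m k z - rotation m k w = rotation m k (z - w)"
    by (simp add: linear_diff[OF rotation_linear])
  then show ?thesis by (simp add: dist_norm norm_eq_sqrt_inner rotation_inner)
qed

lemma rotation_pow: "(rotation m k ^^ i) z $ j = rot_coeff m (k j) ^ i * z $ j"
  by (induction i) (auto simp: rotation_nth)

lemma rot_coeff_pow: "rot_coeff m k ^ i = exp (2 * of_real pi * \<i> * of_int (k * int i) / of_nat m)"
  unfolding rot_coeff_def exp_of_nat_mult[symmetric] by (simp add: mult_ac)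

lemma rot_coeff_order: "m > 0 \<Longrightarrow> rot_coeff m k ^ m = 1"
proof -
  assume "m > 0"
  then have "rot_coeff m k ^ m = exp (2 * of_real pi * \<i> * of_int k)"
    unfolding rot_coeff_pow by (simp add: mult.assoc)
  also have "\<dots> = 1" by (simp add: exp_eq_1 mult_ac)
  finally show ?thesis .
qed

text \<open>Coprimality makes the coefficient a primitive root of unity: otherwise \<open>m\<close>
  would divide \<open>k * i\<close> and hence \<open>i\<close>.\<close>

lemma rot_coeff_free:
  assumes "coprime k (int m)" "0 < i" "i < m" shows "rot_coeff m k ^ i \<noteq> 1"
proof
  assume "rot_coeff m k ^ i = 1"
  then obtain n :: int where n: "2 * pi * (of_int (k * int i) / real m) = of_int (2 * n) * pi"
    unfolding rot_coeff_pow exp_eq_1 by auto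
  have "(2 * pi) * (of_int (k * int i) / real m) = (2 * pi) * of_int n" using n by (simp add: mult_ac)
  then have "of_int (k * int i) / real m = (of_int n :: real)"
    by (metis mult_cancel_left mult_eq_0_iff pi_neq_zero zero_neq_numeral)
  then have "(of_int (k * int i) :: real) = of_int (n * int m)" using assms by (simp add: field_simps)
  then have "k * int i = n * int m" by (simp only: of_int_eq_iff)
  then have "int m dvd k * int i" by simp
  then have "int m dvd int i" using assms(1) by (simp add: coprime_commute coprime_dvd_mult_right_iff)
  then have "m dvd i" by simp
  then show False using assms nat_dvd_not_less by blast
qed

lemma rot_coeff_half:
  assumes "coprime k (int m)" "even m" "m > 0" shows "rot_coeff m k ^ (m div 2) = -1"
proof -
  have "odd k" using assms by (metis coprime_common_divisor even_of_nat not_is_unit_0 odd_one)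
  have "rot_coeff m k ^ (m div 2) = exp (of_real pi * \<i> * of_int k)"
  proof -
    have "of_nat m = (2::complex) * of_nat (m div 2)" using assms(2) by (metis dvd_mult_div_cancel of_nat_mult of_nat_numeral)
    moreover have "of_nat (m div 2) \<noteq> (0::complex)" using assms by auto
    ultimately show ?thesis unfolding rot_coeff_pow by (simp add: field_simps)
  qed
  also have "\<dots> = -1"
  proof -
    obtain n where "k = 2 * n + 1" using \<open>odd k\<close> by (rule oddE)
    then have "exp (of_real pi * \<i> * of_int k) = exp (2 * of_real pi * \<i> * of_int n) * exp (of_real pi * \<i>)"
      by (simp add: exp_add[symmetric] algebra_simps)
    also have "exp (2 * of_real pi * \<i> * of_int n) = 1" by (simp add: exp_eq_1 mult_ac)
    finally show ?thesis by (simp add: mult.commute[of _ \<i>] exp_pi_i)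
  qed
  finally show ?thesis .
qed

section \<open>The Reeb field on the quotient\<close>

locale symmetric_star_domain = star_domain U S
  for U S :: "(complex ^ 'n) set" +
  fixes m :: nat and k :: "'n \<Rightarrow> int"
  assumes m_even: "even m" and m2: "m \<ge> 2" and coprime: "coprime (k j) (int m)"
    and S_inv: "rotation m k ` S = S"
begin

abbreviation "f \<equiv> rotation m k"

sublocale A: free_isometric_action S f m
proof
  show "compact S" by (rule S_compact)
  show "m > 0" using m2 by simp
  show "dist (f x) (f y) = dist x y" for x y by (rule rotation_dist)
  show "(f ^^ m) x = x" for x using m2 by (simp add: vec_eq_iff rotation_pow rot_coeff_order)
  show "f ` S = S" by (rule S_inv)
  show "(f ^^ i) x \<noteq> x" if i: "x \<in> S" "0 < i" "i < m" for x i
  proof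
    assume e: "(f ^^ i) x = x"
    obtain j where j: "x $ j \<noteq> 0" using S_nonzero[OF i(1)] by (auto simp: vec_eq_iff)
    have "rot_coeff m (k j) ^ i * x $ j = x $ j" using e rotation_pow[of i m k x j] by simp
    then have "rot_coeff m (k j) ^ i = 1" using j by simp
    then show False using rot_coeff_free[OF coprime i(2,3)] by blast
  qed
qed

lemma half_turn: "(f ^^ (m div 2)) x = - x"
  using rot_coeff_half[OF coprime m_even] m2 by (simp add: vec_eq_iff rotation_pow)

lemma orbit_proj_minus: "x \<in> S \<Longrightarrow> orbit_proj S f (- x) = orbit_proj S f x"
  using A.orbit_proj_pow[of x "m div 2"] by (simp add: half_turn)

lemma grad_odd: "grad (- x) = - grad x"
proof -
  have "uminus ` S = S"
  proof -
    have "- x \<in> S" if "x \<in> S" for x using A.inv_pow[OF that, of "m div 2"] by (simp add: half_turn)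
    then show ?thesis by force
  qed
  then have "grad (- x) \<bullet> - v = grad x \<bullet> v" for v
    using grad_linear_invariant[of uminus] by (simp add: linear_uminus)
  then have "grad (- x) \<bullet> v = - grad x \<bullet> v" for v
    by (metis inner_minus_left inner_minus_right minus_minus)
  then show ?thesis using vector_eq_rdot by blast
qed

lemma grad_rotation: "grad (f x) = f (grad x)"
proof -
  \<comment> \<open>\<open>f\<close> is surjective, so that it suffices to test against vectors
    \<open>f v\<close>.\<close>
  have s: "v = f ((f ^^ (m - 1)) v)" for v
    using A.order[of v] m2 by (metis Suc_diff_1 A.m_pos comp_apply funpow.simps(2))
  have "grad (f x) \<bullet> f v = f (grad x) \<bullet> f v" for v
    using grad_linear_invariant[OF rotation_linear S_inv] rotation_inner by metis
  then have "grad (f x) \<bullet> v = f (grad x) \<bullet> v" for v using s by metis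
  then show ?thesis using vector_eq_rdot by blast
qed

text \<open>The normalisation is right by Euler's identity: \<open>liouville_form x (reeb x)\<close>
  is half of \<open>grad x \<bullet> x\<close>, thus 1 on \<open>S\<close>. The kernel condition
  holds because \<open>ext_deriv liouville_form x (reeb x) v\<close> is
  \<open>- (grad x \<bullet> v)\<close>, which vanishes on tangent vectors.\<close>

definition reeb :: "complex ^ 'n \<Rightarrow> complex ^ 'n" where "reeb x = cmul (- \<i>) (grad x)"

lemma reeb_rotation: "reeb (f x) = f (reeb x)"
  by (simp add: reeb_def grad_rotation rotation_cmul)

lemma cmul_i_reeb: "cmul \<i> (reeb x) = grad x"
  by (simp add: reeb_def cmul_cmul cmul_1)

lemma grad_reeb: "grad x \<bullet> reeb x = 0"
proof -
  have "reeb x = - cmul \<i> (grad x)" by (simp add: reeb_def cmul_def vec_eq_iff)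
  then show ?thesis by (simp add: inner_cmul_i)
qed

lemma tangent_bundle_iff: "(x, v) \<in> tangent_bundle S \<longleftrightarrow> x \<in> S \<and> grad x \<bullet> v = 0"
  using tangent_space_eq by (auto simp: tangent_bundle_def)

lemma tangent_map_rotation: "tangent_map f (x, v) = (f x, f v)"
proof -
  have "(f has_derivative f) (at x)"
    using rotation_linear[of m k] linear_conv_bounded_linear bounded_linear_imp_has_derivative by blast
  then have "frechet_derivative f (at x) = f" using frechet_derivative_at by metis
  then show ?thesis by (simp add: tangent_map_def)
qed

lemma tangent_map_pow: "(tangent_map f ^^ i) (x, v) = ((f ^^ i) x, (f ^^ i) v)"
  by (induction i) (auto simp: tangent_map_rotation)

lemma grad_rotation_pow: "grad ((f ^^ i) x) = (f ^^ i) (grad x)"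
  by (induction i) (auto simp: grad_rotation)

lemma inner_rotation_pow: "(f ^^ i) x \<bullet> (f ^^ i) y = x \<bullet> y"
  by (induction i) (auto simp: rotation_inner)

lemma reeb_rotation_pow: "reeb ((f ^^ i) x) = (f ^^ i) (reeb x)"
  by (induction i) (auto simp: reeb_rotation)

text \<open>By equivariance the class is a graph over the orbit: each base point carries a single
  vector, so that \<open>descend1\<close> and \<open>descend2\<close> only see values at
  \<open>reeb\<close>.\<close>

lemma quot_tangent_proj_reeb:
  assumes x: "x \<in> S"
  shows "quot_tangent_proj S f (x, reeb x) = (\<lambda>y. (y, reeb y)) ` orbit_proj S f x"
proof -
  have tb: "((f ^^ i) x, (f ^^ i) (reeb x)) \<in> tangent_bundle S" for i
    unfolding tangent_bundle_iff grad_rotation_pow inner_rotation_pow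
    using A.inv_pow[OF x] grad_reeb by blast
  have "quot_tangent_proj S f (x, reeb x) = {((f ^^ i) x, (f ^^ i) (reeb x)) |i. True}"
    unfolding quot_tangent_proj_def orbit_proj_def action_rel_def
    using tb[of 0] tb by (auto simp: tangent_map_pow)
  also have "\<dots> = (\<lambda>y. (y, reeb y)) ` orbit_proj S f x"
    using x A.inv_pow by (auto simp: orbit_proj_def action_rel_def reeb_rotation_pow)
  finally show ?thesis .
qed

lemma reeb_is_reeb_vector:
  assumes x: "x \<in> S"
  shows "is_reeb_vector liouville_form S f (orbit_proj S f x) (quot_tangent_proj S f (x, reeb x))"
proof -
  let ?\<xi> = "quot_tangent_proj S f (x, reeb x)" and ?q = "orbit_proj S f x"
  note \<xi> = quot_tangent_proj_reeb[OF x]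
  have qS: "?q \<subseteq> S" by (auto simp: orbit_proj_def action_rel_def)
  have xq: "x \<in> ?q" using x by (auto simp: orbit_proj_def action_rel_def intro: exI[of _ 0])
  have TB: "(x, reeb x) \<in> tangent_bundle S" using x grad_reeb by (simp add: tangent_bundle_iff)
  have 1: "?\<xi> \<in> quot_tangent_space S f ?q"
    unfolding quot_tangent_space_def
  proof (intro CollectI conjI)
    show "?\<xi> \<in> tangent_bundle S // action_rel (tangent_bundle S) (tangent_map f)"
      unfolding quot_tangent_proj_def orbit_proj_def using TB by (rule quotientI)
    show "fst ` ?\<xi> = ?q" unfolding \<xi> by force
  qed
  have form: "liouville_form y (reeb y) = 1" if "y \<in> S" for y
    unfolding liouville_form_inner cmul_i_reeb using grad_self[OF that] by (simp add: inner_commute)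
  have 2: "descend1 liouville_form ?\<xi> = 1"
    unfolding descend1_def
  proof (rule the_equality)
    have "(x, reeb x) \<in> ?\<xi>" unfolding \<xi> using xq by blast
    then show "\<exists>y v. (y, v) \<in> ?\<xi> \<and> 1 = liouville_form y v" using form[OF x] by metis
    show "r = 1" if "\<exists>y v. (y, v) \<in> ?\<xi> \<and> r = liouville_form y v" for r
      using that form qS unfolding \<xi> by auto
  qed
  have 3: "descend2 (ext_deriv liouville_form) ?\<xi> \<eta> = 0" if \<eta>: "\<eta> \<in> quot_tangent_space S f ?q" for \<eta>
    unfolding descend2_def
  proof (rule the_equality)
    have \<eta>TB: "\<eta> \<subseteq> tangent_bundle S" and \<eta>q: "fst ` \<eta> = ?q"
      using \<eta> by (auto simp: quot_tangent_space_def quotient_def action_rel_def)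
    have zero: "ext_deriv liouville_form y u v = 0" if "(y, u) \<in> ?\<xi>" "(y, v) \<in> \<eta>" for y u v
    proof -
      have u: "u = cmul (- \<i>) (grad y)" using that unfolding \<xi> by (auto simp: reeb_def)
      have "u = - cmul \<i> (grad y)" unfolding u by (simp add: cmul_def vec_eq_iff)
      then have "u \<bullet> cmul \<i> v = - (grad y \<bullet> v)" by (simp add: inner_cmul)
      moreover have "grad y \<bullet> v = 0" using that(2) \<eta>TB tangent_bundle_iff by blast
      ultimately show ?thesis by (simp add: ext_deriv_liouville)
    qed
    \<comment> \<open>The uniqueness shown by \<open>zero\<close> is not enough for
      \<open>THE\<close>: some vector of \<open>\<eta>\<close> must share its base point with one of
      the Reeb class.\<close>
    obtain v where v: "(x, v) \<in> \<eta>" using xq \<eta>q by force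
    have "(x, reeb x) \<in> ?\<xi>" unfolding \<xi> using xq by blast
    then show "\<exists>y u v. (y, u) \<in> ?\<xi> \<and> (y, v) \<in> \<eta> \<and> 0 = ext_deriv liouville_form y u v"
      using v zero by metis
    show "r = 0" if "\<exists>y u v. (y, u) \<in> ?\<xi> \<and> (y, v) \<in> \<eta> \<and> r = ext_deriv liouville_form y u v" for r
      using that zero by blast
  qed
  show ?thesis unfolding is_reeb_vector_def using 1 2 3 by blast
qed

end

section \<open>Real coordinates\<close>

definition to_complex :: "(real ^ 'n) \<times> (real ^ 'n) \<Rightarrow> complex ^ 'n" where
  "to_complex z = (\<chi> j. Complex (fst z $ j) (snd z $ j))"

definition of_complex_vec :: "complex ^ 'n \<Rightarrow> (real ^ 'n) \<times> (real ^ 'n)" where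
  "of_complex_vec z = (\<chi> j. Re (z $ j), \<chi> j. Im (z $ j))"

lemma to_complex_linear: "linear to_complex"
  by (rule linearI) (simp_all add: to_complex_def vec_eq_iff complex_eq_iff)

lemma of_complex_linear: "linear of_complex_vec"
  by (rule linearI) (simp_all add: of_complex_vec_def vec_eq_iff prod_eq_iff)

lemma inner_to_complex: "w \<bullet> to_complex z = of_complex_vec w \<bullet> z"
  by (simp add: to_complex_def of_complex_vec_def inner_vec_def inner_prod_def inner_complex_def sum.distrib)

lemma to_complex_eq_0: "to_complex z = 0 \<longleftrightarrow> z = 0"
  by (auto simp: to_complex_def vec_eq_iff complex_eq_iff prod_eq_iff)

text \<open>With \<open>q\<close> as real and \<open>p\<close> as imaginary part, the right-hand
  side of Hamilton's equations is the multiple of the gradient that defines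
  \<open>reeb\<close>.\<close>

lemma to_complex_hamilton: "to_complex (snd (of_complex_vec w), - fst (of_complex_vec w)) = cmul (- \<i>) w"
  by (simp add: to_complex_def of_complex_vec_def cmul_def vec_eq_iff complex_eq_iff)

section \<open>The orbit and its lift\<close>

context symmetric_star_domain
begin

text \<open>\<open>hamil\<close> is constant along the limit solution, which is not identically 0
  and therefore stays on a positive multiple of \<open>S\<close>. As \<open>reeb\<close> is
  homogeneous of degree 1, scaling it onto \<open>S\<close> keeps the multiplier
  \<open>l\<close>.\<close>

lemma half_periodic_flow_line:
  obtains z l where "l > 0" "continuous_on {0..3} z"
    "\<And>t. t \<in> {0..3} \<Longrightarrow> z t \<in> S"
    "\<And>t. t \<in> {0..2} \<Longrightarrow> z (t + 1) = - z t"
    "\<And>t. 0 < t \<Longrightarrow> t < 3 \<Longrightarrow> (z has_vector_derivative l *\<^sub>R reeb (z t)) (at t)"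
proof -
  interpret HH: homogeneous_hamiltonian hamil grad by (rule homogeneous_hamiltonian)
  have bl1: "bounded_linear (to_complex :: _ \<Rightarrow> complex ^ 'n)"
    using to_complex_linear linear_conv_bounded_linear by blast
  have bl2: "bounded_linear (of_complex_vec :: complex ^ 'n \<Rightarrow> _)"
    using of_complex_linear linear_conv_bounded_linear by blast
  interpret O: odd_hamiltonian "\<lambda>z. hamil (to_complex z)" "\<lambda>z. of_complex_vec (grad (to_complex z))"
  proof
    fix z :: "(real ^ 'n) \<times> (real ^ 'n)" and t :: real
    have "((\<lambda>z. hamil (to_complex z)) has_derivative (\<lambda>h. grad (to_complex z) \<bullet> to_complex h)) (at z)"
      by (rule has_derivative_compose[OF bounded_linear_imp_has_derivative[OF bl1] HH.H_deriv])
    then show "((\<lambda>z. hamil (to_complex z)) has_derivative (\<lambda>h. of_complex_vec (grad (to_complex z)) \<bullet> h)) (at z)"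
      by (simp add: inner_to_complex)
    show "continuous_on UNIV (\<lambda>z::(real ^ 'n) \<times> (real ^ 'n). of_complex_vec (grad (to_complex z)))"
      by (intro bounded_linear.continuous_on[OF bl2] continuous_on_compose2[OF HH.F_cont]
          bounded_linear.continuous_on[OF bl1] continuous_on_id) auto
    show "of_complex_vec (grad (to_complex (t *\<^sub>R z))) = t *\<^sub>R of_complex_vec (grad (to_complex z))" if "0 \<le> t"
      using that by (simp add: linear_cmul[OF to_complex_linear] linear_cmul[OF of_complex_linear] HH.F_scale)
    show "hamil (to_complex 0) = 0" by (simp add: linear_0[OF to_complex_linear] HH.H_0)
    show "hamil (to_complex z) > 0" if "z \<noteq> 0" using that by (intro HH.H_pos) (simp add: to_complex_eq_0)
    show "of_complex_vec (grad (to_complex (- z))) = - of_complex_vec (grad (to_complex z))"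
      by (simp add: linear_neg[OF to_complex_linear] linear_neg[OF of_complex_linear] grad_odd)
  qed
  obtain g l where l: "l > 0" and gc: "continuous_on {0..3} g"
    and gper: "\<And>t. t \<in> {0..2} \<Longrightarrow> g (t + 1) = - g t"
    and gnz: "\<exists>t\<in>{0..1}. g t \<noteq> 0"
    and gd: "\<And>t. 0 < t \<Longrightarrow> t < 3 \<Longrightarrow> (g has_vector_derivative l *\<^sub>R (snd (of_complex_vec (grad (to_complex (g t)))),
        - fst (of_complex_vec (grad (to_complex (g t)))))) (at t)"
    by (rule O.antiperiodic_limit) blast
  define y where "y = (\<lambda>t. to_complex (g t))"
  have yc: "continuous_on {0..3} y" unfolding y_def by (rule bounded_linear.continuous_on[OF bl1 gc])
  have yper: "y (t + 1) = - y t" if "t \<in> {0..2}" for t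
    using gper[OF that] by (simp add: y_def linear_neg[OF to_complex_linear])
  have yd: "(y has_vector_derivative l *\<^sub>R reeb (y t)) (at t)" if "0 < t" "t < 3" for t
    using bounded_linear.has_vector_derivative[OF bl1 gd[OF that]]
    unfolding y_def reeb_def linear_cmul[OF to_complex_linear] to_complex_hamilton .
  have Hd: "DERIV (\<lambda>t. hamil (y t)) t :> 0" if "0 < t" "t < 3" for t
  proof -
    have "((\<lambda>t. hamil (y t)) has_derivative (\<lambda>h. grad (y t) \<bullet> (h *\<^sub>R (l *\<^sub>R reeb (y t))))) (at t)"
      by (rule has_derivative_compose[OF yd[OF that, unfolded has_vector_derivative_def] HH.H_deriv])
    moreover have "(\<lambda>h. grad (y t) \<bullet> (h *\<^sub>R (l *\<^sub>R reeb (y t)))) = (\<lambda>h. 0 * h)"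
      by (simp add: grad_reeb)
    ultimately show ?thesis unfolding has_field_derivative_def by (simp only:)
  qed
  have Hc: "continuous_on {0..3} (\<lambda>t. hamil (y t))"
    by (rule continuous_on_compose2[OF HH.H_cont[of UNIV] yc]) auto
  have Hconst: "hamil (y t) = hamil (y 0)" if "t \<in> {0..3}" for t
  proof (cases "t = 0")
    case False
    show ?thesis
    proof (rule DERIV_isconst_end[of 0 t "\<lambda>t. hamil (y t)"])
      show "0 < t" using that False by auto
      show "continuous_on {0..t} (\<lambda>t. hamil (y t))" using Hc by (rule continuous_on_subset) (use that in auto)
      show "DERIV (\<lambda>t. hamil (y t)) s :> 0" if "0 < s" "s < t" for s
        using Hd[of s] that \<open>t \<in> {0..3}\<close> by auto
    qed
  qed simp
  obtain t0 where t0: "t0 \<in> {0..1}" "g t0 \<noteq> 0" using gnz by blast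
  define c where "c = minkowski (y 0)"
  have "hamil (y 0) = hamil (y t0)" using Hconst[of t0] t0 by auto
  also have "\<dots> > 0" using t0 by (intro HH.H_pos) (simp add: y_def to_complex_eq_0)
  finally have "y 0 \<noteq> 0" using HH.H_0 by auto
  then have c: "c > 0" unfolding c_def by (rule minkowski_pos)
  have mc: "minkowski (y t) = c" if "t \<in> {0..3}" for t
  proof -
    have "hamil (y t) = hamil (y 0)" by (rule Hconst[OF that])
    moreover have "minkowski (y t) \<ge> 0" using minkowski_pos[of "y t"] minkowski_0 by (cases "y t = 0") auto
    ultimately show ?thesis using c unfolding hamil_def c_def by (simp add: power2_eq_iff_nonneg)
  qed
  define z where "z = (\<lambda>t. (1 / c) *\<^sub>R y t)"
  show ?thesis
  proof (rule that[OF l])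
    show "continuous_on {0..3} z" unfolding z_def by (intro continuous_intros yc)
    show "z t \<in> S" if "t \<in> {0..3}" for t
      using mc[OF that] c by (intro minkowski_eq_1) (simp add: z_def minkowski_scale)
    show "z (t + 1) = - z t" if "t \<in> {0..2}" for t using yper[OF that] by (simp add: z_def)
    show "(z has_vector_derivative l *\<^sub>R reeb (z t)) (at t)" if "0 < t" "t < 3" for t
    proof -
      have "(z has_vector_derivative (1 / c) *\<^sub>R (l *\<^sub>R reeb (y t))) (at t)"
        unfolding z_def by (intro bounded_linear.has_vector_derivative[OF bounded_linear_scaleR_right] yd that)
      moreover have "reeb (z t) = (1 / c) *\<^sub>R reeb (y t)"
        unfolding reeb_def z_def using c by (simp add: HH.F_scale linear_cmul[OF linear_cmul_vec])
      ultimately show ?thesis by (simp add: mult.commute)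
    qed
  qed
qed

lemma noncontractible_reeb_orbit:
  "\<exists>T \<gamma>. periodic_reeb_orbit liouville_form S f T \<gamma> \<and>
     \<not> null_homotopic_loop (quotient_space S f) (\<lambda>s. \<gamma> (T * s))"
proof -
  obtain z l where l: "l > 0" and zc: "continuous_on {0..3} z"
    and zS: "\<And>t. t \<in> {0..3} \<Longrightarrow> z t \<in> S"
    and zper: "\<And>t. t \<in> {0..2} \<Longrightarrow> z (t + 1) = - z t"
    and zd: "\<And>t. 0 < t \<Longrightarrow> t < 3 \<Longrightarrow> (z has_vector_derivative l *\<^sub>R reeb (z t)) (at t)"
    by (rule half_periodic_flow_line) blast
  \<comment> \<open>The summand 1 moves the argument into \<open>{1..2}\<close>, away from the ends
    of the interval on which \<open>z\<close> is known.\<close>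
  define \<gamma> where "\<gamma> = (\<lambda>t. orbit_proj S f (z (frac (t / l) + 1)))"
  have shift: "orbit_proj S f (z (t + 1)) = orbit_proj S f (z t)" if "t \<in> {0..2}" for t
    using zper[OF that] orbit_proj_minus[OF zS, of t] that by simp
  have "periodic_reeb_orbit liouville_form S f l \<gamma>"
    unfolding periodic_reeb_orbit_def
  proof (intro conjI allI)
    show "l > 0" by (rule l)
    show "\<gamma> (t + l) = \<gamma> t" for t
    proof -
      have "(t + l) / l = t / l + 1" using l by (simp add: add_divide_distrib)
      then show ?thesis by (simp add: \<gamma>_def frac_1_eq)
    qed
    fix t
    define n where "n = real_of_int \<lfloor>t / l\<rfloor>"
    \<comment> \<open>Freezing the integer part at \<open>t\<close> gives a lift that is
      differentiable across the jumps of \<open>frac\<close>.\<close>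
    define c where "c = (\<lambda>s. z (s / l - n + 1))"
    have tn: "n \<le> t / l" "t / l < n + 1" by (auto simp: n_def)
    have ct: "c t \<in> S" unfolding c_def using tn by (intro zS) auto
    have \<gamma>t: "\<gamma> t = orbit_proj S f (c t)" by (simp add: \<gamma>_def c_def n_def frac_def)
    have "quot_velocity S f \<gamma> t (quot_tangent_proj S f (c t, reeb (c t)))"
      unfolding quot_velocity_def
    proof (intro exI conjI)
      \<comment> \<open>Just below \<open>n\<close> the curve \<open>\<gamma>\<close> uses the
        preceding branch, which differs from the lift by the half turn. The bound
        \<open>n - 1/2\<close> keeps the argument of \<open>z\<close> positive there.\<close>
      have "open {s. n - 1/2 < s / l \<and> s / l < n + 1}"
        by (intro open_Collect_conj open_Collect_less continuous_intros) (use l in auto)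
      then have "\<forall>\<^sub>F s in nhds t. s \<in> {s. n - 1/2 < s / l \<and> s / l < n + 1}"
        by (rule eventually_nhds_in_open) (use tn in auto)
      then show "\<forall>\<^sub>F s in nhds t. c s \<in> S \<and> \<gamma> s = orbit_proj S f (c s)"
      proof eventually_elim
        fix s assume "s \<in> {s. n - 1/2 < s / l \<and> s / l < n + 1}"
        then have s: "n - 1/2 < s / l" "s / l < n + 1" by auto
        have "\<gamma> s = orbit_proj S f (c s)"
        proof (cases "n \<le> s / l")
          case True
          then have "\<lfloor>s / l\<rfloor> = \<lfloor>t / l\<rfloor>" using s unfolding n_def by (intro floor_unique) auto
          then show ?thesis by (simp add: \<gamma>_def c_def frac_def n_def)
        next
          case False
          then have "\<lfloor>s / l\<rfloor> = \<lfloor>t / l\<rfloor> - 1" using s unfolding n_def by (intro floor_unique) auto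
          then have "frac (s / l) + 1 = (s / l - n + 1) + 1" by (simp add: frac_def n_def)
          then show ?thesis using shift[of "s / l - n + 1"] s False by (simp add: \<gamma>_def c_def)
        qed
        moreover have "c s \<in> S" unfolding c_def using s by (intro zS) auto
        ultimately show "c s \<in> S \<and> \<gamma> s = orbit_proj S f (c s)" by blast
      qed
      have "((\<lambda>s. s / l - n + 1) has_vector_derivative 1 / l) (at t)"
        using l by (auto intro!: derivative_eq_intros simp: has_real_derivative_iff_has_vector_derivative[symmetric])
      moreover have "(z has_vector_derivative l *\<^sub>R reeb (c t)) (at (t / l - n + 1))"
        unfolding c_def using tn by (intro zd) auto
      ultimately have "(z \<circ> (\<lambda>s. s / l - n + 1) has_vector_derivative (1 / l) *\<^sub>R (l *\<^sub>R reeb (c t))) (at t)"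
        by (rule vector_diff_chain_at)
      then show "(c has_vector_derivative reeb (c t)) (at t)" using l by (simp add: c_def o_def)
    qed (rule refl)
    moreover have "is_reeb_vector liouville_form S f (\<gamma> t) (quot_tangent_proj S f (c t, reeb (c t)))"
      unfolding \<gamma>t by (rule reeb_is_reeb_vector[OF ct])
    ultimately show "\<exists>\<xi>. quot_velocity S f \<gamma> t \<xi> \<and> is_reeb_vector liouville_form S f (\<gamma> t) \<xi>" by blast
  qed
  moreover have "\<not> null_homotopic_loop (quotient_space S f) (\<lambda>s. \<gamma> (l * s))"
  proof
    \<comment> \<open>This lift of the loop runs from \<open>z 1\<close> to
      \<open>z 2 = - z 1\<close>; equal ends would force \<open>z 1 = 0\<close>, and 0 is not in
      \<open>S\<close>.\<close>
    define c where "c = (\<lambda>s. z (s + 1))"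
    have eq: "\<gamma> (l * s) = orbit_proj S f (c s)" if "s \<in> {0..1}" for s
    proof (cases "s = 1")
      case True
      then show ?thesis using shift[of 1] l by (simp add: \<gamma>_def c_def)
    next
      case False
      then have "frac s = s" using that by (simp add: frac_eq)
      then show ?thesis using l by (simp add: \<gamma>_def c_def)
    qed
    assume "null_homotopic_loop (quotient_space S f) (\<lambda>s. \<gamma> (l * s))"
    then obtain y where y: "y \<in> topspace (quotient_space S f)"
      "homotopic_with (\<lambda>r. r 1 = r 0) (top_of_set {0..1}) (quotient_space S f) (\<lambda>s. \<gamma> (l * s)) (\<lambda>_. y)"
      unfolding null_homotopic_loop_def by blast
    have "homotopic_with (\<lambda>r. r 1 = r 0) (top_of_set {0..1}) (quotient_space S f) (\<lambda>s. orbit_proj S f (c s)) (\<lambda>_. y)"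
      by (rule homotopic_with_eq[OF y(2)]) (auto simp: eq)
    then have "null_homotopic_loop (quotient_space S f) (\<lambda>s. orbit_proj S f (c s))"
      unfolding null_homotopic_loop_def using y(1) by blast
    moreover have "path c" unfolding path_def c_def
      by (rule continuous_on_compose2[OF zc]) (auto intro!: continuous_intros)
    moreover have "path_image c \<subseteq> S" unfolding path_image_def c_def using zS by auto
    ultimately have "c 1 = c 0" by (intro A.null_homotopic_lift_closed)
    then have "z 1 = - z 1" using zper[of 1] by (simp add: c_def)
    then have "2 *\<^sub>R z 1 = 0" by (metis add.right_inverse scaleR_2)
    then have "z 1 = 0" by simp
    then show False using S_nonzero[OF zS[of 1]] by simp
  qed
  ultimately show ?thesis by blast
qed

end

theorem theorem1p1:
  fixes \<Sigma> :: "(complex ^ 'n) set" and m :: nat and k :: "'n \<Rightarrow> int"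
  assumes "CARD('n) \<ge> 2"
    and "compact \<Sigma>" and "connected \<Sigma>" and "star_shaped_hypersurface \<Sigma>"
    and "even m" and "m \<ge> 2" and "\<And>j. coprime (k j) (int m)"
    and "rotation m k ` \<Sigma> = \<Sigma>"
  shows "\<exists>T \<gamma>. periodic_reeb_orbit liouville_form \<Sigma> (rotation m k) T \<gamma> \<and>
           \<not> null_homotopic_loop (quotient_space \<Sigma> (rotation m k)) (\<lambda>s. \<gamma> (T * s))"
proof -
  obtain U where U: "open U \<and> bounded U \<and> connected U \<and> 0 \<in> U \<and> (\<forall>x\<in>U. closed_segment 0 x \<subseteq> U) \<and>
      \<Sigma> = frontier U \<and> smooth_boundary U \<and> outward_pointing U liouville_field"
    using assms(4)[unfolded star_shaped_hypersurface_def] by (rule exE)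
  interpret symmetric_star_domain U \<Sigma> m k
  proof
    show "open U" "bounded U" "0 \<in> U" "\<Sigma> = frontier U" "smooth_boundary U"
      "outward_pointing U liouville_field"
      using U by simp_all
    show "closed_segment 0 x \<subseteq> U" if "x \<in> U" for x
      using U that by (elim conjE) (rule bspec)
  qed (fact assms(5-8))+
  show ?thesis by (rule noncontractible_reeb_orbit)
qed

end
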